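(* Let $n\ge2$, $s\in(0,\frac12)$, and let $\Omega\subset\mathbb{R}^n$ be a bounded Lipschitz domain. Assume the standing assumptions on $a$ and $L$ given in the context and, in addition, that for all $\mathsf m>0$ and $u\in[-\mathsf m,\mathsf m]$, $a(\cdot,u),\frac{\partial L}{\partial u}(\cdot,u)\in L^2(\Omega)$. If $(\bar u,\bar p,\bar z)\in\tilde H^s(\Omega)\times\tilde H^s(\Omega)\times\mathbb Z_{ad}$ denotes an optimal triplet of the fractional semilinear optimal control problem, then $$\bar u,\ \bar p,\ \bar z\in H^{2s-2\epsilon}(\Omega)\qquad\text{for every }\epsilon\in(0,s).$$
   Context: Spaces and bilinear form: $\tilde H^s(\Omega)=\{v|_\Omega: v\in H^s(\mathbb{R}^n),\ \operatorname{supp}v\subset\overline\Omega\}$ (functions extended by zero outside $\Omega$); $\mathcal A(v,w)=\frac{C(n,s)}2\iint_{\mathbb{R}^n\times\mathbb{R}^n}\frac{(v(x)-v(y))(w(x)-w(y))}{|x-y|^{n+2s}}dx\,dy$, $C(n,s)=\frac{2^{2s}s\Gamma(s+n/2)}{\pi^{n/2}\Gamma(1-s)}$. Standing assumptions. $a:\Omega\times\mathbb{R}\to\mathbb{R}$ is Carath\'eodory, of class $C^2$ in the second variable, $a(\cdot,0)\in L^r(\Omega)$ with $r>n/(2s)$; $\frac{\partial a}{\partial u}(x,u)\ge0$ for a.e. $x\in\Omega$ and all $u\in\mathbb{R}$; for all $\mathfrak m>0$ there is $C_{\mathfrak m}>0$ with $\sum_{i=1}^2|\frac{\partial^ia}{\partial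 u^i}(x,u)|\le C_{\mathfrak m}$ and $|\frac{\partial^2a}{\partial u^2}(x,v)-\frac{\partial^2a}{\partial u^2}(x,w)|\le C_{\mathfrak m}|v-w|$ for a.e. $x\in\Omega$ and $u,v,w\in[-\mathfrak m,\mathfrak m]$. $L:\Omega\times\mathbb{R}\to\mathbb{R}$ is Carath\'eodory, of class $C^2$ in the second variable, $L(\cdot,0)\in L^1(\Omega)$; for all $\mathfrak m>0$ there are $\psi_{\mathfrak m},\phi_{\mathfrak m}\in L^r(\Omega)$, $r>n/(2s)$, with $|\frac{\partial L}{\partial u}(x,u)|\le\psi_{\mathfrak m}(x)$ and $|\frac{\partial^2L}{\partial u^2}(x,u)|\le\phi_{\mathfrak m}(x)$ for a.e. $x\in\Omega$ and $u\in[-\mathfrak m,\mathfrak m]$. Control problem: let $\alpha>0$ and $\mathfrak a<\mathfrak b$ be real, $\mathbb Z_{ad}=\{v\in L^2(\Omega):\mathfrak a\le v\le\mathfrak b\text{ a.e. in }\Omega\}$, $J(u,z)=\int_\Omega L(x,u(x))dx+\frac\alpha2\|z\|_{L^2(\Omega)}^2$. Minimize $J(u,z)$ over $(u,z)\in\tilde H^s(\Omega)\times\mathbb Z_{ad}$ subject to the state equation $\mathcal A(u,v)+(a(\cdot,u),v)_{L^2(\Omega)}=(z,v)_{L^2(\Omega)}$ for all $v\in\tilde H^s(\Omega)$; its unique solution is $u=\mathcal Sz\in\tilde H^s(\Omega)\cap L^\infty(\Omega)$. Optimal triplet $(\bar u,\bar p,\bar z)$: $\bar z\in\mathbb Z_{ad}$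 is a locally optimal control (a local minimizer of $z\mapsto J(\mathcal Sz,z)$ on $\mathbb Z_{ad}$ in the sense of $L^2(\Omega)$), $\bar u=\mathcal S\bar z$, and $\bar p\in\tilde H^s(\Omega)\cap L^\infty(\Omega)$ solves the adjoint equation $\mathcal A(v,\bar p)+(\frac{\partial a}{\partial u}(\cdot,\bar u)\bar p,v)_{L^2(\Omega)}=(\frac{\partial L}{\partial u}(\cdot,\bar u),v)_{L^2(\Omega)}$ for all $v\in\tilde H^s(\Omega)$. These satisfy $(\bar p+\alpha\bar z,z-\bar z)_{L^2(\Omega)}\ge0$ for all $z\in\mathbb Z_{ad}$. *)

theory Defs
  imports "HOL-Analysis.Analysis"
begin

section \<open>Domains\<close>

text \<open>Near every boundary point the set is, inside a ball, the strict epigraph of a Lipschitz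
  function over the hyperplane orthogonal to some unit vector \<open>e\<close> (the rotated
  last coordinate axis); \<open>x - (x \<bullet> e) *\<^sub>R e\<close> is the projection of \<open>x\<close> onto
  that hyperplane.\<close>

definition lipschitz_boundary :: "(real ^ 'n) set \<Rightarrow> bool" where
  "lipschitz_boundary \<Omega> \<longleftrightarrow>
     (\<forall>p \<in> frontier \<Omega>. \<exists>\<rho> > 0. \<exists>e K \<gamma>. norm e = 1 \<and> K-lipschitz_on {y. y \<bullet> e = 0} \<gamma> \<and>
        \<Omega> \<inter> ball p \<rho> = {x \<in> ball p \<rho>. (\<gamma> (x - (x \<bullet> e) *\<^sub>R e) :: real) < x \<bullet> e})"

definition bounded_lipschitz_domain :: "(real ^ 'n) set \<Rightarrow> bool" where
  "bounded_lipschitz_domain \<Omega> \<longleftrightarrow>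
     open \<Omega> \<and> connected \<Omega> \<and> \<Omega> \<noteq> {} \<and> bounded \<Omega> \<and> lipschitz_boundary \<Omega>"

section \<open>Function spaces\<close>

text \<open>Elements of function spaces on a set \<open>U\<close> are represented by functions on the
  whole space, of which only the values on \<open>U\<close> (up to null sets) matter.\<close>

definition Lp_space :: "real \<Rightarrow> (real ^ 'n) set \<Rightarrow> (real ^ 'n \<Rightarrow> real) set" where
  "Lp_space p U = {f \<in> borel_measurable (lebesgue_on U).
                     integrable (lebesgue_on U) (\<lambda>x. \<bar>f x\<bar> powr p)}"

definition Linf_space :: "(real ^ 'n) set \<Rightarrow> (real ^ 'n \<Rightarrow> real) set" where
  "Linf_space U = {f \<in> borel_measurable (lebesgue_on U).
                     \<exists>M. AE x in lebesgue_on U. \<bar>f x\<bar> \<le> M}"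

definition L2_inner ::
    "(real ^ 'n) set \<Rightarrow> (real ^ 'n \<Rightarrow> real) \<Rightarrow> (real ^ 'n \<Rightarrow> real) \<Rightarrow> real" where
  "L2_inner U f g = (\<integral>x. f x * g x \<partial>(lebesgue_on U))"

definition L2_norm :: "(real ^ 'n) set \<Rightarrow> (real ^ 'n \<Rightarrow> real) \<Rightarrow> real" where
  "L2_norm U f = sqrt (L2_inner U f f)"

text \<open>The Sobolev--Slobodeckij space of order \<open>t\<close> strictly between 0 and 1: square integrable
  functions with finite Gagliardo seminorm. On the diagonal \<open>x = y\<close>, a null set, the
  integrand is \<open>0 / 0 = 0\<close>.\<close>

definition sobolev_space :: "real \<Rightarrow> (real ^ 'n) set \<Rightarrow> (real ^ 'n \<Rightarrow> real) set" where
  "sobolev_space t U = {v \<in> Lp_space 2 U.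
     (\<integral>\<^sup>+ (x, y). ennreal ((v x - v y)\<^sup>2 / norm (x - y) powr (real CARD('n) + 2 * t))
        \<partial>(lebesgue_on U \<Otimes>\<^sub>M lebesgue_on U)) < \<infinity>}"

text \<open>The complement of the largest open set on which \<open>v\<close> vanishes almost everywhere.\<close>

definition ess_support :: "(real ^ 'n \<Rightarrow> real) \<Rightarrow> (real ^ 'n) set" where
  "ess_support v = - \<Union>{U. open U \<and> (AE x in lebesgue. x \<in> U \<longrightarrow> v x = 0)}"

text \<open>Restrictions to \<open>\<Omega>\<close> are identified with their extensions by zero, so the
  members of this space are functions on the whole space that vanish outside \<open>\<Omega>\<close>.\<close>

definition tilde_H :: "real \<Rightarrow> (real ^ 'n) set \<Rightarrow> (real ^ 'n \<Rightarrow> real) set" where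
  "tilde_H s \<Omega> = {(\<lambda>x. if x \<in> \<Omega> then v x else 0) | v.
                     v \<in> sobolev_space s UNIV \<and> ess_support v \<subseteq> closure \<Omega>}"

section \<open>The bilinear form of the fractional Laplacian\<close>

definition frac_const :: "nat \<Rightarrow> real \<Rightarrow> real" where
  "frac_const n s = 2 powr (2 * s) * s * Gamma (s + real n / 2) /
                    (pi powr (real n / 2) * Gamma (1 - s))"

definition frac_form :: "real \<Rightarrow> (real ^ 'n \<Rightarrow> real) \<Rightarrow> (real ^ 'n \<Rightarrow> real) \<Rightarrow> real" where
  "frac_form s v w = frac_const CARD('n) s / 2 *
     (\<integral>(x, y). (v x - v y) * (w x - w y) / norm (x - y) powr (real CARD('n) + 2 * s)
        \<partial>(lebesgue \<Otimes>\<^sub>M lebesgue))"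

section \<open>Nonlinearities\<close>

text \<open>First and second partial derivative with respect to the second variable.\<close>

definition D1 :: "('a \<Rightarrow> real \<Rightarrow> real) \<Rightarrow> 'a \<Rightarrow> real \<Rightarrow> real" where
  "D1 g x u = deriv (g x) u"

definition D2 :: "('a \<Rightarrow> real \<Rightarrow> real) \<Rightarrow> 'a \<Rightarrow> real \<Rightarrow> real" where
  "D2 g x u = deriv (D1 g x) u"

definition caratheodory :: "(real ^ 'n) set \<Rightarrow> (real ^ 'n \<Rightarrow> real \<Rightarrow> real) \<Rightarrow> bool" where
  "caratheodory \<Omega> g \<longleftrightarrow>
     (\<forall>u. (\<lambda>x. g x u) \<in> borel_measurable (lebesgue_on \<Omega>)) \<and>
     (AE x in lebesgue_on \<Omega>. continuous_on UNIV (g x))"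

definition C2_second :: "(real ^ 'n) set \<Rightarrow> (real ^ 'n \<Rightarrow> real \<Rightarrow> real) \<Rightarrow> bool" where
  "C2_second \<Omega> g \<longleftrightarrow>
     (AE x in lebesgue_on \<Omega>.
        (\<forall>u. g x field_differentiable (at u)) \<and>
        (\<forall>u. D1 g x field_differentiable (at u)) \<and>
        continuous_on UNIV (D2 g x))"

definition standing_a :: "real \<Rightarrow> (real ^ 'n) set \<Rightarrow> (real ^ 'n \<Rightarrow> real \<Rightarrow> real) \<Rightarrow> bool" where
  "standing_a s \<Omega> a \<longleftrightarrow>
     caratheodory \<Omega> a \<and> C2_second \<Omega> a \<and>
     (\<exists>r > real CARD('n) / (2 * s). (\<lambda>x. a x 0) \<in> Lp_space r \<Omega>) \<and>
     (AE x in lebesgue_on \<Omega>. \<forall>u. D1 a x u \<ge> 0) \<and>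
     (\<forall>m > 0. \<exists>C > 0. AE x in lebesgue_on \<Omega>.
        \<forall>u \<in> {-m..m}. \<forall>v \<in> {-m..m}. \<forall>w \<in> {-m..m}.
          \<bar>D1 a x u\<bar> + \<bar>D2 a x u\<bar> \<le> C \<and> \<bar>D2 a x v - D2 a x w\<bar> \<le> C * \<bar>v - w\<bar>)"

definition standing_L :: "real \<Rightarrow> (real ^ 'n) set \<Rightarrow> (real ^ 'n \<Rightarrow> real \<Rightarrow> real) \<Rightarrow> bool" where
  "standing_L s \<Omega> L \<longleftrightarrow>
     caratheodory \<Omega> L \<and> C2_second \<Omega> L \<and>
     (\<lambda>x. L x 0) \<in> Lp_space 1 \<Omega> \<and>
     (\<exists>r > real CARD('n) / (2 * s). \<forall>m > 0.
        \<exists>\<psi> \<in> Lp_space r \<Omega>. \<exists>\<phi> \<in> Lp_space r \<Omega>.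
          AE x in lebesgue_on \<Omega>. \<forall>u \<in> {-m..m}. \<bar>D1 L x u\<bar> \<le> \<psi> x \<and> \<bar>D2 L x u\<bar> \<le> \<phi> x)"

section \<open>The optimal control problem\<close>

definition Z_ad :: "(real ^ 'n) set \<Rightarrow> real \<Rightarrow> real \<Rightarrow> (real ^ 'n \<Rightarrow> real) set" where
  "Z_ad \<Omega> lo hi = {z \<in> Lp_space 2 \<Omega>. AE x in lebesgue_on \<Omega>. lo \<le> z x \<and> z x \<le> hi}"

definition cost ::
    "(real ^ 'n) set \<Rightarrow> (real ^ 'n \<Rightarrow> real \<Rightarrow> real) \<Rightarrow> real \<Rightarrow>
     (real ^ 'n \<Rightarrow> real) \<Rightarrow> (real ^ 'n \<Rightarrow> real) \<Rightarrow> real" where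
  "cost \<Omega> L \<alpha> u z = (\<integral>x. L x (u x) \<partial>(lebesgue_on \<Omega>)) + \<alpha> / 2 * (L2_norm \<Omega> z)\<^sup>2"

text \<open>\<open>is_state s \<Omega> a z u\<close> says \<open>u = \<S> z\<close>. The control-to-state map
  \<open>\<S>\<close> is given by its graph because the solution of the state equation is unique only up to
  equality almost everywhere.\<close>

definition is_state ::
    "real \<Rightarrow> (real ^ 'n) set \<Rightarrow> (real ^ 'n \<Rightarrow> real \<Rightarrow> real) \<Rightarrow>
     (real ^ 'n \<Rightarrow> real) \<Rightarrow> (real ^ 'n \<Rightarrow> real) \<Rightarrow> bool" where
  "is_state s \<Omega> a z u \<longleftrightarrow>
     u \<in> tilde_H s \<Omega> \<inter> Linf_space \<Omega> \<and>
     (\<forall>v \<in> tilde_H s \<Omega>. frac_form s u v + L2_inner \<Omega> (\<lambda>x. a x (u x)) v = L2_inner \<Omega> z v)"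

definition is_adjoint_state ::
    "real \<Rightarrow> (real ^ 'n) set \<Rightarrow> (real ^ 'n \<Rightarrow> real \<Rightarrow> real) \<Rightarrow> (real ^ 'n \<Rightarrow> real \<Rightarrow> real) \<Rightarrow>
     (real ^ 'n \<Rightarrow> real) \<Rightarrow> (real ^ 'n \<Rightarrow> real) \<Rightarrow> bool" where
  "is_adjoint_state s \<Omega> a L u p \<longleftrightarrow>
     p \<in> tilde_H s \<Omega> \<inter> Linf_space \<Omega> \<and>
     (\<forall>v \<in> tilde_H s \<Omega>. frac_form s v p + L2_inner \<Omega> (\<lambda>x. D1 a x (u x) * p x) v
                       = L2_inner \<Omega> (\<lambda>x. D1 L x (u x)) v)"

definition locally_optimal ::
    "real \<Rightarrow> (real ^ 'n) set \<Rightarrow> (real ^ 'n \<Rightarrow> real \<Rightarrow> real) \<Rightarrow> (real ^ 'n \<Rightarrow> real \<Rightarrow> real) \<Rightarrow>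
     real \<Rightarrow> real \<Rightarrow> real \<Rightarrow> (real ^ 'n \<Rightarrow> real) \<Rightarrow> bool" where
  "locally_optimal s \<Omega> a L \<alpha> lo hi zb \<longleftrightarrow>
     zb \<in> Z_ad \<Omega> lo hi \<and>
     (\<exists>\<rho> > 0. \<forall>z \<in> Z_ad \<Omega> lo hi. L2_norm \<Omega> (\<lambda>x. z x - zb x) \<le> \<rho> \<longrightarrow>
        (\<forall>ub u. is_state s \<Omega> a zb ub \<and> is_state s \<Omega> a z u \<longrightarrow>
           cost \<Omega> L \<alpha> ub zb \<le> cost \<Omega> L \<alpha> u z))"

definition optimal_triplet ::
    "real \<Rightarrow> (real ^ 'n) set \<Rightarrow> (real ^ 'n \<Rightarrow> real \<Rightarrow> real) \<Rightarrow> (real ^ 'n \<Rightarrow> real \<Rightarrow> real) \<Rightarrow>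
     real \<Rightarrow> real \<Rightarrow> real \<Rightarrow>
     (real ^ 'n \<Rightarrow> real) \<Rightarrow> (real ^ 'n \<Rightarrow> real) \<Rightarrow> (real ^ 'n \<Rightarrow> real) \<Rightarrow> bool" where
  "optimal_triplet s \<Omega> a L \<alpha> lo hi ub pb zb \<longleftrightarrow>
     locally_optimal s \<Omega> a L \<alpha> lo hi zb \<and> is_state s \<Omega> a zb ub \<and> is_adjoint_state s \<Omega> a L ub pb"

end

theory Submission
  imports Defs
begin

text \<open>The state \<open>ub\<close> and the adjoint state \<open>pb\<close> are bounded, so both solve an equation
  \<open>frac_form s u v = L2_inner \<Omega> f v\<close> with a square integrable right-hand side \<open>f\<close>. The core of the proof
  is that every such \<open>u\<close> belongs to the Sobolev space of order \<open>t\<close> on \<open>\<Omega>\<close> for all \<open>t < 2 * s\<close>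
  (\<open>weak_solution_regularity\<close>). On a Lipschitz domain this is obtained from translations, in the way of
  Savare. Near a boundary point the complement of \<open>\<Omega>\<close> is mapped into itself by short shifts in a cone of
  directions, so with a cutoff \<open>\<phi>\<close> the localised shift \<open>u + w\<close>, \<open>w = \<phi> * (u (\<cdot> + h) - u)\<close>, is again
  admissible. By convexity its energy exceeds that of \<open>u\<close> only by a multiple of \<open>norm h\<close> and of the
  \<open>L\<^sup>2\<close> norm of the shift difference (\<open>gagliardo_localised_shift\<close>). Testing the equation with \<open>w\<close>
  bounds the squared seminorm of \<open>w\<close> by the same quantities.

  If the \<open>L\<^sup>2\<close> modulus of translation of \<open>u\<close> is of order \<open>\<sigma>\<close>, the seminorm of \<open>w\<close> is thus of order
  \<open>\<sigma> / 2\<close>. A further shift of \<open>w\<close> gains the factor \<open>norm h powr s\<close>, so second differences of \<open>u\<close> are of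
  order \<open>s + \<sigma> / 2 < 1\<close>, and so are first differences (\<open>localised_modulus_improvement\<close>). Other
  directions are reached as differences of cone vectors, and a compactness argument makes the bound global
  (\<open>translation_order_step\<close>). Starting with \<open>\<sigma> = 0\<close>, the iteration \<open>\<sigma> \<mapsto> s + \<sigma> / 2\<close> approaches \<open>2 * s\<close>,
  and a modulus of order \<open>\<sigma>\<close> yields every Sobolev order below \<open>\<sigma>\<close>.

  For the control it remains to show that \<open>zb\<close> is the projection of \<open>- pb / \<alpha>\<close> onto the interval from
  \<open>lo\<close> to \<open>hi\<close> (\<open>control_is_projection\<close>): projecting is Lipschitz and keeps finite seminorms finite.
  The formula follows from local optimality once controls near \<open>zb\<close> are known to have states that depend on
  them in a Lipschitz way. The difference of the two states solves a monotone equation with bounded data. It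
  is found by minimising a uniformly convex functional (\<open>monotone_problem_solvable\<close>). Comparison with
  constants, which are strict supersolutions because the operator is nonlocal, bounds it uniformly
  (\<open>supersolution_bound\<close>, \<open>perturbed_state\<close>). Expanding the cost to first order with the help of the
  adjoint equation then gives the projection formula.\<close>

section \<open>Translations and the Gagliardo seminorm\<close>

definition gagliardo :: "real \<Rightarrow> ('a::euclidean_space \<Rightarrow> real) \<Rightarrow> ennreal" where
  "gagliardo t u = (\<integral>\<^sup>+ x. \<integral>\<^sup>+ y. ennreal ((u x - u y)\<^sup>2 / norm (x - y) powr (real DIM('a) + 2 * t)) \<partial>lborel \<partial>lborel)"

definition square_integral :: "('a::euclidean_space \<Rightarrow> real) \<Rightarrow> ennreal" where
  "square_integral u = (\<integral>\<^sup>+ x. ennreal ((u x)\<^sup>2) \<partial>lborel)"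

definition shift_diff :: "'a \<Rightarrow> ('a::euclidean_space \<Rightarrow> real) \<Rightarrow> 'a \<Rightarrow> real" where
  "shift_diff h u x = u (x + h) - u x"

lemma nn_integral_lborel_shift:
  fixes f :: "'a::euclidean_space \<Rightarrow> ennreal"
  assumes [measurable]: "f \<in> borel_measurable borel"
  shows "(\<integral>\<^sup>+ x. f (x + h) \<partial>lborel) = (\<integral>\<^sup>+ x. f x \<partial>lborel)"
proof -
  have "(\<integral>\<^sup>+ x. f x \<partial>lborel) = (\<integral>\<^sup>+ x. f x \<partial>(distr lborel borel ((+) h)))"
    by (simp add: lborel_distr_plus)
  also have "\<dots> = (\<integral>\<^sup>+ x. f (h + x) \<partial>lborel)"
    by (subst nn_integral_distr) auto
  finally show ?thesis by (simp add: add.commute)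
qed

lemma measurable_shift_diff [measurable (raw)]:
  assumes [measurable]: "u \<in> borel_measurable borel"
  shows "shift_diff h u \<in> borel_measurable borel"
  unfolding shift_diff_def[abs_def] by measurable

lemma dyadic_floor:
  fixes x :: real
  assumes "1 \<le> x"
  obtains k :: nat where "2 powr real k \<le> x" "x < 2 powr (real k + 1)"
proof
  define k where "k = nat \<lfloor>log 2 x\<rfloor>"
  have "0 \<le> log 2 x" using assms by simp
  then have k: "real k \<le> log 2 x" "log 2 x < real k + 1" unfolding k_def by linarith+
  have "2 powr real k \<le> 2 powr (log 2 x)" using k by (intro powr_mono) auto
  then show "2 powr real k \<le> x" using assms by simp
  have "2 powr (log 2 x) < 2 powr (real k + 1)" using k by (intro powr_less_mono) auto
  then show "x < 2 powr (real k + 1)" using assms by simp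
qed

lemma emeasure_lborel_cball:
  fixes c :: "'a::euclidean_space"
  assumes "0 \<le> r"
  shows "emeasure lborel (cball c r) = ennreal (unit_ball_vol DIM('a) * r powr DIM('a))"
  using assms emeasure_cball[of r c] by (cases "r = 0") (auto simp: powr_realpow)

lemma suminf_geometric_powr_finite:
  assumes "0 < q"
  shows "(\<Sum>k. ennreal (c * 2 powr (- real k * q))) < \<infinity>"
proof (cases "0 \<le> c")
  case True
  have eq: "c * 2 powr (- real k * q) = c * (2 powr (- q)) ^ k" for k
  proof -
    have "(2 powr (- q)) ^ k = (2 powr (- q)) powr real k" by (simp add: powr_realpow)
    also have "\<dots> = 2 powr (- real k * q)" by (simp add: powr_powr mult.commute)
    finally show ?thesis by simp
  qed
  have "2 powr (- q) < 1" using assms by (simp add: powr_less_one)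
  then have "summable (\<lambda>k. c * (2 powr (- q)) ^ k)"
    by (intro summable_mult summable_geometric) auto
  then show ?thesis unfolding eq using True
    by (subst suminf_ennreal2) auto
next
  case False
  then have "ennreal (c * 2 powr (- real k * q)) = 0" for k
    by (intro ennreal_neg) (auto intro!: mult_nonpos_nonneg)
  then show ?thesis by simp
qed

text \<open>Summation over dyadic shells: the shell of radius \<open>2\<^sup>k\<close> has volume comparable to \<open>2\<^sup>k\<^sup>n\<close>,
  so it contributes a geometric term of ratio \<open>2 powr (- 2 * t)\<close> far out and
  \<open>2 powr (- 2 * (b - t))\<close> towards the origin.\<close>

lemma truncated_kernel_integral_finite:
  assumes t: "0 < t" "t < b"
  shows "(\<integral>\<^sup>+ z. ennreal (min 1 (norm z powr (2 * b)) / norm z powr (real DIM('a) + 2 * t))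
            \<partial>(lborel :: 'a::euclidean_space measure)) < \<infinity>"
proof -
  define n where "n = real DIM('a)"
  define g where "g = 2 * (b - t)"
  have g: "0 < g" using t by (simp add: g_def)
  define V where "V = unit_ball_vol DIM('a)"
  define A :: "nat \<Rightarrow> 'a \<Rightarrow> ennreal" where "A = (\<lambda>k z. ennreal (2 powr (- real k * (n + 2 * t))) * indicator (cball 0 (2 powr (real k + 1))) z)"
  define B :: "nat \<Rightarrow> 'a \<Rightarrow> ennreal" where "B = (\<lambda>k z. ennreal (2 powr (- real k * g) * 2 powr ((real k + 1) * n)) * indicator (cball 0 (2 powr (- real k))) z)"
  have n: "0 < n" by (simp add: n_def)
  have [measurable]: "A k \<in> borel_measurable borel" "B k \<in> borel_measurable borel" for k
    unfolding A_def B_def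
    by (rule borel_measurable_times_ennreal[OF borel_measurable_const borel_measurable_indicator]; simp)+
  have pt: "ennreal (min 1 (norm z powr (2 * b)) / norm z powr (n + 2 * t)) \<le> (\<Sum>k. A k z) + (\<Sum>k. B k z)" for z
  proof -
    consider "z = 0" | "1 \<le> norm z" | "z \<noteq> 0" "norm z \<le> 1" by linarith
    then show ?thesis
    proof cases
      case 1 then show ?thesis by simp
    next
      case 2
      then obtain k where k: "2 powr real k \<le> norm z" "norm z < 2 powr (real k + 1)" by (rule dyadic_floor)
      have "(2 powr real k) powr (n + 2 * t) \<le> norm z powr (n + 2 * t)"
        using k n t by (intro powr_mono2) auto
      then have "1 / norm z powr (n + 2 * t) \<le> 1 / (2 powr real k) powr (n + 2 * t)"
        by (intro frac_le) simp_all
      also have "\<dots> = 2 powr (- real k * (n + 2 * t))"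
        by (simp add: powr_powr powr_minus divide_simps)
      finally have "min 1 (norm z powr (2 * b)) / norm z powr (n + 2 * t) \<le> 2 powr (- real k * (n + 2 * t))"
        using divide_right_mono[OF min.cobounded1, of "norm z powr (n + 2 * t)" 1 "norm z powr (2 * b)"] by simp
      then have "ennreal (min 1 (norm z powr (2 * b)) / norm z powr (n + 2 * t)) \<le> A k z"
        using k unfolding A_def by (auto simp: indicator_def intro!: ennreal_leI)
      also have "\<dots> = (\<Sum>j\<in>{k}. A j z)" by simp
      also have "\<dots> \<le> (\<Sum>j. A j z)" by (intro sum_le_suminf) auto
      finally show ?thesis by (metis add.right_neutral add_mono zero_le)
    next
      case 3
      then have "1 \<le> inverse (norm z)" by (simp add: one_le_inverse)
      then obtain k where k: "2 powr real k \<le> inverse (norm z)" "inverse (norm z) < 2 powr (real k + 1)" by (rule dyadic_floor)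
      have z: "0 < norm z" using 3 by simp
      have k1: "norm z \<le> 2 powr (- real k)"
        using k(1) z by (simp add: powr_minus field_simps)
      have "min 1 (norm z powr (2 * b)) / norm z powr (n + 2 * t) \<le> norm z powr (2 * b) / norm z powr (n + 2 * t)"
        by (intro divide_right_mono) auto
      also have "\<dots> = norm z powr g * (inverse (norm z)) powr n"
        using z by (simp add: g_def powr_diff[symmetric] powr_add[symmetric] inverse_powr powr_minus[symmetric] algebra_simps)
      also have "\<dots> \<le> (2 powr (- real k)) powr g * (2 powr (real k + 1)) powr n"
        using k1 k z g n by (intro mult_mono powr_mono2) auto
      also have "\<dots> = 2 powr (- real k * g) * 2 powr ((real k + 1) * n)"
        by (simp add: powr_powr)
      finally have "ennreal (min 1 (norm z powr (2 * b)) / norm z powr (n + 2 * t)) \<le> B k z"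
        using k1 unfolding B_def by (auto simp: indicator_def intro!: ennreal_leI)
      also have "\<dots> = (\<Sum>j\<in>{k}. B j z)" by simp
      also have "\<dots> \<le> (\<Sum>j. B j z)" by (intro sum_le_suminf) auto
      finally show ?thesis by (metis add_0 add_mono zero_le)
    qed
  qed
  have "(\<integral>\<^sup>+ z. ennreal (min 1 (norm z powr (2 * b)) / norm z powr (n + 2 * t)) \<partial>(lborel :: 'a measure))
      \<le> (\<integral>\<^sup>+ z. (\<Sum>k. A k z) + (\<Sum>k. B k z) \<partial>lborel)"
    by (intro nn_integral_mono pt)
  also have "\<dots> = (\<Sum>k. \<integral>\<^sup>+ z. A k z \<partial>lborel) + (\<Sum>k. \<integral>\<^sup>+ z. B k z \<partial>lborel)"
    by (subst nn_integral_add) (auto simp: nn_integral_suminf)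
  also have "(\<lambda>k. \<integral>\<^sup>+ z. A k z \<partial>lborel) = (\<lambda>k. ennreal (V * 2 powr n * 2 powr (- real k * (2 * t))))"
  proof
    fix k
    have "(\<integral>\<^sup>+ z. A k z \<partial>lborel) = ennreal (2 powr (- real k * (n + 2 * t))) * ennreal (V * (2 powr (real k + 1)) powr n)"
      unfolding A_def by (simp add: nn_integral_cmult_indicator emeasure_lborel_cball V_def n_def)
    also have "\<dots> = ennreal (2 powr (- real k * (n + 2 * t)) * (V * (2 powr (real k + 1)) powr n))"
      by (subst ennreal_mult) (auto simp: V_def)
    also have "2 powr (- real k * (n + 2 * t)) * (V * (2 powr (real k + 1)) powr n) = V * 2 powr n * 2 powr (- real k * (2 * t))"
      by (simp add: powr_powr powr_add[symmetric] algebra_simps)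
    finally show "(\<integral>\<^sup>+ z. A k z \<partial>lborel) = ennreal (V * 2 powr n * 2 powr (- real k * (2 * t)))" .
  qed
  also have "(\<lambda>k. \<integral>\<^sup>+ z. B k z \<partial>lborel) = (\<lambda>k. ennreal (V * 2 powr n * 2 powr (- real k * g)))"
  proof
    fix k
    have "(\<integral>\<^sup>+ z. B k z \<partial>lborel) = ennreal (2 powr (- real k * g) * 2 powr ((real k + 1) * n)) * ennreal (V * (2 powr (- real k)) powr n)"
      unfolding B_def by (simp add: nn_integral_cmult_indicator emeasure_lborel_cball V_def n_def)
    also have "\<dots> = ennreal (2 powr (- real k * g) * 2 powr ((real k + 1) * n) * (V * (2 powr (- real k)) powr n))"
      by (subst ennreal_mult) (auto simp: V_def)
    also have "2 powr (- real k * g) * 2 powr ((real k + 1) * n) * (V * (2 powr (- real k)) powr n) = V * 2 powr n * 2 powr (- real k * g)"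
      by (simp add: powr_powr powr_add[symmetric] algebra_simps)
    finally show "(\<integral>\<^sup>+ z. B k z \<partial>lborel) = ennreal (V * 2 powr n * 2 powr (- real k * g))" .
  qed
  also have "(\<Sum>k. ennreal (V * 2 powr n * 2 powr (- real k * (2 * t)))) + (\<Sum>k. ennreal (V * 2 powr n * 2 powr (- real k * g))) < \<infinity>"
    using suminf_geometric_powr_finite[of "2 * t" "V * 2 powr n"] suminf_geometric_powr_finite[of g "V * 2 powr n"] t g by simp
  finally show ?thesis by (simp add: n_def)
qed

text \<open>The squared increment of a Lipschitz cutoff vanishes to second order on the diagonal, which makes the
  kernel of order \<open>s < 1\<close> integrable; this number is the resulting mass.\<close>

definition kernel_mass :: "real \<Rightarrow> 'a::euclidean_space itself \<Rightarrow> real" where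
  "kernel_mass s _ = enn2real (\<integral>\<^sup>+ z. ennreal (min 1 (norm z powr 2) / norm z powr (real DIM('a) + 2 * s)) \<partial>(lborel :: 'a measure))"

lemma square_diff_le: "((a::real) - c)\<^sup>2 \<le> 2 * (a - b)\<^sup>2 + 2 * (b - c)\<^sup>2"
proof -
  have "0 \<le> ((a - b) - (b - c))\<^sup>2" by simp
  then show ?thesis by (simp add: power2_eq_square algebra_simps)
qed

text \<open>The values \<open>w (x + h)\<close> and \<open>w x\<close> are both compared with \<open>w y\<close>, and the result is averaged over all
  \<open>y\<close> in the ball of radius \<open>norm h\<close> around \<open>x\<close>. On that ball the kernel is bounded below by a power of
  \<open>norm h\<close>.\<close>

lemma shift_diff_estimate:
  fixes w :: "'a::euclidean_space \<Rightarrow> real"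
  assumes [measurable]: "w \<in> borel_measurable borel" and s: "0 < s"
  shows "square_integral (shift_diff h w)
    \<le> ennreal (4 * 2 powr (real DIM('a) + 2 * s) / unit_ball_vol DIM('a) * norm h powr (2 * s)) * gagliardo s w"
proof (cases "h = 0")
  case True then show ?thesis by (simp add: square_integral_def shift_diff_def)
next
  case False
  define n where "n = real DIM('a)"
  define V where "V = unit_ball_vol DIM('a) * norm h powr n"
  have V: "0 < V" using False by (simp add: V_def)
  define P where "P = 2 * (2 * norm h) powr (n + 2 * s)"
  have "0 \<le> P" by (simp add: P_def)
  have n: "0 < n" by (simp add: n_def)
  define K where "K = (\<lambda>x y. ennreal ((w x - w y)\<^sup>2 / norm (x - y) powr (n + 2 * s)))"
  have [measurable]: "(\<lambda>(x, y). K x y) \<in> borel_measurable (borel \<Otimes>\<^sub>M borel)"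
    unfolding K_def by measurable
  have Kb: "ennreal (2 * (w x - w y)\<^sup>2) \<le> ennreal P * K x y" if "norm (x - y) \<le> 2 * norm h" for x y
  proof (cases "x = y")
    case False
    have "norm (x - y) powr (n + 2 * s) \<le> (2 * norm h) powr (n + 2 * s)"
      using that n s by (intro powr_mono2) auto
    then have "2 * (w x - w y)\<^sup>2 * norm (x - y) powr (n + 2 * s) \<le> 2 * (w x - w y)\<^sup>2 * (2 * norm h) powr (n + 2 * s)"
      by (intro mult_left_mono) auto
    then have "2 * (w x - w y)\<^sup>2 \<le> P * ((w x - w y)\<^sup>2 / norm (x - y) powr (n + 2 * s))"
      using False by (simp add: P_def field_simps)
    then show ?thesis unfolding K_def by (subst ennreal_mult[symmetric]) (auto simp: P_def intro!: ennreal_leI)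
  qed simp
  have pt: "ennreal ((shift_diff h w x)\<^sup>2) \<le> ennreal (1 / V) * (ennreal P * ((\<integral>\<^sup>+y. K (x + h) y \<partial>lborel) + (\<integral>\<^sup>+y. K x y \<partial>lborel)))" for x
  proof -
    have "ennreal ((shift_diff h w x)\<^sup>2) = ennreal (1 / V) * (ennreal ((shift_diff h w x)\<^sup>2) * ennreal V)"
      using V by (simp add: ennreal_mult[symmetric])
    also have "ennreal ((shift_diff h w x)\<^sup>2) * ennreal V = (\<integral>\<^sup>+y. ennreal ((shift_diff h w x)\<^sup>2) * indicator (cball x (norm h)) y \<partial>lborel)"
      by (simp add: nn_integral_cmult_indicator emeasure_lborel_cball V_def n_def)
    also have "\<dots> \<le> (\<integral>\<^sup>+y. ennreal P * K (x + h) y + ennreal P * K x y \<partial>lborel)"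
    proof (intro nn_integral_mono)
      fix y
      show "ennreal ((shift_diff h w x)\<^sup>2) * indicator (cball x (norm h)) y \<le> ennreal P * K (x + h) y + ennreal P * K x y"
      proof (cases "y \<in> cball x (norm h)")
        case True
        then have 1: "norm (x - y) \<le> norm h" by (simp add: dist_norm)
        have "norm (x + h - y) \<le> norm (x - y) + norm h"
          by (metis add.commute add_diff_eq norm_triangle_ineq)
        then have 2: "norm (x + h - y) \<le> 2 * norm h" using 1 by simp
        have "(shift_diff h w x)\<^sup>2 \<le> 2 * (w (x + h) - w y)\<^sup>2 + 2 * (w x - w y)\<^sup>2"
          using square_diff_le[of "w (x + h)" "w x" "w y"] by (simp add: shift_diff_def power2_commute)
        then have "ennreal ((shift_diff h w x)\<^sup>2) \<le> ennreal (2 * (w (x + h) - w y)\<^sup>2) + ennreal (2 * (w x - w y)\<^sup>2)"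
          by (subst ennreal_plus[symmetric]) (auto intro!: ennreal_leI simp del: ennreal_plus)
        also have "\<dots> \<le> ennreal P * K (x + h) y + ennreal P * K x y"
          using 1 2 norm_ge_zero[of h] by (intro add_mono Kb) linarith+
        finally show ?thesis using True by simp
      qed simp
    qed
    also have "\<dots> = ennreal P * ((\<integral>\<^sup>+y. K (x + h) y \<partial>lborel) + (\<integral>\<^sup>+y. K x y \<partial>lborel))"
      by (simp add: nn_integral_add nn_integral_cmult distrib_left)
    finally show ?thesis by (simp add: mult_left_mono)
  qed
  have "square_integral (shift_diff h w) \<le> (\<integral>\<^sup>+x. ennreal (1 / V) * (ennreal P * ((\<integral>\<^sup>+y. K (x + h) y \<partial>lborel) + (\<integral>\<^sup>+y. K x y \<partial>lborel))) \<partial>lborel)"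
    unfolding square_integral_def by (intro nn_integral_mono pt)
  also have "\<dots> = ennreal (1 / V) * (ennreal P * ((\<integral>\<^sup>+x. \<integral>\<^sup>+y. K (x + h) y \<partial>lborel \<partial>lborel) + (\<integral>\<^sup>+x. \<integral>\<^sup>+y. K x y \<partial>lborel \<partial>lborel)))"
    by (simp add: nn_integral_cmult nn_integral_add)
  also have "(\<integral>\<^sup>+x. \<integral>\<^sup>+y. K (x + h) y \<partial>lborel \<partial>lborel) = gagliardo s w"
    by (subst nn_integral_lborel_shift[where f = "\<lambda>x. \<integral>\<^sup>+y. K x y \<partial>lborel"]) (auto simp: gagliardo_def K_def n_def)
  also have "(\<integral>\<^sup>+x. \<integral>\<^sup>+y. K x y \<partial>lborel \<partial>lborel) = gagliardo s w"
    by (simp add: gagliardo_def K_def n_def)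
  also have "ennreal (1 / V) * (ennreal P * (gagliardo s w + gagliardo s w)) = ennreal (1 / V * P * 2) * gagliardo s w"
  proof -
    have "ennreal (1 / V * P * 2) = ennreal (1 / V) * ennreal P * 2"
      using V \<open>0 \<le> P\<close> by (simp add: ennreal_mult del: times_divide_eq_left)
    then show ?thesis by (simp add: mult_2 distrib_left distrib_right mult_ac)
  qed
  also have "1 / V * P * 2 = 4 * 2 powr (real DIM('a) + 2 * s) / unit_ball_vol DIM('a) * norm h powr (2 * s)"
    using False by (simp add: V_def P_def n_def powr_mult powr_add)
  finally show ?thesis .
qed

lemma ennreal_kernel_mass:
  assumes "0 < s" "s < 1"
  shows "(\<integral>\<^sup>+ z. ennreal (min 1 (norm z powr 2) / norm z powr (real DIM('a) + 2 * s)) \<partial>(lborel :: 'a::euclidean_space measure))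
       = ennreal (kernel_mass s TYPE('a))"
  using truncated_kernel_integral_finite[of s 1, where 'a = 'a] assms by (simp add: kernel_mass_def)

lemma square_add_le:
  assumes "0 < e"
  shows "((a::real) + b)\<^sup>2 \<le> (1 + e) * a\<^sup>2 + (1 + 1 / e) * b\<^sup>2"
proof -
  have "0 \<le> (e * a - b)\<^sup>2 / e" using assms by simp
  also have "\<dots> = e * a\<^sup>2 - 2 * a * b + b\<^sup>2 / e"
    using assms by (simp add: power2_eq_square field_simps)
  finally show ?thesis by (simp add: power2_eq_square algebra_simps)
qed

lemma square_convex_le:
  assumes "0 \<le> p" "p \<le> 1"
  shows "((1 - p) * (a::real) + p * b)\<^sup>2 \<le> (1 - p) * a\<^sup>2 + p * b\<^sup>2"
proof -
  have "0 \<le> p * (1 - p) * (a - b)\<^sup>2" using assms by simp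
  then show ?thesis by (simp add: power2_eq_square algebra_simps)
qed

lemma ennreal_combination:
  assumes "0 \<le> a" "0 \<le> b" "0 \<le> p" "0 \<le> q" "0 \<le> x" "0 \<le> y" "0 \<le> z" "0 \<le> w"
  shows "ennreal (a * (p * x + q * y) + b * (z * w))
     = ennreal a * (ennreal p * ennreal x + ennreal q * ennreal y) + ennreal b * (ennreal z * ennreal w)"
  using assms by (simp add: ennreal_mult)

text \<open>The localised shift \<open>u + \<phi> * (u (\<cdot> + h) - u)\<close> is a pointwise convex combination of \<open>u\<close> and its
  translate. By convexity of the square its increments cost at most those of \<open>u\<close> and of the translate,
  weighted with \<open>1 - \<phi>\<close> and \<open>\<phi>\<close>; after a change of variables the total weight is
  \<open>1 - \<phi> x + \<phi> (x - h) \<le> 1 + L * norm h\<close>. What remains are the increments of \<open>\<phi>\<close> itself, which only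
  see the \<open>L\<^sup>2\<close> norm of the shift difference.\<close>

lemma gagliardo_localised_shift:
  fixes u \<phi> :: "'a::euclidean_space \<Rightarrow> real"
  assumes [measurable]: "u \<in> borel_measurable borel" "\<phi> \<in> borel_measurable borel"
    and \<phi>: "\<And>x. 0 \<le> \<phi> x" "\<And>x. \<phi> x \<le> 1"
    and lip: "\<And>x y. \<bar>\<phi> x - \<phi> y\<bar> \<le> L * norm (x - y)" and L: "1 \<le> L"
    and s: "0 < s" "s < 1" and e: "0 < e"
  shows "gagliardo s (\<lambda>x. u x + \<phi> x * shift_diff h u x)
     \<le> ennreal ((1 + e) * (1 + L * norm h)) * gagliardo s u
       + ennreal ((1 + 1 / e) * L\<^sup>2 * kernel_mass s TYPE('a)) * square_integral (shift_diff h u)"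
proof -
  define n where "n = real DIM('a)"
  define K where "K = (\<lambda>x y. ennreal ((u x - u y)\<^sup>2 / norm (x - y) powr (n + 2 * s)))"
  define k where "k = (\<lambda>z::'a. ennreal (min 1 (norm z powr 2) / norm z powr (n + 2 * s)))"
  define D where "D = shift_diff h u"
  have [measurable]: "D \<in> borel_measurable borel" by (simp add: D_def)
  have [measurable]: "(\<lambda>(x, y). K x y) \<in> borel_measurable (borel \<Otimes>\<^sub>M borel)"
    unfolding K_def by measurable
  have [measurable]: "k \<in> borel_measurable borel"
    unfolding k_def by measurable
  define Kx where "Kx = (\<lambda>x. \<integral>\<^sup>+y. K x y \<partial>lborel)"
  have [measurable]: "Kx \<in> borel_measurable borel"
    unfolding Kx_def by measurable
  have pt: "ennreal (((u x + \<phi> x * D x) - (u y + \<phi> y * D y))\<^sup>2 / norm (x - y) powr (n + 2 * s))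
     \<le> ennreal (1 + e) * (ennreal (1 - \<phi> x) * K x y + ennreal (\<phi> x) * K (x + h) (y + h))
       + ennreal ((1 + 1 / e) * L\<^sup>2) * (k (x - y) * ennreal ((D y)\<^sup>2))" for x y
  proof -
    define N where "N = norm (x - y) powr (n + 2 * s)"
    have N: "0 \<le> N" by (simp add: N_def)
    \<comment> \<open>The increment splits into a convex combination of increments and the increment of the cutoff.\<close>
    define a where "a = (1 - \<phi> x) * (u x - u y) + \<phi> x * (u (x + h) - u (y + h))"
    define b where "b = (\<phi> x - \<phi> y) * D y"
    have ab: "(u x + \<phi> x * D x) - (u y + \<phi> y * D y) = a + b"
      by (simp add: a_def b_def D_def shift_diff_def algebra_simps)
    have "\<bar>\<phi> x - \<phi> y\<bar> \<le> 1" using \<phi>[of x] \<phi>[of y] by linarith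
    moreover have "\<bar>\<phi> x - \<phi> y\<bar>\<^sup>2 \<le> (L * norm (x - y))\<^sup>2" using lip by (intro power_mono) auto
    moreover have "1 \<le> L\<^sup>2" using L by simp
    moreover from calculation(1) have "(\<phi> x - \<phi> y)\<^sup>2 \<le> 1" by (simp add: abs_square_le_1)
    ultimately have f: "(\<phi> x - \<phi> y)\<^sup>2 \<le> L\<^sup>2 * min 1 (norm (x - y) powr 2)"
      by (auto simp: min_def power_mult_distrib)
    have "(a + b)\<^sup>2 \<le> (1 + e) * a\<^sup>2 + (1 + 1 / e) * b\<^sup>2" using e by (rule square_add_le)
    also have "\<dots> \<le> (1 + e) * ((1 - \<phi> x) * (u x - u y)\<^sup>2 + \<phi> x * (u (x + h) - u (y + h))\<^sup>2)
        + (1 + 1 / e) * ((L\<^sup>2 * min 1 (norm (x - y) powr 2)) * (D y)\<^sup>2)"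
      unfolding a_def b_def power_mult_distrib using e \<phi> f
      by (intro add_mono mult_left_mono square_convex_le mult_right_mono) auto
    finally have "(a + b)\<^sup>2 / N \<le> ((1 + e) * ((1 - \<phi> x) * (u x - u y)\<^sup>2 + \<phi> x * (u (x + h) - u (y + h))\<^sup>2)
        + (1 + 1 / e) * ((L\<^sup>2 * min 1 (norm (x - y) powr 2)) * (D y)\<^sup>2)) / N"
      using N by (rule divide_right_mono)
    also have "\<dots> = (1 + e) * ((1 - \<phi> x) * ((u x - u y)\<^sup>2 / N) + \<phi> x * ((u (x + h) - u (y + h))\<^sup>2 / N))
        + ((1 + 1 / e) * L\<^sup>2) * ((min 1 (norm (x - y) powr 2) / N) * (D y)\<^sup>2)"
      by (simp add: add_divide_distrib distrib_left)
    finally have "ennreal ((a + b)\<^sup>2 / N) \<le> ennreal \<dots>" by (rule ennreal_leI)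
    also have "\<dots> = ennreal (1 + e) * (ennreal (1 - \<phi> x) * ennreal ((u x - u y)\<^sup>2 / N) + ennreal (\<phi> x) * ennreal ((u (x + h) - u (y + h))\<^sup>2 / N))
        + ennreal ((1 + 1 / e) * L\<^sup>2) * (ennreal (min 1 (norm (x - y) powr 2) / N) * ennreal ((D y)\<^sup>2))"
      using \<phi>[of x] e N by (intro ennreal_combination) auto
    finally show ?thesis unfolding ab K_def k_def N_def by simp
  qed
  have "gagliardo s (\<lambda>x. u x + \<phi> x * D x) \<le>
     (\<integral>\<^sup>+x. \<integral>\<^sup>+y. ennreal (1 + e) * (ennreal (1 - \<phi> x) * K x y + ennreal (\<phi> x) * K (x + h) (y + h))
       + ennreal ((1 + 1 / e) * L\<^sup>2) * (k (x - y) * ennreal ((D y)\<^sup>2)) \<partial>lborel \<partial>lborel)"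
    unfolding gagliardo_def n_def[symmetric] by (intro nn_integral_mono pt)
  also have "\<dots> = ennreal (1 + e) * ((\<integral>\<^sup>+x. ennreal (1 - \<phi> x) * Kx x \<partial>lborel) + (\<integral>\<^sup>+x. ennreal (\<phi> x) * (\<integral>\<^sup>+y. K (x + h) (y + h) \<partial>lborel) \<partial>lborel))
       + ennreal ((1 + 1 / e) * L\<^sup>2) * (\<integral>\<^sup>+x. \<integral>\<^sup>+y. k (x - y) * ennreal ((D y)\<^sup>2) \<partial>lborel \<partial>lborel)"
    by (simp add: nn_integral_add nn_integral_cmult Kx_def)
  also have "(\<integral>\<^sup>+x. ennreal (\<phi> x) * (\<integral>\<^sup>+y. K (x + h) (y + h) \<partial>lborel) \<partial>lborel) = (\<integral>\<^sup>+x. ennreal (\<phi> (x - h)) * Kx x \<partial>lborel)"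
  proof -
    have "(\<integral>\<^sup>+y. K (x + h) (y + h) \<partial>lborel) = Kx (x + h)" for x
      unfolding Kx_def by (rule nn_integral_lborel_shift) measurable
    then show ?thesis
      using nn_integral_lborel_shift[of "\<lambda>x. ennreal (\<phi> (x - h)) * Kx x" h] by simp
  qed
  also have "(\<integral>\<^sup>+x. ennreal (1 - \<phi> x) * Kx x \<partial>lborel) + (\<integral>\<^sup>+x. ennreal (\<phi> (x - h)) * Kx x \<partial>lborel)
      = (\<integral>\<^sup>+x. ennreal (1 - \<phi> x) * Kx x + ennreal (\<phi> (x - h)) * Kx x \<partial>lborel)"
    by (rule nn_integral_add[symmetric]) measurable
  also have "\<dots> \<le> (\<integral>\<^sup>+x. ennreal (1 + L * norm h) * Kx x \<partial>lborel)"
  proof (intro nn_integral_mono)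
    fix x
    have "ennreal (1 - \<phi> x) + ennreal (\<phi> (x - h)) = ennreal (1 - \<phi> x + \<phi> (x - h))"
      using \<phi>[of x] \<phi>[of "x - h"] by (subst ennreal_plus) auto
    also have "\<dots> \<le> ennreal (1 + L * norm h)"
      using lip[of "x - h" x] by (intro ennreal_leI) auto
    finally show "ennreal (1 - \<phi> x) * Kx x + ennreal (\<phi> (x - h)) * Kx x \<le> ennreal (1 + L * norm h) * Kx x"
      by (simp add: distrib_right[symmetric] mult_right_mono)
  qed
  also have "\<dots> = ennreal (1 + L * norm h) * gagliardo s u"
    by (subst nn_integral_cmult) (auto simp: Kx_def K_def gagliardo_def n_def)
  also have "(\<integral>\<^sup>+x. \<integral>\<^sup>+y. k (x - y) * ennreal ((D y)\<^sup>2) \<partial>lborel \<partial>lborel) = (\<integral>\<^sup>+y. \<integral>\<^sup>+x. k (x - y) * ennreal ((D y)\<^sup>2) \<partial>lborel \<partial>lborel)"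
    by (rule lborel_pair.Fubini') measurable
  also have "\<dots> = (\<integral>\<^sup>+y. ennreal (kernel_mass s TYPE('a)) * ennreal ((D y)\<^sup>2) \<partial>lborel)"
  proof (intro nn_integral_cong)
    fix y
    have "(\<integral>\<^sup>+x. k (x - y) * ennreal ((D y)\<^sup>2) \<partial>lborel) = (\<integral>\<^sup>+x. k (x + - y) \<partial>lborel) * ennreal ((D y)\<^sup>2)"
      by (subst nn_integral_multc) auto
    also have "(\<integral>\<^sup>+x. k (x + - y) \<partial>lborel) = (\<integral>\<^sup>+x. k x \<partial>lborel)"
      by (rule nn_integral_lborel_shift) measurable
    also have "\<dots> = ennreal (kernel_mass s TYPE('a))"
      unfolding k_def n_def using s by (rule ennreal_kernel_mass)
    finally show "(\<integral>\<^sup>+x. k (x - y) * ennreal ((D y)\<^sup>2) \<partial>lborel) = ennreal (kernel_mass s TYPE('a)) * ennreal ((D y)\<^sup>2)" .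
  qed
  also have "\<dots> = ennreal (kernel_mass s TYPE('a)) * square_integral D"
    by (subst nn_integral_cmult) (auto simp: square_integral_def)
  finally show ?thesis
    using e L by (simp add: D_def ennreal_mult kernel_mass_def mult.assoc add_mono mult_left_mono)
qed

text \<open>Order 0 is square integrability, or slightly less. For \<open>0 < \<sigma> < 1\<close> the condition
  singles out, among the square integrable functions, the Besov space of order \<open>\<sigma>\<close> with summability 2
  and fine index \<open>\<infinity>\<close>. The minimum with 1 is there so that one constant serves all shifts.\<close>

definition translation_order :: "real \<Rightarrow> ('a::euclidean_space \<Rightarrow> real) \<Rightarrow> bool" where
  "translation_order \<sigma> u \<longleftrightarrow>
     (\<exists>C. \<forall>h. square_integral (shift_diff h u) \<le> ennreal (C * min 1 (norm h powr (2 * \<sigma>))))"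

text \<open>In the variables \<open>x\<close> and \<open>h = y - x\<close> the seminorm is the integral of the translation modulus against
  the kernel, so any loss \<open>t < \<sigma>\<close> makes it converge at \<open>h = 0\<close>.\<close>

lemma gagliardo_finite_if_translation_order:
  fixes u :: "'a::euclidean_space \<Rightarrow> real"
  assumes [measurable]: "u \<in> borel_measurable borel"
    and "translation_order \<sigma> u" and t: "0 < t" "t < \<sigma>"
  shows "gagliardo t u < \<infinity>"
proof -
  define n where "n = real DIM('a)"
  obtain C where C: "\<And>h. square_integral (shift_diff h u) \<le> ennreal (C * min 1 (norm h powr (2 * \<sigma>)))"
    using assms(2) by (auto simp: translation_order_def)
  define K where "K = (\<lambda>x y. ennreal ((u x - u y)\<^sup>2 / norm (x - y) powr (n + 2 * t)))"
  have [measurable]: "(\<lambda>(x, y). K x y) \<in> borel_measurable (borel \<Otimes>\<^sub>M borel)"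
    unfolding K_def by measurable
  have "gagliardo t u = (\<integral>\<^sup>+x. \<integral>\<^sup>+y. K x y \<partial>lborel \<partial>lborel)"
    by (simp add: gagliardo_def K_def n_def)
  also have "\<dots> = (\<integral>\<^sup>+x. \<integral>\<^sup>+h. K x (h + x) \<partial>lborel \<partial>lborel)"
    by (intro nn_integral_cong nn_integral_lborel_shift[symmetric]) measurable
  also have "\<dots> = (\<integral>\<^sup>+h. \<integral>\<^sup>+x. K x (h + x) \<partial>lborel \<partial>lborel)"
    by (rule lborel_pair.Fubini') measurable
  also have "\<dots> \<le> (\<integral>\<^sup>+h. ennreal C * ennreal (min 1 (norm (h::'a) powr (2 * \<sigma>)) / norm h powr (n + 2 * t)) \<partial>lborel)"
  proof (intro nn_integral_mono)
    fix h :: 'a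
    have "(\<integral>\<^sup>+x. K x (h + x) \<partial>lborel) = (\<integral>\<^sup>+x. ennreal (1 / norm h powr (n + 2 * t)) * ennreal ((shift_diff h u x)\<^sup>2) \<partial>lborel)"
      by (intro nn_integral_cong)
        (simp add: K_def ennreal_mult[symmetric] shift_diff_def add.commute power2_commute)
    also have "\<dots> = ennreal (1 / norm h powr (n + 2 * t)) * square_integral (shift_diff h u)"
      by (subst nn_integral_cmult) (auto simp: square_integral_def)
    also have "\<dots> \<le> ennreal (1 / norm h powr (n + 2 * t)) * ennreal (C * min 1 (norm h powr (2 * \<sigma>)))"
      by (intro mult_left_mono C) auto
    also have "\<dots> = ennreal C * ennreal (min 1 (norm h powr (2 * \<sigma>)) / norm h powr (n + 2 * t))"
    proof (cases "0 \<le> C")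
      case True then show ?thesis by (simp add: ennreal_mult[symmetric] field_simps)
    next
      case False
      then have "C * min 1 (norm h powr (2 * \<sigma>)) \<le> 0" by (intro mult_nonpos_nonneg) auto
      then show ?thesis using False by (simp add: ennreal_neg)
    qed
    finally show "(\<integral>\<^sup>+x. K x (h + x) \<partial>lborel) \<le> ennreal C * ennreal (min 1 (norm h powr (2 * \<sigma>)) / norm h powr (n + 2 * t))" .
  qed
  also have "\<dots> = ennreal C * (\<integral>\<^sup>+h. ennreal (min 1 (norm (h::'a) powr (2 * \<sigma>)) / norm h powr (n + 2 * t)) \<partial>lborel)"
    by (subst nn_integral_cmult) auto
  also have "\<dots> < \<infinity>"
    using truncated_kernel_integral_finite[OF t, where 'a = 'a] by (simp add: n_def ennreal_mult_less_top)
  finally show ?thesis .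
qed

lemma square_integral_shift_diff_le:
  fixes u :: "'a::euclidean_space \<Rightarrow> real"
  assumes [measurable]: "u \<in> borel_measurable borel"
  shows "square_integral (shift_diff h u) \<le> 4 * square_integral u"
proof -
  have "square_integral (shift_diff h u) \<le> (\<integral>\<^sup>+x. 2 * ennreal ((u (x + h))\<^sup>2) + 2 * ennreal ((u x)\<^sup>2) \<partial>lborel)"
    unfolding square_integral_def
  proof (intro nn_integral_mono)
    fix x
    have "(shift_diff h u x)\<^sup>2 \<le> 2 * (u (x + h))\<^sup>2 + 2 * (u x)\<^sup>2"
      using square_diff_le[of "u (x + h)" "u x" 0] by (simp add: shift_diff_def)
    then have "ennreal ((shift_diff h u x)\<^sup>2) \<le> ennreal (2 * (u (x + h))\<^sup>2 + 2 * (u x)\<^sup>2)" by (rule ennreal_leI)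
    then show "ennreal ((shift_diff h u x)\<^sup>2) \<le> 2 * ennreal ((u (x + h))\<^sup>2) + 2 * ennreal ((u x)\<^sup>2)"
      by (simp add: ennreal_mult)
  qed
  also have "\<dots> = 2 * (\<integral>\<^sup>+x. ennreal ((u (x + h))\<^sup>2) \<partial>lborel) + 2 * square_integral u"
    by (simp add: nn_integral_add nn_integral_cmult square_integral_def)
  also have "(\<integral>\<^sup>+x. ennreal ((u (x + h))\<^sup>2) \<partial>lborel) = square_integral u"
    unfolding square_integral_def by (rule nn_integral_lborel_shift) measurable
  finally show ?thesis by (simp add: distrib_right[symmetric])
qed

lemma translation_order_zero:
  fixes u :: "'a::euclidean_space \<Rightarrow> real"
  assumes "u \<in> borel_measurable borel" "square_integral u < \<infinity>"
  shows "translation_order 0 u"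
  unfolding translation_order_def
proof (intro exI allI)
  fix h :: 'a
  show "square_integral (shift_diff h u) \<le> ennreal (4 * enn2real (square_integral u) * min 1 (norm h powr (2 * 0)))"
    using square_integral_shift_diff_le[OF assms(1), of h] assms(2)
    by (cases "h = 0") (auto simp: shift_diff_def square_integral_def ennreal_mult)
qed

lemma translation_order_if_small_shifts:
  fixes u :: "'a::euclidean_space \<Rightarrow> real"
  assumes "u \<in> borel_measurable borel" "square_integral u < \<infinity>"
    and r: "0 < r" and t: "0 \<le> t"
    and small: "\<And>h. norm h \<le> r \<Longrightarrow> square_integral (shift_diff h u) \<le> ennreal (C * norm h powr (2 * t))"
  shows "translation_order t u"
  unfolding translation_order_def
proof (intro exI allI)
  fix h :: 'a
  define p where "p = min r 1"
  have p: "0 < p" "p \<le> 1" "p \<le> r" using r by (auto simp: p_def)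
  define Q where "Q = 4 * enn2real (square_integral u)"
  have Q: "0 \<le> Q" by (simp add: Q_def)
  have Q': "square_integral (shift_diff h u) \<le> ennreal Q"
    using square_integral_shift_diff_le[OF assms(1), of h] assms(2) by (simp add: Q_def ennreal_mult)
  show "square_integral (shift_diff h u) \<le> ennreal (max C (Q / p powr (2 * t)) * min 1 (norm h powr (2 * t)))"
  proof (cases "norm h \<le> p")
    case True
    then have "norm h powr (2 * t) \<le> 1 powr (2 * t)" using t p by (intro powr_mono2) auto
    moreover have "square_integral (shift_diff h u) \<le> ennreal (C * norm h powr (2 * t))"
      using True p by (intro small) auto
    moreover have "C * norm h powr (2 * t) \<le> max C (Q / p powr (2 * t)) * norm h powr (2 * t)"
      by (intro mult_right_mono) auto
    ultimately show ?thesis by (auto simp: min_def intro: order_trans ennreal_leI)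
  next
    case False
    then have "p powr (2 * t) \<le> norm h powr (2 * t)" using t p by (intro powr_mono2) auto
    moreover have "p powr (2 * t) \<le> 1 powr (2 * t)" using t p by (intro powr_mono2) auto
    ultimately have m: "p powr (2 * t) \<le> min 1 (norm h powr (2 * t))" by simp
    have "Q = Q / p powr (2 * t) * p powr (2 * t)" using p by simp
    also have "\<dots> \<le> max C (Q / p powr (2 * t)) * min 1 (norm h powr (2 * t))"
      using m Q by (intro mult_mono) (auto simp: le_max_iff_disj)
    finally show ?thesis using Q' by (meson ennreal_leI order_trans)
  qed
qed

section \<open>The translation argument\<close>

text \<open>The open cone with axis \<open>e\<close>, described through balls so that small perturbations of a vector on the
  axis visibly stay inside.\<close>

definition cone :: "'a::euclidean_space \<Rightarrow> real \<Rightarrow> 'a set" where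
  "cone e \<kappa> = {h. \<exists>\<rho>>0. norm (h - \<rho> *\<^sub>R e) < \<kappa> * \<rho>}"

text \<open>Near \<open>p\<close>, short shifts along the cone never lead from the complement into \<open>\<Omega>\<close>. A function vanishing
  outside \<open>\<Omega>\<close> therefore keeps this property under a localised shift.\<close>

definition complement_cone_property :: "'a::euclidean_space set \<Rightarrow> 'a \<Rightarrow> bool" where
  "complement_cone_property \<Omega> p \<longleftrightarrow>
     (\<exists>r>0. \<exists>e \<kappa>. norm e = 1 \<and> \<kappa> > 0 \<and>
        (\<forall>x \<in> ball p r - \<Omega>. \<forall>h \<in> cone e \<kappa>. norm h < r \<longrightarrow> x + h \<notin> \<Omega>))"

lemma cone_double: "h \<in> cone e \<kappa> \<Longrightarrow> 2 *\<^sub>R h \<in> cone e \<kappa>"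
proof -
  assume "h \<in> cone e \<kappa>"
  then obtain \<rho> where r: "0 < \<rho>" "norm (h - \<rho> *\<^sub>R e) < \<kappa> * \<rho>" by (auto simp: cone_def)
  have "2 *\<^sub>R h - (2 * \<rho>) *\<^sub>R e = 2 *\<^sub>R (h - \<rho> *\<^sub>R e)" by (simp add: algebra_simps)
  then have "norm (2 *\<^sub>R h - (2 * \<rho>) *\<^sub>R e) < \<kappa> * (2 * \<rho>)" using r by simp
  then show ?thesis using r by (auto simp: cone_def intro!: exI[of _ "2 * \<rho>"])
qed

lemma gagliardo_diff_le:
  fixes v w :: "'a::euclidean_space \<Rightarrow> real"
  assumes [measurable]: "v \<in> borel_measurable borel" "w \<in> borel_measurable borel"
  shows "gagliardo s (\<lambda>x. v x - w x) \<le> 2 * gagliardo s v + 2 * gagliardo s w"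
proof -
  define n where "n = real DIM('a)"
  have "gagliardo s (\<lambda>x. v x - w x) \<le> (\<integral>\<^sup>+ x. \<integral>\<^sup>+ y. 2 * ennreal ((v x - v y)\<^sup>2 / norm (x - y) powr (n + 2 * s))
      + 2 * ennreal ((w x - w y)\<^sup>2 / norm (x - y) powr (n + 2 * s)) \<partial>lborel \<partial>lborel)"
    unfolding gagliardo_def n_def[symmetric]
  proof (intro nn_integral_mono)
    fix x y
    have "(v x - w x - (v y - w y))\<^sup>2 \<le> 2 * (v x - v y)\<^sup>2 + 2 * (w x - w y)\<^sup>2"
    proof -
      have "v x - w x - (v y - w y) = (v x - v y) - (w x - w y)" by simp
      then show ?thesis
        using square_diff_le[of "v x - v y" "w x - w y" 0] by (simp only: diff_0 diff_0_right power2_minus)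
    qed
    then have "(v x - w x - (v y - w y))\<^sup>2 / norm (x - y) powr (n + 2 * s)
        \<le> (2 * (v x - v y)\<^sup>2 + 2 * (w x - w y)\<^sup>2) / norm (x - y) powr (n + 2 * s)"
      by (rule divide_right_mono) simp
    also have "\<dots> = 2 * ((v x - v y)\<^sup>2 / norm (x - y) powr (n + 2 * s)) + 2 * ((w x - w y)\<^sup>2 / norm (x - y) powr (n + 2 * s))"
      by (simp add: add_divide_distrib)
    finally have "ennreal ((v x - w x - (v y - w y))\<^sup>2 / norm (x - y) powr (n + 2 * s)) \<le> ennreal \<dots>"
      by (rule ennreal_leI)
    then show "ennreal ((v x - w x - (v y - w y))\<^sup>2 / norm (x - y) powr (n + 2 * s)) \<le> 2 * ennreal ((v x - v y)\<^sup>2 / norm (x - y) powr (n + 2 * s))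
      + 2 * ennreal ((w x - w y)\<^sup>2 / norm (x - y) powr (n + 2 * s))"
      by (simp add: ennreal_mult del: times_divide_eq_right)
  qed
  also have "\<dots> = 2 * gagliardo s v + 2 * gagliardo s w"
    by (simp add: nn_integral_add nn_integral_cmult gagliardo_def n_def)
  finally show ?thesis .
qed

text \<open>A Marchaud type argument. Since \<open>\<theta> < 2\<close>, the parameter \<open>e\<close> can be chosen with
  \<open>(1 + e) / 4 * 2 powr \<theta> < 1\<close>, so that a bound of order \<open>\<theta>\<close> at \<open>2 h\<close> reproduces itself at \<open>h\<close>.
  The vectors of norm between \<open>r / 2\<close> and \<open>r\<close> start the induction.\<close>

lemma doubling_iteration:
  fixes m :: "'a::real_normed_vector \<Rightarrow> ennreal"
  assumes th: "0 < \<theta>" "\<theta> < 2" and r: "0 < r"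
    and H2: "\<And>h. h \<in> H \<Longrightarrow> 2 *\<^sub>R h \<in> H"
    and C0: "0 \<le> C0" and bnd: "\<And>h. h \<in> H \<Longrightarrow> norm h \<le> r \<Longrightarrow> m h \<le> ennreal C0"
    and C3: "0 \<le> C3"
    and rec: "\<And>h e. h \<in> H \<Longrightarrow> 2 * norm h \<le> r \<Longrightarrow> 0 < e \<Longrightarrow>
        m h \<le> ennreal ((1 + e) / 4) * m (2 *\<^sub>R h) + ennreal ((1 + 1 / e) * C3 * norm h powr \<theta>)"
  shows "\<exists>B\<ge>0. \<forall>h\<in>H. h \<noteq> 0 \<longrightarrow> norm h \<le> r \<longrightarrow> m h \<le> ennreal (B * norm h powr \<theta>)"
proof -
  \<comment> \<open>With this choice the factor \<open>q\<close> below is the average of 1 and \<open>2 powr \<theta> / 4\<close>.\<close>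
  define e where "e = (4 / 2 powr \<theta> - 1) / 2"
  have two: "2 powr \<theta> < 4" using powr_less_mono[of \<theta> 2 2] th by simp
  have e: "0 < e" using two by (simp add: e_def)
  define q where "q = (1 + e) / 4 * 2 powr \<theta>"
  have q: "q = 2 powr \<theta> / 8 + 1 / 2" by (simp add: q_def e_def field_simps)
  have q1: "0 < q" "q < 1" using two by (auto simp: q intro: add_pos_pos)
  define C4 where "C4 = (1 + 1 / e) * C3"
  have C4: "0 \<le> C4" using C3 e by (simp add: C4_def)
  define B where "B = max (C0 / (r / 2) powr \<theta>) (C4 / (1 - q))"
  have B: "0 \<le> B" using C0 by (simp add: B_def le_max_iff_disj)
  have B0: "C0 \<le> B * (r / 2) powr \<theta>"
    using r by (simp add: B_def pos_divide_le_eq[symmetric])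
  have B1: "q * B + C4 \<le> B"
  proof -
    have "C4 / (1 - q) \<le> B" by (simp add: B_def)
    then have "C4 \<le> B * (1 - q)" using q1 by (simp add: pos_divide_le_eq)
    then show ?thesis by (simp add: algebra_simps)
  qed
  have far: "m h \<le> ennreal (B * norm h powr \<theta>)" if "h \<in> H" "r / 2 < norm h" "norm h \<le> r" for h
  proof -
    have "(r / 2) powr \<theta> \<le> norm h powr \<theta>" using that r th by (intro powr_mono2) auto
    then have "C0 \<le> B * norm h powr \<theta>" using B0 B by (meson mult_left_mono order_trans)
    then show ?thesis using bnd[OF that(1,3)] by (meson ennreal_leI order_trans)
  qed
  have main: "\<forall>h\<in>H. r / 2 ^ (k + 1) < norm h \<longrightarrow> norm h \<le> r \<longrightarrow> m h \<le> ennreal (B * norm h powr \<theta>)" for k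
  proof (induction k)
    case 0 then show ?case using far by auto
  next
    case (Suc k)
    show ?case
    proof (intro ballI impI)
      fix h assume h: "h \<in> H" "r / 2 ^ (Suc k + 1) < norm h" "norm h \<le> r"
      show "m h \<le> ennreal (B * norm h powr \<theta>)"
      proof (cases "r / 2 < norm h")
        case True then show ?thesis using far h by simp
      next
        case False
        have n2: "norm (2 *\<^sub>R h) = 2 * norm h" by simp
        have "r / 2 ^ (k + 1) < norm (2 *\<^sub>R h)" "norm (2 *\<^sub>R h) \<le> r"
          using h(2) False by (auto simp: field_simps)
        then have "m (2 *\<^sub>R h) \<le> ennreal (B * norm (2 *\<^sub>R h) powr \<theta>)" using Suc H2 h(1) by blast
        moreover have "m h \<le> ennreal ((1 + e) / 4) * m (2 *\<^sub>R h) + ennreal (C4 * norm h powr \<theta>)"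
          using rec[OF h(1) _ e] False by (simp add: C4_def)
        ultimately have "m h \<le> ennreal ((1 + e) / 4) * ennreal (B * (2 * norm h) powr \<theta>) + ennreal (C4 * norm h powr \<theta>)"
          by (smt (verit, ccfv_SIG) add_right_mono mult_left_mono n2 order_trans zero_le)
        also have "\<dots> = ennreal ((1 + e) / 4 * (B * (2 * norm h) powr \<theta>) + C4 * norm h powr \<theta>)"
          using e B C4 by (simp add: ennreal_mult[symmetric] ennreal_plus[symmetric] del: ennreal_plus)
        also have "(1 + e) / 4 * (B * (2 * norm h) powr \<theta>) + C4 * norm h powr \<theta> = (q * B + C4) * norm h powr \<theta>"
          by (simp add: q_def powr_mult algebra_simps)
        also have "ennreal \<dots> \<le> ennreal (B * norm h powr \<theta>)"
          using B1 by (intro ennreal_leI mult_right_mono) auto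
        finally show ?thesis .
      qed
    qed
  qed
  show ?thesis
  proof (intro exI[of _ B] conjI ballI impI B)
    fix h assume h: "h \<in> H" "h \<noteq> 0" "norm h \<le> r"
    obtain k where "r / norm h < 2 ^ k" using real_arch_pow[of 2 "r / norm h"] by auto
    also have "(2::real) ^ k \<le> 2 ^ (k + 1)" by simp
    finally have "r / 2 ^ (k + 1) < norm h" using h by (simp add: field_simps)
    then show "m h \<le> ennreal (B * norm h powr \<theta>)" using main h by blast
  qed
qed

text \<open>The energy hypothesis compares \<open>u\<close> with its localised shift. The seminorm of \<open>u\<close> cancels up to
  terms of order \<open>norm h\<close> and terms of the size of the \<open>L\<^sup>2\<close> norm of the shift difference, that is
  \<open>norm h powr \<sigma>\<close>. Young's inequality is used with the parameter \<open>norm h powr \<sigma>\<close> throughout.\<close>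

lemma localised_shift_energy:
  fixes u \<phi> :: "'a::euclidean_space \<Rightarrow> real"
  assumes [measurable]: "u \<in> borel_measurable borel" "\<phi> \<in> borel_measurable borel"
    and u: "square_integral u < \<infinity>" "gagliardo s u < \<infinity>"
    and s: "0 < s" "s < 1 / 2"
    and \<sigma>: "0 \<le> \<sigma>" "\<sigma> \<le> 2 * s"
    and C: "0 \<le> C" "\<And>h. square_integral (shift_diff h u) \<le> ennreal (C * min 1 (norm h powr (2 * \<sigma>)))"
    and \<phi>: "\<And>x. 0 \<le> \<phi> x" "\<And>x. \<phi> x \<le> 1"
    and lip: "\<And>x y. \<bar>\<phi> x - \<phi> y\<bar> \<le> L * norm (x - y)" and L: "1 \<le> L"
    and F: "0 \<le> F"
    and h: "h \<noteq> 0" "norm h \<le> 1"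
    and energy: "\<And>\<eta>. 0 < \<eta> \<Longrightarrow> gagliardo s (\<lambda>x. \<phi> x * shift_diff h u x) + gagliardo s u
        \<le> gagliardo s (\<lambda>x. u x + \<phi> x * shift_diff h u x) + ennreal (F * \<eta>)
          + ennreal (1 / \<eta>) * square_integral (\<lambda>x. \<phi> x * shift_diff h u x)"
  shows "gagliardo s (\<lambda>x. \<phi> x * shift_diff h u x)
     \<le> ennreal ((enn2real (gagliardo s u) * (1 + 2 * L) + 2 * L\<^sup>2 * kernel_mass s TYPE('a) * C + F + C) * norm h powr \<sigma>)"
proof -
  define G where "G = enn2real (gagliardo s u)"
  have G: "gagliardo s u = ennreal G" "0 \<le> G" using u(2) by (auto simp: G_def)
  define \<eta> where "\<eta> = norm h powr \<sigma>"
  have \<eta>: "0 < \<eta>" using h by (simp add: \<eta>_def)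
  have hn: "norm h \<le> \<eta>"
    using powr_mono'[of \<sigma> 1 "norm h"] h \<sigma> s by (simp add: \<eta>_def)
  have \<eta>1: "\<eta> \<le> 1" using powr_mono2[of \<sigma> "norm h" 1] h \<sigma> by (simp add: \<eta>_def)
  define k where "k = kernel_mass s TYPE('a)"
  have k: "0 \<le> k" by (simp add: k_def kernel_mass_def)
  define w where "w = (\<lambda>x. \<phi> x * shift_diff h u x)"
  have \<eta>2: "norm h powr (2 * \<sigma>) = \<eta>\<^sup>2"
    by (simp add: \<eta>_def power2_eq_square powr_add[symmetric])
  have M: "square_integral (shift_diff h u) \<le> ennreal (C * \<eta>\<^sup>2)"
  proof -
    have "C * min 1 (norm h powr (2 * \<sigma>)) \<le> C * \<eta>\<^sup>2"
      unfolding \<eta>2 using C(1) by (intro mult_left_mono) auto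
    then show ?thesis using C(2)[of h] by (meson ennreal_leI order_trans)
  qed
  have w: "square_integral w \<le> square_integral (shift_diff h u)"
    unfolding square_integral_def w_def power_mult_distrib using \<phi>
    by (intro nn_integral_mono ennreal_leI mult_left_le_one_le) (auto intro: power_le_one)
  have "gagliardo s w + ennreal G \<le> gagliardo s (\<lambda>x. u x + \<phi> x * shift_diff h u x) + ennreal (F * \<eta>) + ennreal (1 / \<eta>) * square_integral w"
    using energy[OF \<eta>] G by (simp add: w_def)
  also have "\<dots> \<le> (ennreal ((1 + \<eta>) * (1 + L * norm h)) * ennreal G + ennreal ((1 + 1 / \<eta>) * L\<^sup>2 * k) * ennreal (C * \<eta>\<^sup>2))
       + ennreal (F * \<eta>) + ennreal (1 / \<eta>) * ennreal (C * \<eta>\<^sup>2)"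
  proof -
    have "gagliardo s (\<lambda>x. u x + \<phi> x * shift_diff h u x) \<le> ennreal ((1 + \<eta>) * (1 + L * norm h)) * ennreal G
       + ennreal ((1 + 1 / \<eta>) * L\<^sup>2 * k) * square_integral (shift_diff h u)"
      using gagliardo_localised_shift[OF assms(1,2) \<phi> lip L s(1) _ \<eta>, of h] s G by (simp add: k_def)
    also have "\<dots> \<le> ennreal ((1 + \<eta>) * (1 + L * norm h)) * ennreal G + ennreal ((1 + 1 / \<eta>) * L\<^sup>2 * k) * ennreal (C * \<eta>\<^sup>2)"
      using M by (intro add_left_mono mult_left_mono) auto
    finally show ?thesis using order_trans[OF w M]
      by (intro add_mono mult_left_mono order_refl) auto
  qed
  also have "\<dots> = ennreal ((1 + \<eta>) * (1 + L * norm h) * G + (1 + 1 / \<eta>) * L\<^sup>2 * k * (C * \<eta>\<^sup>2) + F * \<eta> + 1 / \<eta> * (C * \<eta>\<^sup>2))"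
    using \<eta> L G(2) k C(1) F by (simp add: ennreal_mult[symmetric] ennreal_plus[symmetric] del: ennreal_plus)
  also have "\<dots> \<le> ennreal (G + (G * (1 + 2 * L) + 2 * L\<^sup>2 * k * C + F + C) * \<eta>)"
  proof (rule ennreal_leI)
    have 1: "(1 + \<eta>) * (1 + L * norm h) \<le> 1 + (1 + 2 * L) * \<eta>"
    proof -
      have "(1 + \<eta>) * (1 + L * norm h) \<le> (1 + \<eta>) * (1 + L * \<eta>)"
        using \<eta> L hn by (intro mult_left_mono add_left_mono) auto
      also have "\<dots> = 1 + (1 + L) * \<eta> + L * (\<eta> * \<eta>)" by (simp add: algebra_simps)
      also have "\<dots> \<le> 1 + (1 + L) * \<eta> + L * (\<eta> * 1)" using \<eta> \<eta>1 L by (intro add_left_mono mult_left_mono) auto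
      finally show ?thesis by (simp add: algebra_simps)
    qed
    have 2: "(1 + 1 / \<eta>) * \<eta>\<^sup>2 \<le> 2 * \<eta>"
      using \<eta> \<eta>1 by (simp add: power2_eq_square field_simps)
    have "(1 + 1 / \<eta>) * L\<^sup>2 * k * (C * \<eta>\<^sup>2) = L\<^sup>2 * k * C * ((1 + 1 / \<eta>) * \<eta>\<^sup>2)" by (simp add: algebra_simps)
    also have "\<dots> \<le> L\<^sup>2 * k * C * (2 * \<eta>)" using 2 k C(1) by (intro mult_left_mono) auto
    finally have "(1 + 1 / \<eta>) * L\<^sup>2 * k * (C * \<eta>\<^sup>2) \<le> L\<^sup>2 * k * C * (2 * \<eta>)" .
    moreover have "(1 + \<eta>) * (1 + L * norm h) * G \<le> (1 + (1 + 2 * L) * \<eta>) * G"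
      using 1 G(2) by (rule mult_right_mono)
    moreover have "1 / \<eta> * (C * \<eta>\<^sup>2) = C * \<eta>" using \<eta> by (simp add: power2_eq_square)
    ultimately show "(1 + \<eta>) * (1 + L * norm h) * G + (1 + 1 / \<eta>) * L\<^sup>2 * k * (C * \<eta>\<^sup>2) + F * \<eta> + 1 / \<eta> * (C * \<eta>\<^sup>2)
       \<le> G + (G * (1 + 2 * L) + 2 * L\<^sup>2 * k * C + F + C) * \<eta>"
      by (simp add: algebra_simps)
  qed
  also have "\<dots> = ennreal ((G * (1 + 2 * L) + 2 * L\<^sup>2 * k * C + F + C) * \<eta>) + ennreal G"
    using G(2) L k C(1) F \<eta> by (subst ennreal_plus[symmetric]) (auto simp: add.commute)
  finally have "gagliardo s w \<le> ennreal ((G * (1 + 2 * L) + 2 * L\<^sup>2 * k * C + F + C) * \<eta>)"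
    by (simp add: add.commute[of _ "ennreal G"] ennreal_add_left_cancel_le)
  then show ?thesis by (simp add: w_def G_def k_def \<eta>_def)
qed

text \<open>Let \<open>w = \<phi> * (u (\<cdot> + h) - u)\<close>. Its seminorm is of order \<open>\<sigma> / 2\<close> in \<open>h\<close>, so shifting \<open>w\<close> once more gains
  a factor \<open>norm h powr s\<close>. Up to the increments of the cutoff this double shift is the second difference
  of \<open>u\<close>, and because \<open>s + \<sigma> / 2 < 1\<close> a bound on second differences implies the same bound on first
  differences.\<close>

lemma localised_modulus_improvement:
  fixes u \<phi> :: "'a::euclidean_space \<Rightarrow> real"
  assumes [measurable]: "u \<in> borel_measurable borel" "\<phi> \<in> borel_measurable borel"
    and u: "square_integral u < \<infinity>" "gagliardo s u < \<infinity>"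
    and s: "0 < s" "s < 1 / 2"
    and \<sigma>: "0 \<le> \<sigma>" "\<sigma> \<le> 2 * s" "translation_order \<sigma> u"
    and \<phi>: "\<And>x. 0 \<le> \<phi> x" "\<And>x. \<phi> x \<le> 1"
    and lip: "\<And>x y. \<bar>\<phi> x - \<phi> y\<bar> \<le> L * norm (x - y)" and L: "1 \<le> L"
    and F: "0 \<le> F"
    and H2: "\<And>h. h \<in> H \<Longrightarrow> 2 *\<^sub>R h \<in> H"
    and r: "0 < r" "r \<le> 1"
    and energy: "\<And>h \<eta>. h \<in> H \<Longrightarrow> norm h \<le> r \<Longrightarrow> 0 < \<eta> \<Longrightarrow>
       gagliardo s (\<lambda>x. \<phi> x * shift_diff h u x) + gagliardo s u
        \<le> gagliardo s (\<lambda>x. u x + \<phi> x * shift_diff h u x) + ennreal (F * \<eta>)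
          + ennreal (1 / \<eta>) * square_integral (\<lambda>x. \<phi> x * shift_diff h u x)"
  shows "\<exists>B\<ge>0. \<forall>h\<in>H. h \<noteq> 0 \<longrightarrow> norm h \<le> r \<longrightarrow>
     square_integral (\<lambda>x. \<phi> x * shift_diff h u x) \<le> ennreal (B * norm h powr (2 * s + \<sigma>))"
proof -
  define \<theta> where "\<theta> = 2 * s + \<sigma>"
  have th: "0 < \<theta>" "\<theta> < 2" using s \<sigma> by (auto simp: \<theta>_def)
  obtain C' where C': "\<And>h. square_integral (shift_diff h u) \<le> ennreal (C' * min 1 (norm h powr (2 * \<sigma>)))"
    using \<sigma> by (auto simp: translation_order_def)
  define C where "C = max 0 C'"
  have C: "0 \<le> C" by (simp add: C_def)
  have Cm: "square_integral (shift_diff h u) \<le> ennreal (C * min 1 (norm h powr (2 * \<sigma>)))" for h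
    by (rule order_trans[OF C']) (auto intro!: ennreal_leI mult_right_mono simp: C_def)
  have Cm1: "square_integral (shift_diff h u) \<le> ennreal C" for h
  proof (rule order_trans[OF Cm ennreal_leI])
    show "C * min 1 (norm h powr (2 * \<sigma>)) \<le> C" using mult_left_mono[OF _ C, of "min 1 (norm h powr (2 * \<sigma>))" 1] by simp
  qed
  define W where "W = (\<lambda>h x. \<phi> x * shift_diff h u x)"
  have [measurable]: "W h \<in> borel_measurable borel" for h
    unfolding W_def by measurable
  define C1 where "C1 = enn2real (gagliardo s u) * (1 + 2 * L) + 2 * L\<^sup>2 * kernel_mass s TYPE('a) * C + F + C"
  have C1: "0 \<le> C1" using L C F by (auto simp: C1_def kernel_mass_def)
  have E: "gagliardo s (W h) \<le> ennreal (C1 * norm h powr \<sigma>)" if "h \<in> H" "h \<noteq> 0" "norm h \<le> r" for h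
    unfolding W_def C1_def
    by (rule localised_shift_energy[OF assms(1,2) u s \<sigma>(1,2) C Cm \<phi> lip L F]) (use that r energy in auto)
  define C2 where "C2 = 4 * 2 powr (real DIM('a) + 2 * s) / unit_ball_vol DIM('a)"
  have C2: "0 \<le> C2" by (simp add: C2_def)
  define C3 where "C3 = 2 * C2 * C1 + 2 * L\<^sup>2 * C"
  have C3: "0 \<le> C3" using C2 C1 C by (simp add: C3_def)
  define D2 where "D2 = (\<lambda>h x. u (x + 2 *\<^sub>R h) - 2 * u (x + h) + u x)"
  have [measurable]: "D2 h \<in> borel_measurable borel" for h
    unfolding D2_def by measurable
  have [measurable]: "shift_diff h u \<in> borel_measurable borel" "shift_diff h (W h) \<in> borel_measurable borel" for h
    by (intro measurable_shift_diff; measurable)+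
  have second: "square_integral (\<lambda>x. \<phi> x * D2 h x) \<le> ennreal (C3 * norm h powr \<theta>)" if h: "h \<in> H" "h \<noteq> 0" "norm h \<le> r" for h
  proof -
    have "square_integral (\<lambda>x. \<phi> x * D2 h x) \<le> (\<integral>\<^sup>+x. 2 * ennreal ((shift_diff h (W h) x)\<^sup>2) + ennreal (2 * (L * norm h)\<^sup>2) * ennreal ((shift_diff h u (x + h))\<^sup>2) \<partial>lborel)"
      unfolding square_integral_def
    proof (intro nn_integral_mono)
      fix x
      have e: "\<phi> x * D2 h x = shift_diff h (W h) x - (\<phi> (x + h) - \<phi> x) * shift_diff h u (x + h)"
        by (simp add: W_def D2_def shift_diff_def scaleR_2 algebra_simps)
      have "\<bar>\<phi> (x + h) - \<phi> x\<bar> \<le> L * norm h" using lip[of "x + h" x] by simp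
      then have "(\<phi> (x + h) - \<phi> x)\<^sup>2 \<le> (L * norm h)\<^sup>2" using abs_le_square_iff[of "\<phi> (x + h) - \<phi> x" "L * norm h"] L by simp
      then have "((\<phi> (x + h) - \<phi> x) * shift_diff h u (x + h))\<^sup>2 \<le> (L * norm h)\<^sup>2 * (shift_diff h u (x + h))\<^sup>2"
        unfolding power_mult_distrib[of "\<phi> (x + h) - \<phi> x"] by (intro mult_right_mono) auto
      then have "(\<phi> x * D2 h x)\<^sup>2 \<le> 2 * (shift_diff h (W h) x)\<^sup>2 + 2 * (L * norm h)\<^sup>2 * (shift_diff h u (x + h))\<^sup>2"
        unfolding e using square_diff_le[of "shift_diff h (W h) x" "(\<phi> (x + h) - \<phi> x) * shift_diff h u (x + h)" 0] by simp
      then have "ennreal ((\<phi> x * D2 h x)\<^sup>2) \<le> ennreal (2 * (shift_diff h (W h) x)\<^sup>2 + 2 * (L * norm h)\<^sup>2 * (shift_diff h u (x + h))\<^sup>2)"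
        by (rule ennreal_leI)
      also have "\<dots> = 2 * ennreal ((shift_diff h (W h) x)\<^sup>2) + ennreal (2 * (L * norm h)\<^sup>2) * ennreal ((shift_diff h u (x + h))\<^sup>2)"
        by (simp add: ennreal_mult)
      finally show "ennreal ((\<phi> x * D2 h x)\<^sup>2) \<le> \<dots>" .
    qed
    also have "\<dots> = 2 * square_integral (shift_diff h (W h)) + ennreal (2 * (L * norm h)\<^sup>2) * (\<integral>\<^sup>+x. ennreal ((shift_diff h u (x + h))\<^sup>2) \<partial>lborel)"
      by (simp add: nn_integral_add nn_integral_cmult square_integral_def)
    also have "(\<integral>\<^sup>+x. ennreal ((shift_diff h u (x + h))\<^sup>2) \<partial>lborel) = square_integral (shift_diff h u)"
      unfolding square_integral_def by (rule nn_integral_lborel_shift) measurable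
    also have "2 * square_integral (shift_diff h (W h)) + ennreal (2 * (L * norm h)\<^sup>2) * square_integral (shift_diff h u)
        \<le> 2 * (ennreal (C2 * norm h powr (2 * s)) * ennreal (C1 * norm h powr \<sigma>)) + ennreal (2 * (L * norm h)\<^sup>2) * ennreal C"
    proof -
      have "square_integral (shift_diff h (W h)) \<le> ennreal (C2 * norm h powr (2 * s)) * gagliardo s (W h)"
        unfolding C2_def using s by (intro shift_diff_estimate) auto
      also have "\<dots> \<le> ennreal (C2 * norm h powr (2 * s)) * ennreal (C1 * norm h powr \<sigma>)"
        using E[OF h] by (rule mult_left_mono) simp
      finally show ?thesis using Cm1[of h] by (intro add_mono mult_left_mono) auto
    qed
    also have "\<dots> = ennreal (2 * C2 * C1 * norm h powr \<theta> + 2 * L\<^sup>2 * C * (norm h)\<^sup>2)"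
    proof -
      have "2 * C2 * C1 * norm h powr \<theta> = 2 * ((C2 * norm h powr (2 * s)) * (C1 * norm h powr \<sigma>))"
        by (simp add: \<theta>_def powr_add)
      moreover have "2 * L\<^sup>2 * C * (norm h)\<^sup>2 = (2 * (L * norm h)\<^sup>2) * C" by (simp add: power_mult_distrib)
      ultimately show ?thesis using C C1 C2 by (simp only: ennreal_mult ennreal_plus) (simp add: ennreal_mult)
    qed
    also have "\<dots> \<le> ennreal (C3 * norm h powr \<theta>)"
    proof (rule ennreal_leI)
      have "norm h powr 2 \<le> norm h powr \<theta>" using h r th by (intro powr_mono') auto
      then have "(norm h)\<^sup>2 \<le> norm h powr \<theta>" using h by simp
      then have "2 * L\<^sup>2 * C * (norm h)\<^sup>2 \<le> 2 * L\<^sup>2 * C * norm h powr \<theta>" using C by (intro mult_left_mono) auto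
      then show "2 * C2 * C1 * norm h powr \<theta> + 2 * L\<^sup>2 * C * (norm h)\<^sup>2 \<le> C3 * norm h powr \<theta>"
        by (simp add: C3_def algebra_simps)
    qed
    finally show ?thesis .
  qed
  have "\<exists>B\<ge>0. \<forall>h\<in>H - {0}. h \<noteq> 0 \<longrightarrow> norm h \<le> r \<longrightarrow> square_integral (W h) \<le> ennreal (B * norm h powr \<theta>)"
  proof (rule doubling_iteration[OF th r(1) _ C _ C3])
    show "2 *\<^sub>R h \<in> H - {0}" if "h \<in> H - {0}" for h using that H2 by auto
    show "square_integral (W h) \<le> ennreal C" for h
    proof -
      have "square_integral (W h) \<le> square_integral (shift_diff h u)"
        unfolding square_integral_def W_def power_mult_distrib using \<phi>
        by (intro nn_integral_mono ennreal_leI mult_left_le_one_le) (auto intro: power_le_one)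
      then show ?thesis using Cm1 order_trans by blast
    qed
    fix h and e :: real assume h: "h \<in> H - {0}" "2 * norm h \<le> r" and e: "0 < e"
    have "square_integral (W h) \<le> (\<integral>\<^sup>+x. ennreal ((1 + e) / 4) * ennreal ((W (2 *\<^sub>R h) x)\<^sup>2) + ennreal ((1 + 1 / e) / 4) * ennreal ((\<phi> x * D2 h x)\<^sup>2) \<partial>lborel)"
      unfolding square_integral_def
    proof (intro nn_integral_mono)
      fix x
      have "2 * W h x = W (2 *\<^sub>R h) x + (- (\<phi> x * D2 h x))"
        by (simp add: W_def D2_def shift_diff_def algebra_simps)
      then have "(2 * W h x)\<^sup>2 \<le> (1 + e) * (W (2 *\<^sub>R h) x)\<^sup>2 + (1 + 1 / e) * (- (\<phi> x * D2 h x))\<^sup>2"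
        by (simp only: square_add_le[OF e])
      then have "(W h x)\<^sup>2 \<le> (1 + e) / 4 * (W (2 *\<^sub>R h) x)\<^sup>2 + (1 + 1 / e) / 4 * (\<phi> x * D2 h x)\<^sup>2"
        by (simp add: power_mult_distrib field_simps)
      then have "ennreal ((W h x)\<^sup>2) \<le> ennreal ((1 + e) / 4 * (W (2 *\<^sub>R h) x)\<^sup>2 + (1 + 1 / e) / 4 * (\<phi> x * D2 h x)\<^sup>2)"
        by (rule ennreal_leI)
      also have "\<dots> = ennreal ((1 + e) / 4) * ennreal ((W (2 *\<^sub>R h) x)\<^sup>2) + ennreal ((1 + 1 / e) / 4) * ennreal ((\<phi> x * D2 h x)\<^sup>2)"
        using e by (subst ennreal_plus) (auto simp: ennreal_mult[symmetric])
      finally show "ennreal ((W h x)\<^sup>2) \<le> \<dots>" .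
    qed
    also have "\<dots> = ennreal ((1 + e) / 4) * square_integral (W (2 *\<^sub>R h)) + ennreal ((1 + 1 / e) / 4) * square_integral (\<lambda>x. \<phi> x * D2 h x)"
      by (simp add: nn_integral_add nn_integral_cmult square_integral_def)
    also have "\<dots> \<le> ennreal ((1 + e) / 4) * square_integral (W (2 *\<^sub>R h)) + ennreal ((1 + 1 / e) * C3 * norm h powr \<theta>)"
    proof (intro add_left_mono)
      have "norm h \<le> r" using h(2) norm_ge_zero[of h] by linarith
      then have "ennreal ((1 + 1 / e) / 4) * square_integral (\<lambda>x. \<phi> x * D2 h x) \<le> ennreal ((1 + 1 / e) / 4) * ennreal (C3 * norm h powr \<theta>)"
        using second[of h] h by (intro mult_left_mono) auto
      also have "\<dots> = ennreal ((1 + 1 / e) / 4 * (C3 * norm h powr \<theta>))"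
        using e C3 by (intro ennreal_mult[symmetric]) auto
      also have "\<dots> \<le> ennreal ((1 + 1 / e) * (C3 * norm h powr \<theta>))"
      proof (intro ennreal_leI mult_right_mono)
        show "(1 + 1 / e) / 4 \<le> 1 + 1 / e" using e by (simp add: field_simps)
      qed (use C3 in auto)
      finally show "ennreal ((1 + 1 / e) / 4) * square_integral (\<lambda>x. \<phi> x * D2 h x) \<le> ennreal ((1 + 1 / e) * C3 * norm h powr \<theta>)"
        by (simp add: mult.assoc)
    qed
    finally show "square_integral (W h) \<le> ennreal ((1 + e) / 4) * square_integral (W (2 *\<^sub>R h)) + ennreal ((1 + 1 / e) * C3 * norm h powr \<theta>)" .
  qed
  then show ?thesis by (auto simp: W_def \<theta>_def)
qed

text \<open>Only shifts along the cone are admissible, but every short vector is the difference of two vectors of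
  comparable length in the cone.\<close>

lemma shift_modulus_near_point:
  fixes u :: "'a::euclidean_space \<Rightarrow> real"
  assumes [measurable]: "u \<in> borel_measurable borel"
    and u: "square_integral u < \<infinity>" "gagliardo s u < \<infinity>" "\<And>x. x \<notin> \<Omega> \<Longrightarrow> u x = 0"
    and s: "0 < s" "s < 1 / 2"
    and \<sigma>: "0 \<le> \<sigma>" "\<sigma> \<le> 2 * s" "translation_order \<sigma> u"
    and F: "0 \<le> F"
    and energy: "\<And>w \<eta>. w \<in> borel_measurable borel \<Longrightarrow> square_integral w < \<infinity> \<Longrightarrow> gagliardo s w < \<infinity> \<Longrightarrow>
       (\<And>x. x \<notin> \<Omega> \<Longrightarrow> w x = 0) \<Longrightarrow> 0 < \<eta> \<Longrightarrow>
       gagliardo s w + gagliardo s u \<le> gagliardo s (\<lambda>x. u x + w x) + ennreal (F * \<eta>) + ennreal (1 / \<eta>) * square_integral w"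
    and p: "complement_cone_property \<Omega> p"
  shows "\<exists>d>0. \<exists>B\<ge>0. \<forall>h. norm h \<le> d \<longrightarrow>
     (\<integral>\<^sup>+x. ennreal ((shift_diff h u x)\<^sup>2) * indicator (ball p d) x \<partial>lborel) \<le> ennreal (B * norm h powr (2 * s + \<sigma>))"
proof -
  define \<theta> where "\<theta> = 2 * s + \<sigma>"
  have th: "0 < \<theta>" using s \<sigma> by (auto simp: \<theta>_def)
  obtain r e \<kappa>' where r: "0 < r" and e: "norm e = 1" and k': "\<kappa>' > 0"
    and cone': "\<And>x h. x \<in> ball p r \<Longrightarrow> x \<notin> \<Omega> \<Longrightarrow> h \<in> cone e \<kappa>' \<Longrightarrow> norm h < r \<Longrightarrow> x + h \<notin> \<Omega>"
    using p unfolding complement_cone_property_def by blast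
  define \<kappa> where "\<kappa> = min \<kappa>' 1"
  have k: "0 < \<kappa>" "\<kappa> \<le> 1" using k' by (auto simp: \<kappa>_def)
  have "cone e \<kappa> \<subseteq> cone e \<kappa>'"
  proof
    fix h assume "h \<in> cone e \<kappa>"
    then obtain \<rho> where \<rho>: "0 < \<rho>" "norm (h - \<rho> *\<^sub>R e) < \<kappa> * \<rho>" by (auto simp: cone_def)
    have "\<kappa> * \<rho> \<le> \<kappa>' * \<rho>" using \<rho> by (intro mult_right_mono) (auto simp: \<kappa>_def)
    then show "h \<in> cone e \<kappa>'" using \<rho> order.strict_trans2[OF \<rho>(2)] by (auto simp: cone_def)
  qed
  then have cone: "x + h \<notin> \<Omega>" if "x \<in> ball p r" "x \<notin> \<Omega>" "h \<in> cone e \<kappa>" "norm h < r" for x h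
    using cone' that by blast
  define R where "R = min r 1"
  have R: "0 < R" "R \<le> 1" "R \<le> r" using r by (simp_all add: R_def)
  \<comment> \<open>The cutoff is 1 on the ball of radius \<open>R / 4\<close> and vanishes outside the ball of radius \<open>R / 2\<close>.\<close>
  define \<phi> where "\<phi> = (\<lambda>x. max 0 (min 1 (2 - 4 / R * dist p x)))"
  have [measurable]: "\<phi> \<in> borel_measurable borel" unfolding \<phi>_def by measurable
  have \<phi>: "0 \<le> \<phi> x" "\<phi> x \<le> 1" for x by (auto simp: \<phi>_def)
  have lip: "\<bar>\<phi> x - \<phi> y\<bar> \<le> 4 / R * norm (x - y)" for x y
  proof -
    have "\<bar>\<phi> x - \<phi> y\<bar> \<le> \<bar>4 / R * dist p x - 4 / R * dist p y\<bar>" unfolding \<phi>_def by linarith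
    also have "\<dots> = 4 / R * \<bar>dist p x - dist p y\<bar>" using R by (simp only: right_diff_distrib[symmetric] abs_mult) simp
    also have "\<dots> \<le> 4 / R * dist x y"
      using R abs_dist_diff_le[of x p y] by (intro mult_left_mono) (auto simp: dist_commute)
    finally show ?thesis by (simp add: dist_norm)
  qed
  have L: "1 \<le> 4 / R" using R by simp
  have supp: "x \<in> ball p r" if "\<phi> x \<noteq> 0" for x
  proof -
    have "4 / R * dist p x < 2" using that by (auto simp: \<phi>_def)
    then have "dist p x < R" using R by (simp add: field_simps)
    then show ?thesis using R by simp
  qed
  have one: "\<phi> x = 1" if "dist p x \<le> R / 4" for x
  proof -
    have "4 / R * dist p x \<le> 1" using that R by (simp add: field_simps)
    then show ?thesis by (simp add: \<phi>_def)
  qed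
  define W where "W = (\<lambda>h x. \<phi> x * shift_diff h u x)"
  have W_meas [measurable]: "W h \<in> borel_measurable borel" for h unfolding W_def by measurable
  have W0: "W h x = 0" if "x \<notin> \<Omega>" "h \<in> cone e \<kappa>" "norm h < r" for x h
    using u(3)[OF that(1)] cone[OF _ that] supp[of x] u(3)[of "x + h"] by (auto simp: W_def shift_diff_def)
  have Wsq: "square_integral (W h) < \<infinity>" for h
  proof -
    have "square_integral (W h) \<le> square_integral (shift_diff h u)"
      unfolding square_integral_def W_def power_mult_distrib using \<phi>
      by (intro nn_integral_mono ennreal_leI mult_left_le_one_le) (auto intro: power_le_one)
    also have "\<dots> \<le> 4 * square_integral u" by (rule square_integral_shift_diff_le) measurable
    also have "\<dots> < \<infinity>" using u by (simp add: ennreal_mult_less_top)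
    finally show ?thesis .
  qed
  have Wgag: "gagliardo s (W h) < \<infinity>" for h
  proof -
    have "square_integral (shift_diff h u) < \<infinity>"
      using order.strict_trans1[OF square_integral_shift_diff_le[OF assms(1)], of "\<infinity>" h] u by (simp add: ennreal_mult_less_top)
    then have "gagliardo s (\<lambda>x. u x + W h x) < \<infinity>"
      using order.strict_trans1[OF gagliardo_localised_shift[OF assms(1) _ \<phi> lip L s(1), of 1 h], of "\<infinity>"] u s
      by (simp add: W_def ennreal_mult_less_top)
    moreover have "gagliardo s (\<lambda>x. (u x + W h x) - u x) \<le> 2 * gagliardo s (\<lambda>x. u x + W h x) + 2 * gagliardo s u"
      by (rule gagliardo_diff_le) measurable
    ultimately show ?thesis using u by (simp add: ennreal_mult_less_top order.strict_trans1)
  qed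
  have "\<exists>B\<ge>0. \<forall>h\<in>cone e \<kappa>. h \<noteq> 0 \<longrightarrow> norm h \<le> R / 2 \<longrightarrow>
     square_integral (\<lambda>x. \<phi> x * shift_diff h u x) \<le> ennreal (B * norm h powr (2 * s + \<sigma>))"
  proof (rule localised_modulus_improvement[OF assms(1) _ u(1,2) s \<sigma> \<phi> lip L F cone_double])
    fix h and \<eta> :: real assume h: "h \<in> cone e \<kappa>" "norm h \<le> R / 2" "0 < \<eta>"
    then have hr: "norm h < r" using R by linarith
    show "gagliardo s (\<lambda>x. \<phi> x * shift_diff h u x) + gagliardo s u
           \<le> gagliardo s (\<lambda>x. u x + \<phi> x * shift_diff h u x) + ennreal (F * \<eta>) +
             ennreal (1 / \<eta>) * square_integral (\<lambda>x. \<phi> x * shift_diff h u x)"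
      using energy[OF W_meas Wsq Wgag _ h(3), of h] W0[OF _ h(1) hr] unfolding W_def by blast
  qed (use R in auto)
  then obtain B where B: "0 \<le> B" "\<And>h. h \<in> cone e \<kappa> \<Longrightarrow> h \<noteq> 0 \<Longrightarrow> norm h \<le> R / 2 \<Longrightarrow>
     square_integral (W h) \<le> ennreal (B * norm h powr \<theta>)"
    by (auto simp: W_def \<theta>_def)
  define d where "d = \<kappa> * R / 16"
  have d: "0 < d" "d \<le> R / 8" using k R mult_right_mono[of \<kappa> 1 "R"] by (auto simp: d_def)
  have "(\<integral>\<^sup>+x. ennreal ((shift_diff h u x)\<^sup>2) * indicator (ball p d) x \<partial>lborel) \<le> ennreal (4 * B * (4 / \<kappa>) powr \<theta> * norm h powr \<theta>)"
    if hd: "norm h \<le> d" for h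
  proof (cases "h = 0")
    case True then show ?thesis by (simp add: shift_diff_def)
  next
    case False
    \<comment> \<open>Then \<open>norm h < \<kappa> * \<rho>\<close>, so \<open>h + \<rho> *\<^sub>R e\<close> is still in the cone.\<close>
    define \<rho> where "\<rho> = 2 * norm h / \<kappa>"
    have \<rho>: "0 < \<rho>" using False k by (simp add: \<rho>_def)
    have \<rho>R: "\<rho> \<le> R / 8" using hd k by (simp add: \<rho>_def d_def field_simps)
    have h\<rho>: "norm h = \<kappa> * \<rho> / 2" using k by (simp add: \<rho>_def)
    then have h\<rho>2: "norm h \<le> \<rho> / 2" using k \<rho> mult_right_mono[of \<kappa> 1 \<rho>] by simp
    define h1 where "h1 = h + \<rho> *\<^sub>R e"
    define h2 where "h2 = \<rho> *\<^sub>R e"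
    have n2: "norm h2 = \<rho>" using \<rho> e by (simp add: h2_def)
    have n1: "norm h1 \<le> 2 * \<rho>" "\<rho> / 2 \<le> norm h1"
      using norm_triangle_ineq[of h h2] norm_diff_ineq[of h2 h] n2 h\<rho>2 \<rho> unfolding h1_def h2_def[symmetric] by (auto simp: add.commute)
    have "norm h < \<kappa> * \<rho>" using h\<rho> mult_pos_pos[OF k(1) \<rho>] by linarith
    then have c1: "h1 \<in> cone e \<kappa>" unfolding cone_def h1_def using \<rho> by (auto intro!: exI[of _ \<rho>])
    have c2: "h2 \<in> cone e \<kappa>" unfolding cone_def h2_def using k \<rho> by (auto intro!: exI[of _ \<rho>])
    have "(\<integral>\<^sup>+x. ennreal ((shift_diff h u x)\<^sup>2) * indicator (ball p d) x \<partial>lborel)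
       \<le> (\<integral>\<^sup>+x. 2 * ennreal ((W h1 (x + - h2))\<^sup>2) + 2 * ennreal ((W h2 (x + - h2))\<^sup>2) \<partial>lborel)"
    proof (intro nn_integral_mono)
      fix x
      show "ennreal ((shift_diff h u x)\<^sup>2) * indicator (ball p d) x \<le> 2 * ennreal ((W h1 (x + - h2))\<^sup>2) + 2 * ennreal ((W h2 (x + - h2))\<^sup>2)"
      proof (cases "x \<in> ball p d")
        case True
        have "dist p (x + - h2) \<le> dist p x + norm h2"
          using norm_triangle_ineq[of "p - x" h2] by (simp add: dist_norm algebra_simps)
        then have "dist p (x + - h2) \<le> R / 4" using True n2 \<rho>R d by auto
        then have 1: "\<phi> (x + - h2) = 1" by (rule one)
        have "shift_diff h u x = W h1 (x + - h2) - W h2 (x + - h2)"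
          using 1 by (simp add: W_def shift_diff_def h1_def h2_def algebra_simps)
        then have "(shift_diff h u x)\<^sup>2 \<le> 2 * (W h1 (x + - h2))\<^sup>2 + 2 * (W h2 (x + - h2))\<^sup>2"
          using square_diff_le[of "W h1 (x + - h2)" "W h2 (x + - h2)" 0] by simp
        then have "ennreal ((shift_diff h u x)\<^sup>2) \<le> ennreal (2 * (W h1 (x + - h2))\<^sup>2 + 2 * (W h2 (x + - h2))\<^sup>2)"
          by (rule ennreal_leI)
        then show ?thesis using True by (simp add: ennreal_mult)
      qed simp
    qed
    also have "\<dots> = 2 * (\<integral>\<^sup>+x. ennreal ((W h1 (x + - h2))\<^sup>2) \<partial>lborel) + 2 * (\<integral>\<^sup>+x. ennreal ((W h2 (x + - h2))\<^sup>2) \<partial>lborel)"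
      by (simp add: nn_integral_add nn_integral_cmult)
    also have "(\<integral>\<^sup>+x. ennreal ((W h1 (x + - h2))\<^sup>2) \<partial>lborel) = square_integral (W h1)"
      unfolding square_integral_def by (rule nn_integral_lborel_shift) measurable
    also have "(\<integral>\<^sup>+x. ennreal ((W h2 (x + - h2))\<^sup>2) \<partial>lborel) = square_integral (W h2)"
      unfolding square_integral_def by (rule nn_integral_lborel_shift) measurable
    also have "2 * square_integral (W h1) + 2 * square_integral (W h2) \<le> 2 * ennreal (B * (2 * \<rho>) powr \<theta>) + 2 * ennreal (B * (2 * \<rho>) powr \<theta>)"
    proof (intro add_mono mult_left_mono)
      have "h1 \<noteq> 0" "h2 \<noteq> 0" "norm h1 \<le> R / 2" "norm h2 \<le> R / 2" using n1 n2 \<rho> \<rho>R by auto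
      then have "square_integral (W h1) \<le> ennreal (B * norm h1 powr \<theta>)" "square_integral (W h2) \<le> ennreal (B * norm h2 powr \<theta>)"
        using B c1 c2 by auto
      moreover have "B * norm h1 powr \<theta> \<le> B * (2 * \<rho>) powr \<theta>" "B * norm h2 powr \<theta> \<le> B * (2 * \<rho>) powr \<theta>"
        using n1 n2 \<rho> th B by (auto intro!: mult_left_mono powr_mono2)
      ultimately show "square_integral (W h1) \<le> ennreal (B * (2 * \<rho>) powr \<theta>)" "square_integral (W h2) \<le> ennreal (B * (2 * \<rho>) powr \<theta>)"
        by (meson ennreal_leI order_trans)+
    qed auto
    also have "\<dots> = ennreal (4 * (B * (2 * \<rho>) powr \<theta>))"
    proof -
      have "2 * ennreal b + 2 * ennreal b = ennreal (4 * b)" if "0 \<le> b" for b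
        using that by (simp only: distrib_right[symmetric]) (simp add: ennreal_mult)
      then show ?thesis using B by simp
    qed
    also have "4 * (B * (2 * \<rho>) powr \<theta>) = 4 * B * (4 / \<kappa>) powr \<theta> * norm h powr \<theta>"
      using k by (simp add: \<rho>_def powr_mult[symmetric])
    finally show ?thesis .
  qed
  then show ?thesis unfolding \<theta>_def using d(1) B(1) by (intro exI[of _ d] conjI exI[of _ "4 * B * (4 / \<kappa>) powr (2 * s + \<sigma>)"]) auto
qed

text \<open>Finitely many of the balls above cover the closure of \<open>\<Omega>\<close>. Where \<open>u (x + h) - u x\<close> does not vanish,
  \<open>x\<close> or \<open>x + h\<close> lies in \<open>\<Omega>\<close>, and the second case is the first one for the shift \<open>- h\<close>.\<close>

lemma translation_order_step:
  fixes u :: "'a::euclidean_space \<Rightarrow> real"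
  assumes meas [measurable]: "u \<in> borel_measurable borel"
    and u: "square_integral u < \<infinity>" "gagliardo s u < \<infinity>" "\<And>x. x \<notin> \<Omega> \<Longrightarrow> u x = 0"
    and \<Omega>: "bounded \<Omega>" "\<And>p. p \<in> closure \<Omega> \<Longrightarrow> complement_cone_property \<Omega> p"
    and s: "0 < s" "s < 1 / 2"
    and \<sigma>: "0 \<le> \<sigma>" "\<sigma> \<le> 2 * s" "translation_order \<sigma> u"
    and F: "0 \<le> F"
    and energy: "\<And>w \<eta>. w \<in> borel_measurable borel \<Longrightarrow> square_integral w < \<infinity> \<Longrightarrow> gagliardo s w < \<infinity> \<Longrightarrow>
       (\<And>x. x \<notin> \<Omega> \<Longrightarrow> w x = 0) \<Longrightarrow> 0 < \<eta> \<Longrightarrow>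
       gagliardo s w + gagliardo s u \<le> gagliardo s (\<lambda>x. u x + w x) + ennreal (F * \<eta>) + ennreal (1 / \<eta>) * square_integral w"
  shows "translation_order (s + \<sigma> / 2) u"
proof -
  define \<theta> where "\<theta> = 2 * s + \<sigma>"
  define good where "good = (\<lambda>p d B. \<forall>h. norm h \<le> d \<longrightarrow>
     (\<integral>\<^sup>+x. ennreal ((shift_diff h u x)\<^sup>2) * indicator (ball p d) x \<partial>lborel) \<le> ennreal (B * norm h powr \<theta>))"
  have "\<forall>p\<in>closure \<Omega>. \<exists>d>0. \<exists>B\<ge>0. good p d B"
    unfolding good_def
    unfolding \<theta>_def by (intro ballI shift_modulus_near_point[OF meas u s \<sigma> F energy]) (use \<Omega>(2) in auto)
  then obtain d where d: "\<And>p. p \<in> closure \<Omega> \<Longrightarrow> d p > 0"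
      and "\<forall>p\<in>closure \<Omega>. \<exists>B\<ge>0. good p (d p) B"
    by (auto dest!: bchoice)
  then obtain B where B: "\<And>p. p \<in> closure \<Omega> \<Longrightarrow> B p \<ge> 0"
      and "\<And>p. p \<in> closure \<Omega> \<Longrightarrow> good p (d p) (B p)"
    by (auto dest!: bchoice)
  then have est: "\<And>p h. p \<in> closure \<Omega> \<Longrightarrow> norm h \<le> d p \<Longrightarrow>
      (\<integral>\<^sup>+x. ennreal ((shift_diff h u x)\<^sup>2) * indicator (ball p (d p)) x \<partial>lborel) \<le> ennreal (B p * norm h powr \<theta>)"
    unfolding good_def by blast
  have "compact (closure \<Omega>)" using \<Omega>(1) by (simp add: compact_closure)
  then obtain P where P: "P \<subseteq> closure \<Omega>" "finite P" "closure \<Omega> \<subseteq> (\<Union>p\<in>P. ball p (d p))"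
    by (rule compactE_image[where C = "closure \<Omega>" and f = "\<lambda>p. ball p (d p)"]) (use d in auto)
  define r where "r = Min (insert 1 (d ` P))"
  have r: "0 < r" using P d by (auto simp: r_def)
  have rd: "r \<le> d p" if "p \<in> P" for p using that P by (auto simp: r_def)
  define C where "C = (\<Sum>p\<in>P. B p)"
  have on: "(\<integral>\<^sup>+x. ennreal ((shift_diff h u x)\<^sup>2) * indicator (closure \<Omega>) x \<partial>lborel) \<le> ennreal (C * norm h powr \<theta>)" if h: "norm h \<le> r" for h
  proof -
    have [measurable]: "shift_diff h u \<in> borel_measurable borel" by (rule measurable_shift_diff) measurable
    have "(\<integral>\<^sup>+x. ennreal ((shift_diff h u x)\<^sup>2) * indicator (closure \<Omega>) x \<partial>lborel)
      \<le> (\<integral>\<^sup>+x. (\<Sum>p\<in>P. ennreal ((shift_diff h u x)\<^sup>2) * indicator (ball p (d p)) x) \<partial>lborel)"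
    proof (intro nn_integral_mono)
      fix x
      show "ennreal ((shift_diff h u x)\<^sup>2) * indicator (closure \<Omega>) x \<le> (\<Sum>p\<in>P. ennreal ((shift_diff h u x)\<^sup>2) * indicator (ball p (d p)) x)"
      proof (cases "x \<in> closure \<Omega>")
        case True
        then obtain p where p: "p \<in> P" "x \<in> ball p (d p)" using P by blast
        have "ennreal ((shift_diff h u x)\<^sup>2) * indicator (ball p (d p)) x \<le> (\<Sum>p\<in>P. ennreal ((shift_diff h u x)\<^sup>2) * indicator (ball p (d p)) x)"
          using p P by (intro member_le_sum) auto
        then show ?thesis using True p by simp
      qed simp
    qed
    also have "\<dots> = (\<Sum>p\<in>P. \<integral>\<^sup>+x. ennreal ((shift_diff h u x)\<^sup>2) * indicator (ball p (d p)) x \<partial>lborel)"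
    proof (rule nn_integral_sum)
      fix p
      have "(indicator (ball p (d p)) :: 'a \<Rightarrow> ennreal) \<in> borel_measurable lborel"
        by (rule borel_measurable_indicator) simp
      then show "(\<lambda>x. ennreal ((shift_diff h u x)\<^sup>2) * indicator (ball p (d p)) x) \<in> borel_measurable lborel"
      proof (rule borel_measurable_times_ennreal[rotated])
        show "(\<lambda>x. ennreal ((shift_diff h u x)\<^sup>2)) \<in> borel_measurable lborel" by measurable
      qed
    qed
    also have "\<dots> \<le> (\<Sum>p\<in>P. ennreal (B p * norm h powr \<theta>))"
      using P h rd by (intro sum_mono est) (auto intro: order_trans)
    also have "\<dots> = ennreal (C * norm h powr \<theta>)"
      using P B unfolding C_def sum_distrib_right by (intro sum_ennreal) auto
    finally show ?thesis .
  qed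
  have C: "0 \<le> C" using P B by (auto simp: C_def intro!: sum_nonneg)
  have "translation_order (\<theta> / 2) u"
  proof (rule translation_order_if_small_shifts[OF meas u(1) r])
    fix h :: 'a assume h: "norm h \<le> r"
    have [measurable]: "shift_diff h u \<in> borel_measurable borel" "shift_diff (- h) u \<in> borel_measurable borel"
      by (intro measurable_shift_diff; measurable)+
    have [measurable]: "closure \<Omega> \<in> sets borel" by simp
    have "square_integral (shift_diff h u) \<le> (\<integral>\<^sup>+x. ennreal ((shift_diff h u x)\<^sup>2) * indicator (closure \<Omega>) x
        + ennreal ((shift_diff (- h) u (x + h))\<^sup>2) * indicator (closure \<Omega>) (x + h) \<partial>lborel)"
      unfolding square_integral_def
    proof (intro nn_integral_mono)
      fix x
      consider "x \<in> closure \<Omega>" | "x + h \<in> closure \<Omega>" | "x \<notin> \<Omega>" "x + h \<notin> \<Omega>" using closure_subset by blast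
      then show "ennreal ((shift_diff h u x)\<^sup>2) \<le> ennreal ((shift_diff h u x)\<^sup>2) * indicator (closure \<Omega>) x
        + ennreal ((shift_diff (- h) u (x + h))\<^sup>2) * indicator (closure \<Omega>) (x + h)"
        by cases (auto simp: shift_diff_def u(3) power2_commute)
    qed
    also have "\<dots> = (\<integral>\<^sup>+x. ennreal ((shift_diff h u x)\<^sup>2) * indicator (closure \<Omega>) x \<partial>lborel)
        + (\<integral>\<^sup>+x. ennreal ((shift_diff (- h) u (x + h))\<^sup>2) * indicator (closure \<Omega>) (x + h) \<partial>lborel)"
      by (rule nn_integral_add) measurable
    also have "(\<integral>\<^sup>+x. ennreal ((shift_diff (- h) u (x + h))\<^sup>2) * indicator (closure \<Omega>) (x + h) \<partial>lborel)
       = (\<integral>\<^sup>+x. ennreal ((shift_diff (- h) u x)\<^sup>2) * indicator (closure \<Omega>) x \<partial>lborel)"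
      by (rule nn_integral_lborel_shift) measurable
    also have "(\<integral>\<^sup>+x. ennreal ((shift_diff h u x)\<^sup>2) * indicator (closure \<Omega>) x \<partial>lborel) + (\<integral>\<^sup>+x. ennreal ((shift_diff (- h) u x)\<^sup>2) * indicator (closure \<Omega>) x \<partial>lborel)
       \<le> ennreal (C * norm h powr \<theta>) + ennreal (C * norm (- h) powr \<theta>)"
      using h by (intro add_mono on) auto
    also have "\<dots> = ennreal (2 * C * norm h powr \<theta>)"
      using C by (subst ennreal_plus[symmetric]) auto
    finally show "square_integral (shift_diff h u) \<le> ennreal (2 * C * norm h powr (2 * (\<theta> / 2)))" by simp
  qed (use s \<sigma> in \<open>auto simp: \<theta>_def\<close>)
  then show ?thesis by (simp add: \<theta>_def add_divide_distrib)
qed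

text \<open>Starting from order 0, the map \<open>\<sigma> \<mapsto> s + \<sigma> / 2\<close> is iterated; its fixed point is \<open>2 * s\<close>.\<close>

theorem gagliardo_finite_if_energy_inequality:
  fixes u :: "'a::euclidean_space \<Rightarrow> real"
  assumes meas: "u \<in> borel_measurable borel"
    and u: "square_integral u < \<infinity>" "gagliardo s u < \<infinity>" "\<And>x. x \<notin> \<Omega> \<Longrightarrow> u x = 0"
    and \<Omega>: "bounded \<Omega>" "\<And>p. p \<in> closure \<Omega> \<Longrightarrow> complement_cone_property \<Omega> p"
    and s: "0 < s" "s < 1 / 2"
    and F: "0 \<le> F"
    and energy: "\<And>w \<eta>. w \<in> borel_measurable borel \<Longrightarrow> square_integral w < \<infinity> \<Longrightarrow> gagliardo s w < \<infinity> \<Longrightarrow>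
       (\<And>x. x \<notin> \<Omega> \<Longrightarrow> w x = 0) \<Longrightarrow> 0 < \<eta> \<Longrightarrow>
       gagliardo s w + gagliardo s u \<le> gagliardo s (\<lambda>x. u x + w x) + ennreal (F * \<eta>) + ennreal (1 / \<eta>) * square_integral w"
    and t: "0 < t" "t < 2 * s"
  shows "gagliardo t u < \<infinity>"
proof -
  have ord: "translation_order (2 * s * (1 - (1 / 2) ^ k)) u" for k
  proof (induction k)
    case 0 then show ?case using translation_order_zero[OF meas u(1)] by simp
  next
    case (Suc k)
    have "(1 / 2 :: real) ^ k \<le> 1" by (intro power_le_one) auto
    then have "0 \<le> 2 * s * (1 - (1 / 2) ^ k)" "2 * s * (1 - (1 / 2) ^ k) \<le> 2 * s * 1"
      using s mult_left_mono[of "1 - (1 / 2) ^ k" 1 "2 * s"] by simp_all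
    then have "translation_order (s + 2 * s * (1 - (1 / 2) ^ k) / 2) u"
      using Suc by (intro translation_order_step[OF meas u \<Omega> s _ _ _ F energy]) auto
    moreover have "s + 2 * s * (1 - (1 / 2) ^ k) / 2 = 2 * s * (1 - (1 / 2) ^ Suc k)" by (simp add: field_simps)
    ultimately show ?case by simp
  qed
  obtain k where "(1 / 2 :: real) ^ k < 1 - t / (2 * s)"
    using real_arch_pow_inv[of "1 - t / (2 * s)" "1 / 2"] t s by auto
  then have "t < 2 * s * (1 - (1 / 2) ^ k)" using s by (simp add: field_simps)
  then show ?thesis by (rule gagliardo_finite_if_translation_order[OF meas ord t(1)])
qed

section \<open>Lipschitz domains\<close>

lemma complement_cone_property_interior:
  fixes \<Omega> :: "'a::euclidean_space set"
  assumes "open \<Omega>" "p \<in> \<Omega>"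
  shows "complement_cone_property \<Omega> p"
proof -
  obtain r where r: "0 < r" "ball p r \<subseteq> \<Omega>" using assms by (auto simp: open_contains_ball)
  obtain e :: 'a where "e \<in> Basis" using nonempty_Basis by blast
  then have "norm e = 1" by simp
  then show ?thesis unfolding complement_cone_property_def
    using r by (intro exI[of _ r] conjI exI[of _ e] exI[of _ 1]) auto
qed

text \<open>A point \<open>x\<close> below the graph stays below it after a shift by \<open>- \<tau> *\<^sub>R e\<close> plus an error of norm less than
  \<open>\<kappa> * \<tau>\<close>: the graph drops by at most \<open>2 * K * \<kappa> * \<tau>\<close>, since the projection at most doubles norms, and
  the height of the point drops by at least \<open>\<tau> - \<kappa> * \<tau>\<close>.\<close>

lemma complement_cone_property_epigraph:
  fixes \<Omega> :: "'a::euclidean_space set"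
  assumes r: "0 < r" and e: "norm e = 1" and g: "K-lipschitz_on {y. y \<bullet> e = 0} \<gamma>"
    and eq: "\<Omega> \<inter> ball p r = {x \<in> ball p r. (\<gamma> (x - (x \<bullet> e) *\<^sub>R e) :: real) < x \<bullet> e}"
  shows "complement_cone_property \<Omega> p"
proof -
  have K: "0 \<le> K" using g by (rule lipschitz_on_nonneg)
  define \<kappa> where "\<kappa> = 1 / (1 + 2 * K)"
  have k: "0 < \<kappa>" "\<kappa> * (1 + 2 * K) = 1" using K by (auto simp: \<kappa>_def)
  define P where "P = (\<lambda>x. x - (x \<bullet> e) *\<^sub>R e)"
  have ee: "e \<bullet> e = 1" using e by (simp add: norm_eq_1)
  have P: "P x \<in> {y. y \<bullet> e = 0}" for x by (simp add: P_def inner_diff_left ee)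
  have Pn: "norm (P x) \<le> 2 * norm x" for x
  proof -
    have "norm (P x) \<le> norm x + norm ((x \<bullet> e) *\<^sub>R e)" unfolding P_def by (rule norm_triangle_ineq4)
    also have "norm ((x \<bullet> e) *\<^sub>R e) \<le> norm x" using Cauchy_Schwarz_ineq2[of x e] e by simp
    finally show ?thesis by simp
  qed
  have "x + h \<notin> \<Omega>" if x: "x \<in> ball p (r / 2) - \<Omega>" and h: "h \<in> cone (- e) \<kappa>" "norm h < r / 2" for x h
  proof
    assume "x + h \<in> \<Omega>"
    moreover have "x + h \<in> ball p r"
    proof -
      have "dist p (x + h) \<le> dist p x + norm h"
        using norm_triangle_ineq4[of "p - x" h] by (simp add: dist_norm diff_diff_eq)
      then show ?thesis using x h by simp
    qed
    ultimately have "x + h \<in> \<Omega> \<inter> ball p r" by (rule IntI)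
    then have in1: "\<gamma> (P (x + h)) < (x + h) \<bullet> e" unfolding eq P_def by simp
    have "x \<in> ball p r" using x r by auto
    moreover have "x \<notin> \<Omega> \<inter> ball p r" using x by blast
    ultimately have out: "x \<bullet> e \<le> \<gamma> (P x)" unfolding eq P_def by (simp add: not_less)
    obtain \<tau> where t: "0 < \<tau>" "norm (h - \<tau> *\<^sub>R (- e)) < \<kappa> * \<tau>" using h by (auto simp: cone_def)
    define z where "z = h + \<tau> *\<^sub>R e"
    have z: "norm z < \<kappa> * \<tau>" using t by (simp add: z_def)
    have "P (x + h) - P x = P z"
      by (simp add: P_def z_def inner_add_left ee algebra_simps)
    then have "dist (P (x + h)) (P x) \<le> 2 * (\<kappa> * \<tau>)" using Pn[of z] z by (simp add: dist_norm)
    then have "\<bar>\<gamma> (P (x + h)) - \<gamma> (P x)\<bar> \<le> K * (2 * (\<kappa> * \<tau>))"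
      using order_trans[OF lipschitz_onD[OF g P P, of "x + h" x] mult_left_mono[OF _ K]] by (simp add: dist_real_def)
    moreover have "h \<bullet> e = z \<bullet> e - \<tau>" by (simp add: z_def inner_add_left ee)
    moreover have "z \<bullet> e \<le> norm z" using Cauchy_Schwarz_ineq2[of z e] e by simp
    moreover have "\<kappa> * \<tau> + K * (2 * (\<kappa> * \<tau>)) = \<tau>"
    proof -
      have "\<kappa> * \<tau> + K * (2 * (\<kappa> * \<tau>)) = \<kappa> * (1 + 2 * K) * \<tau>" by (simp add: algebra_simps)
      then show ?thesis using k by simp
    qed
    ultimately show False using in1 out z by (simp add: inner_add_left)
  qed
  then show ?thesis unfolding complement_cone_property_def
    using r e k by (intro exI[of _ "r / 2"] conjI exI[of _ "- e"] exI[of _ \<kappa>]) auto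
qed

lemma bounded_lipschitz_domain_cone:
  fixes \<Omega> :: "(real ^ 'n) set"
  assumes "bounded_lipschitz_domain \<Omega>" "p \<in> closure \<Omega>"
  shows "complement_cone_property \<Omega> p"
proof (cases "p \<in> \<Omega>")
  case True
  then show ?thesis using assms by (auto simp: bounded_lipschitz_domain_def intro: complement_cone_property_interior)
next
  case False
  then have "p \<in> frontier \<Omega>"
    using assms by (auto simp: frontier_def bounded_lipschitz_domain_def interior_open)
  then show ?thesis
    using assms(1) complement_cone_property_epigraph
    unfolding bounded_lipschitz_domain_def lipschitz_boundary_def by blast
qed

lemma emeasure_lborel_translate:
  fixes A :: "'a::euclidean_space set"
  assumes [measurable]: "A \<in> sets borel"
  shows "emeasure lborel {x. x + h \<in> A} = emeasure lborel A"
proof -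
  have m: "{x. x + h \<in> A} \<in> sets borel" by measurable
  have "emeasure lborel {x. x + h \<in> A} = (\<integral>\<^sup>+x. indicator {x. x + h \<in> A} x \<partial>lborel)"
    using m by (subst nn_integral_indicator) auto
  also have "\<dots> = (\<integral>\<^sup>+x. indicator A (x + h) \<partial>lborel)" by (simp add: indicator_def)
  also have "\<dots> = (\<integral>\<^sup>+x. indicator A x \<partial>lborel)"
    by (rule nn_integral_lborel_shift) measurable
  finally show ?thesis by simp
qed

text \<open>Near \<open>p\<close> a frontier point that is shifted along the cone axis leaves the closure of \<open>\<Omega>\<close>. Hence
  different translates along the axis of a piece of the frontier are disjoint; infinitely many of them have
  the same measure and lie in one ball.\<close>

lemma frontier_null_if_cone_property:
  fixes \<Omega> :: "'a::euclidean_space set"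
  assumes "open \<Omega>" "bounded \<Omega>" and cp: "\<And>p. p \<in> frontier \<Omega> \<Longrightarrow> complement_cone_property \<Omega> p"
  shows "frontier \<Omega> \<in> null_sets lborel"
proof -
  have loc: "\<exists>r>0. frontier \<Omega> \<inter> ball p r \<in> null_sets lborel" if p: "p \<in> frontier \<Omega>" for p
  proof -
    obtain r e \<kappa> where r: "0 < r" and e: "norm e = 1" and k: "\<kappa> > 0"
      and cone: "\<And>x h. x \<in> ball p r \<Longrightarrow> x \<notin> \<Omega> \<Longrightarrow> h \<in> cone e \<kappa> \<Longrightarrow> norm h < r \<Longrightarrow> x + h \<notin> \<Omega>"
      using cp[OF p] unfolding complement_cone_property_def by blast
    define F where "F = frontier \<Omega> \<inter> ball p r"
    have F: "F \<in> sets borel" by (simp add: F_def)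
    have move: "x + t *\<^sub>R e \<notin> F" if x: "x \<in> F" and t: "0 < t" "t < r" for x t
    proof -
      have xO: "x \<notin> \<Omega>" using x \<open>open \<Omega>\<close> by (auto simp: F_def frontier_def interior_open)
      define d where "d = min (\<kappa> * t) (r - t)"
      have d: "0 < d" using k t by (simp add: d_def)
      have "ball (x + t *\<^sub>R e) d \<inter> \<Omega> = {}"
      proof (intro equals0I, elim IntE)
        fix y assume y: "y \<in> ball (x + t *\<^sub>R e) d" "y \<in> \<Omega>"
        define h where "h = y - x"
        have n: "norm (h - t *\<^sub>R e) < d" using y by (simp add: h_def dist_norm norm_minus_commute algebra_simps)
        then have "h \<in> cone e \<kappa>" using t by (auto simp: cone_def d_def)
        moreover have "norm h < r"
          using norm_triangle_ineq[of "h - t *\<^sub>R e" "t *\<^sub>R e"] n t e by (simp add: d_def)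
        ultimately have "x + h \<notin> \<Omega>" using cone xO x by (auto simp: F_def)
        then show False using y by (simp add: h_def)
      qed
      then have "x + t *\<^sub>R e \<notin> closure \<Omega>"
        using open_Int_closure_eq_empty[of "ball (x + t *\<^sub>R e) d" \<Omega>] centre_in_ball[of "x + t *\<^sub>R e" d] d
        by (metis IntI empty_iff open_ball)
      then show ?thesis by (auto simp: F_def frontier_def)
    qed
    \<comment> \<open>Infinitely many different shifts, all shorter than \<open>r\<close>.\<close>
    define t where "t = (\<lambda>k::nat. r / (real k + 2))"
    have t: "0 < t k" "t k < r" for k using r by (auto simp: t_def field_simps intro: add_pos_nonneg)
    have tinj: "k = l" if "t k = t l" for k l using that r by (simp add: t_def field_simps)
    define A where "A = (\<lambda>k. {x. x + (- t k) *\<^sub>R e \<in> F})"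
    have disj: "disjoint_family A"
      unfolding disjoint_family_on_def
    proof (intro ballI impI equals0I, elim IntE)
      have aux: False if "x \<in> A k" "x \<in> A l" "t k < t l" for k l x
      proof -
        have "x + (- t l) *\<^sub>R e \<in> F" using that by (simp add: A_def)
        then have "(x + (- t l) *\<^sub>R e) + (t l - t k) *\<^sub>R e \<notin> F" using that t[of k] t[of l] by (intro move) auto
        moreover have "(x + (- t l) *\<^sub>R e) + (t l - t k) *\<^sub>R e = x + (- t k) *\<^sub>R e" by (simp add: algebra_simps)
        moreover have "x + (- t k) *\<^sub>R e \<in> F" using that(1) unfolding A_def by (rule CollectD)
        ultimately show False by metis
      qed
      fix k l x assume "k \<noteq> l" "x \<in> A k" "x \<in> A l"
      then show False using aux[of x k l] aux[of x l k] tinj[of k l] by linarith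
    qed
    have Am: "emeasure lborel (A k) = emeasure lborel F" for k
      unfolding A_def using F by (rule emeasure_lborel_translate)
    have As: "A k \<in> sets borel" for k unfolding A_def using F by measurable
    have sub: "(\<Union>k<n. A k) \<subseteq> ball p (2 * r)" for n
    proof
      fix x assume "x \<in> (\<Union>k<n. A k)"
      then obtain k where "x + (- t k) *\<^sub>R e \<in> ball p r" by (auto simp: A_def F_def)
      then show "x \<in> ball p (2 * r)"
        using norm_triangle_ineq[of "p - (x + (- t k) *\<^sub>R e)" "(- t k) *\<^sub>R e"] t[of k] e by (simp add: dist_norm)
    qed
    have Vfin: "emeasure lborel (ball p (2 * r)) < \<infinity>" by (rule emeasure_lborel_ball_finite)
    have Ffin: "emeasure lborel F < \<infinity>"
      by (rule order.strict_trans1[OF emeasure_mono emeasure_lborel_ball_finite[of p r]]) (auto simp: F_def)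
    define c where "c = measure lborel F"
    define V where "V = measure lborel (ball p (2 * r))"
    have "real n * c \<le> V" for n
    proof -
      have "of_nat n * emeasure lborel F = (\<Sum>k<n. emeasure lborel (A k))" by (simp add: Am)
      also have "\<dots> = emeasure lborel (\<Union>k<n. A k)"
        using disj As by (intro sum_emeasure) (auto simp: disjoint_family_on_def)
      also have "\<dots> \<le> emeasure lborel (ball p (2 * r))" using sub by (intro emeasure_mono) auto
      finally have "ennreal (real n * c) \<le> ennreal V"
        using Vfin Ffin by (simp add: c_def V_def emeasure_eq_ennreal_measure ennreal_mult ennreal_of_nat_eq_real_of_nat less_top)
      then show ?thesis by (simp add: V_def)
    qed
    then have "c \<le> 0" using reals_Archimedean3[of c] by (meson not_le)
    then have "emeasure lborel F = 0"
      using Ffin by (simp add: c_def emeasure_eq_ennreal_measure less_top measure_le_0_iff)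
    then show ?thesis using r F by (intro exI[of _ r]) (auto simp: F_def null_sets_def)
  qed
  then obtain r where r: "\<And>p. p \<in> frontier \<Omega> \<Longrightarrow> 0 < r p \<and> frontier \<Omega> \<inter> ball p (r p) \<in> null_sets lborel"
    by metis
  have "compact (frontier \<Omega>)" using \<open>bounded \<Omega>\<close> by (simp add: compact_frontier_bounded)
  then obtain P where P: "P \<subseteq> frontier \<Omega>" "finite P" "frontier \<Omega> \<subseteq> (\<Union>p\<in>P. ball p (r p))"
    by (rule compactE_image[where C = "frontier \<Omega>" and f = "\<lambda>p. ball p (r p)"]) (use r in auto)
  have "(\<Union>p\<in>P. frontier \<Omega> \<inter> ball p (r p)) \<in> null_sets lborel"
    using P r by (intro null_sets_UN') (auto intro: countable_finite)
  moreover have "(\<Union>p\<in>P. frontier \<Omega> \<inter> ball p (r p)) = frontier \<Omega>" using P by blast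
  ultimately show ?thesis by simp
qed

text \<open>The union in the definition may be uncountable; by Lindelof's theorem a countable subfamily has the
  same union.\<close>

lemma ess_support_AE_zero:
  fixes v :: "real ^ 'n \<Rightarrow> real"
  shows "AE x in lebesgue. x \<notin> ess_support v \<longrightarrow> v x = 0"
proof -
  define \<U> where "\<U> = {U. open U \<and> (AE x in lebesgue. x \<in> U \<longrightarrow> v x = 0)}"
  obtain \<V> where V: "\<V> \<subseteq> \<U>" "countable \<V>" "\<Union>\<V> = \<Union>\<U>"
    by (rule Lindelof[of \<U>]) (auto simp: \<U>_def)
  have "AE x in lebesgue. \<forall>U\<in>\<V>. x \<in> U \<longrightarrow> v x = 0"
    using V by (subst AE_ball_countable) (auto simp: \<U>_def)
  then show ?thesis
  proof eventually_elim
    case (elim x)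
    then show ?case using V(3) by (auto simp: ess_support_def \<U>_def)
  qed
qed

section \<open>The energy space\<close>

lemma sigma_finite_lebesgue: "sigma_finite_measure (lebesgue :: 'a::euclidean_space measure)"
proof
  obtain A :: "'a set set" where A: "countable A" "A \<subseteq> sets lborel" "\<Union>A = space lborel" "\<forall>a\<in>A. emeasure lborel a \<noteq> \<infinity>"
    using lborel.sigma_finite_countable by blast
  then show "\<exists>A::'a set set. countable A \<and> A \<subseteq> sets lebesgue \<and> \<Union>A = space lebesgue \<and> (\<forall>a\<in>A. emeasure lebesgue a \<noteq> \<infinity>)"
    by (intro exI[of _ A]) auto
qed

interpretation lebesgue: sigma_finite_measure "lebesgue :: 'a::euclidean_space measure"
  by (rule sigma_finite_lebesgue)

lemma AE_pair_both:
  assumes "sigma_finite_measure M" "AE x in M. P x"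
  shows "AE p in M \<Otimes>\<^sub>M M. P (fst p) \<and> P (snd p)"
proof -
  interpret sigma_finite_measure M by fact
  obtain N where N: "N \<in> null_sets M" "{x \<in> space M. \<not> P x} \<subseteq> N"
    using assms(2) by (auto simp: eventually_ae_filter)
  have "N \<times> space M \<in> null_sets (M \<Otimes>\<^sub>M M)" "space M \<times> N \<in> null_sets (M \<Otimes>\<^sub>M M)"
    using N by (auto simp: null_sets_def emeasure_pair_measure_Times)
  then have "N \<times> space M \<union> space M \<times> N \<in> null_sets (M \<Otimes>\<^sub>M M)" by auto
  then show ?thesis by (rule AE_I') (use N(2) in \<open>auto simp: space_pair_measure\<close>)
qed

lemmas AE_lebesgue_pair = AE_pair_both[OF sigma_finite_lebesgue]

lemma measurable_ident_lebesgue: "(\<lambda>x. x) \<in> measurable lebesgue (borel :: 'a::euclidean_space measure)"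
  by (rule measurable_completion) simp

lemma measurable_lebesgue_pair:
  fixes f :: "'a::euclidean_space \<times> 'b::euclidean_space \<Rightarrow> 'c::topological_space"
  assumes "f \<in> borel_measurable (borel \<Otimes>\<^sub>M borel)"
  shows "f \<in> borel_measurable (lebesgue \<Otimes>\<^sub>M lebesgue)"
proof -
  have "(\<lambda>p. p) \<in> measurable (lebesgue \<Otimes>\<^sub>M lebesgue) ((borel :: 'a measure) \<Otimes>\<^sub>M (borel :: 'b measure))"
  proof (rule measurable_pair)
    show "fst \<circ> (\<lambda>p. p) \<in> measurable (lebesgue \<Otimes>\<^sub>M (lebesgue :: 'b measure)) (borel :: 'a measure)"
      using measurable_compose[OF measurable_fst measurable_ident_lebesgue, of "lebesgue :: 'b measure"] by (simp add: comp_def)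
    show "snd \<circ> (\<lambda>p. p) \<in> measurable ((lebesgue :: 'a measure) \<Otimes>\<^sub>M lebesgue) (borel :: 'b measure)"
      using measurable_compose[OF measurable_snd measurable_ident_lebesgue, of "lebesgue :: 'a measure"] by (simp add: comp_def)
  qed
  from measurable_compose[OF this assms] show ?thesis by simp
qed

lemma nn_integral_lebesgue_pair:
  fixes f :: "'a::euclidean_space \<times> 'b::euclidean_space \<Rightarrow> ennreal"
  assumes f: "f \<in> borel_measurable (borel \<Otimes>\<^sub>M borel)"
  shows "(\<integral>\<^sup>+ p. f p \<partial>(lebesgue \<Otimes>\<^sub>M lebesgue)) = (\<integral>\<^sup>+ x. \<integral>\<^sup>+ y. f (x, y) \<partial>lborel \<partial>lborel)"
  using measurable_lebesgue_pair[OF f]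
  by (subst lebesgue.nn_integral_fst[symmetric]) (auto simp: nn_integral_completion)

definition kernel_product :: "real \<Rightarrow> ('a::euclidean_space \<Rightarrow> real) \<Rightarrow> ('a \<Rightarrow> real) \<Rightarrow> 'a \<times> 'a \<Rightarrow> real" where
  "kernel_product s v w = (\<lambda>(x, y). (v x - v y) * (w x - w y) / norm (x - y) powr (real DIM('a) + 2 * s))"

lemma kernel_product_measurable:
  fixes v w :: "'a::euclidean_space \<Rightarrow> real"
  assumes v: "v \<in> borel_measurable lebesgue" and w: "w \<in> borel_measurable lebesgue"
  shows "kernel_product s v w \<in> borel_measurable (lebesgue \<Otimes>\<^sub>M lebesgue)"
proof -
  note [measurable] = measurable_compose[OF measurable_fst v] measurable_compose[OF measurable_snd v]
    measurable_compose[OF measurable_fst w] measurable_compose[OF measurable_snd w]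
  have [measurable]: "(\<lambda>p. norm (fst p - snd p) powr (real DIM('a) + 2 * s)) \<in> borel_measurable (lebesgue \<Otimes>\<^sub>M lebesgue)"
    by (rule measurable_lebesgue_pair) measurable
  show ?thesis unfolding kernel_product_def split_beta' by measurable
qed

text \<open>The space \<open>tilde_H\<close> in a form without auxiliary extensions: the functions vanish everywhere outside
  \<open>\<Omega>\<close>, and integrability of the kernel product replaces finiteness of the seminorm.\<close>

definition energy_space :: "real \<Rightarrow> 'a::euclidean_space set \<Rightarrow> ('a \<Rightarrow> real) set" where
  "energy_space s \<Omega> = {v \<in> borel_measurable lebesgue. (\<forall>x. x \<notin> \<Omega> \<longrightarrow> v x = 0) \<and>
     integrable lebesgue (\<lambda>x. (v x)\<^sup>2) \<and> integrable (lebesgue \<Otimes>\<^sub>M lebesgue) (kernel_product s v v)}"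

lemma kernel_product_nonneg: "0 \<le> kernel_product s v v p"
  by (simp add: kernel_product_def split_beta')

lemma abs_kernel_product_le:
  "2 * \<bar>kernel_product s v w p\<bar> \<le> kernel_product s v v p + kernel_product s w w p"
proof -
  obtain x y where p: "p = (x, y)" by (cases p)
  have "2 * \<bar>(v x - v y) * (w x - w y)\<bar> \<le> (v x - v y)\<^sup>2 + (w x - w y)\<^sup>2"
    using sum_squares_bound[of "\<bar>v x - v y\<bar>" "\<bar>w x - w y\<bar>"] by (simp add: abs_mult mult.assoc)
  then have "2 * \<bar>(v x - v y) * (w x - w y)\<bar> / norm (x - y) powr (real DIM('a) + 2 * s)
     \<le> ((v x - v y)\<^sup>2 + (w x - w y)\<^sup>2) / norm (x - y) powr (real DIM('a) + 2 * s)"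
    by (rule divide_right_mono) simp
  then show ?thesis by (simp add: p kernel_product_def abs_divide add_divide_distrib power2_eq_square)
qed

lemma integrable_kernel_product:
  assumes "v \<in> energy_space s \<Omega>" "w \<in> energy_space s \<Omega>"
  shows "integrable (lebesgue \<Otimes>\<^sub>M lebesgue) (kernel_product s v w)"
proof (rule Bochner_Integration.integrable_bound)
  show "integrable (lebesgue \<Otimes>\<^sub>M lebesgue) (\<lambda>p. kernel_product s v v p + kernel_product s w w p)"
    using assms by (auto simp: energy_space_def)
  show "kernel_product s v w \<in> borel_measurable (lebesgue \<Otimes>\<^sub>M lebesgue)"
    using assms by (intro kernel_product_measurable) (auto simp: energy_space_def)
  show "AE p in lebesgue \<Otimes>\<^sub>M lebesgue. norm (kernel_product s v w p) \<le> norm (kernel_product s v v p + kernel_product s w w p)"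
    using abs_kernel_product_le[of s v w] kernel_product_nonneg[of s v] kernel_product_nonneg[of s w]
    by (intro AE_I2) (smt (verit) real_norm_def)
qed

lemma kernel_product_add_left: "kernel_product s (\<lambda>x. v x + w x) z p = kernel_product s v z p + kernel_product s w z p"
  by (simp add: kernel_product_def split_beta' algebra_simps add_divide_distrib diff_divide_distrib)

lemma kernel_product_scale_left: "kernel_product s (\<lambda>x. c * v x) z p = c * kernel_product s v z p"
  by (simp add: kernel_product_def split_beta' right_diff_distrib[symmetric] mult.assoc)

lemma kernel_product_commute: "kernel_product s v w p = kernel_product s w v p"
  by (simp add: kernel_product_def split_beta' mult.commute)

lemma energy_space_scale:
  assumes "v \<in> energy_space s \<Omega>"
  shows "(\<lambda>x. c * v x) \<in> energy_space s \<Omega>"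
proof -
  have k: "kernel_product s (\<lambda>x. c * v x) (\<lambda>x. c * v x) = (\<lambda>p. c\<^sup>2 * kernel_product s v v p)"
    by (intro ext) (simp add: kernel_product_scale_left kernel_product_commute[of s v "\<lambda>x. c * v x"] power2_eq_square)
  then show ?thesis using assms by (auto simp: energy_space_def power_mult_distrib k)
qed

lemma energy_space_add:
  assumes "v \<in> energy_space s \<Omega>" "w \<in> energy_space s \<Omega>"
  shows "(\<lambda>x. v x + w x) \<in> energy_space s \<Omega>"
proof -
  have k: "kernel_product s (\<lambda>x. v x + w x) (\<lambda>x. v x + w x) = (\<lambda>p. kernel_product s v v p + kernel_product s v w p + (kernel_product s v w p + kernel_product s w w p))"
    by (intro ext) (simp add: kernel_product_add_left kernel_product_commute[of s v "\<lambda>x. v x + w x"] kernel_product_commute[of s w "\<lambda>x. v x + w x"] kernel_product_commute[of s w v])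
  have "integrable lebesgue (\<lambda>x. (v x + w x)\<^sup>2)"
  proof (rule Bochner_Integration.integrable_bound)
    show "integrable lebesgue (\<lambda>x. 2 * (v x)\<^sup>2 + 2 * (w x)\<^sup>2)" using assms by (auto simp: energy_space_def)
    have "v \<in> borel_measurable lebesgue" "w \<in> borel_measurable lebesgue" using assms by (auto simp: energy_space_def)
    then show "(\<lambda>x. (v x + w x)\<^sup>2) \<in> borel_measurable lebesgue" by measurable
    have "(v x + w x)\<^sup>2 \<le> 2 * (v x)\<^sup>2 + 2 * (w x)\<^sup>2" for x using square_diff_le[of "v x" "- w x" 0] by simp
    then show "AE x in lebesgue. norm ((v x + w x)\<^sup>2) \<le> norm (2 * (v x)\<^sup>2 + 2 * (w x)\<^sup>2)" by auto
  qed
  then show ?thesis using assms integrable_kernel_product[OF assms]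
    by (auto simp: energy_space_def k)
qed

lemma energy_space_diff:
  assumes "v \<in> energy_space s \<Omega>" "w \<in> energy_space s \<Omega>"
  shows "(\<lambda>x. v x - w x) \<in> energy_space s \<Omega>"
  using energy_space_add[OF assms(1) energy_space_scale[OF assms(2), of "-1"]] by simp

lemma energy_space_cong_AE:
  assumes v: "v \<in> energy_space s \<Omega>" and w: "w \<in> borel_measurable lebesgue" "\<And>x. x \<notin> \<Omega> \<Longrightarrow> w x = 0"
    and ae: "AE x in lebesgue. v x = w x"
  shows "w \<in> energy_space s \<Omega>"
proof -
  have m: "v \<in> borel_measurable lebesgue" using v by (simp add: energy_space_def)
  have "integrable lebesgue (\<lambda>x. (w x)\<^sup>2)"
    using v w m ae by (subst integrable_cong_AE[of _ _ "\<lambda>x. (v x)\<^sup>2"]) (auto simp: energy_space_def)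
  moreover have "integrable (lebesgue \<Otimes>\<^sub>M lebesgue) (kernel_product s w w)"
  proof (subst integrable_cong_AE[of _ _ "kernel_product s v v"])
    show "AE p in lebesgue \<Otimes>\<^sub>M lebesgue. kernel_product s w w p = kernel_product s v v p"
      using AE_lebesgue_pair[OF ae] by eventually_elim (simp add: kernel_product_def split_beta')
  qed (use v w m in \<open>auto simp: energy_space_def intro: kernel_product_measurable\<close>)
  ultimately show ?thesis using w by (simp add: energy_space_def)
qed

lemma integrable_iff_nn_integral_finite:
  assumes "f \<in> borel_measurable M" "\<And>x. 0 \<le> f x"
  shows "integrable M f \<longleftrightarrow> (\<integral>\<^sup>+x. ennreal (f x) \<partial>M) < \<infinity>"
  using assms by (simp add: integrable_iff_bounded)

lemma sobolev_space_UNIV_iff: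
  fixes v :: "real ^ 'n \<Rightarrow> real"
  shows "v \<in> sobolev_space s UNIV \<longleftrightarrow> v \<in> energy_space s UNIV"
proof -
  have "(\<lambda>x. \<bar>v x\<bar> powr 2) = (\<lambda>x. (v x)\<^sup>2)" by simp
  moreover have k: "(\<lambda>(x, y). ennreal ((v x - v y)\<^sup>2 / norm (x - y) powr (real CARD('n) + 2 * s))) = (\<lambda>p. ennreal (kernel_product s v v p))"
    by (intro ext) (simp add: kernel_product_def split_beta' power2_eq_square)
  ultimately show ?thesis
    unfolding sobolev_space_def energy_space_def Lp_space_def lebesgue_on_UNIV_eq
    using integrable_iff_nn_integral_finite[OF kernel_product_measurable[of v v s] kernel_product_nonneg]
    by (auto simp: k)
qed

text \<open>A function in \<open>tilde_H\<close> is the restriction to \<open>\<Omega>\<close> of a function that vanishes almost everywhere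
  outside the closure. The restriction changes it only on the frontier, which is a null set.\<close>

lemma tilde_H_eq_energy_space:
  fixes \<Omega> :: "(real ^ 'n) set"
  assumes "bounded_lipschitz_domain \<Omega>"
  shows "tilde_H s \<Omega> = energy_space s \<Omega>"
proof (intro equalityI subsetI)
  have op: "open \<Omega>" "bounded \<Omega>" using assms by (auto simp: bounded_lipschitz_domain_def)
  have "frontier \<Omega> \<in> null_sets lborel"
    using op bounded_lipschitz_domain_cone[OF assms] by (intro frontier_null_if_cone_property) (auto simp: frontier_def)
  then have "frontier \<Omega> \<in> null_sets lebesgue" by (rule null_sets_completionI)
  then have fr: "AE x in lebesgue. x \<notin> frontier \<Omega>" by (rule AE_not_in)
  fix u assume "u \<in> tilde_H s \<Omega>"
  then obtain v where u: "u = (\<lambda>x. if x \<in> \<Omega> then v x else 0)" and v: "v \<in> energy_space s UNIV" and sup: "ess_support v \<subseteq> closure \<Omega>"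
    by (auto simp: tilde_H_def sobolev_space_UNIV_iff)
  have vm: "v \<in> borel_measurable lebesgue" using v by (simp add: energy_space_def)
  have O: "\<Omega> \<in> sets lebesgue" using op by auto
  have um: "u \<in> borel_measurable lebesgue" unfolding u using vm O by (intro measurable_If_set) auto
  have "AE x in lebesgue. v x = u x"
    using fr ess_support_AE_zero[of v]
  proof eventually_elim
    case (elim x)
    then show ?case using sup op by (auto simp: u frontier_def interior_open)
  qed
  then have "u \<in> energy_space s UNIV" using um v by (intro energy_space_cong_AE[OF v]) auto
  then show "u \<in> energy_space s \<Omega>" by (auto simp: energy_space_def u)
next
  fix u assume u: "u \<in> energy_space s \<Omega>"
  then have 1: "u \<in> sobolev_space s UNIV" unfolding sobolev_space_UNIV_iff by (auto simp: energy_space_def)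
  have "ess_support u \<subseteq> closure \<Omega>"
  proof -
    have "- closure \<Omega> \<in> {U. open U \<and> (AE x in lebesgue. x \<in> U \<longrightarrow> u x = 0)}"
      using u closure_subset[of \<Omega>] by (auto simp: energy_space_def intro!: AE_I2)
    then show ?thesis unfolding ess_support_def by blast
  qed
  moreover have "u = (\<lambda>x. if x \<in> \<Omega> then u x else 0)" using u by (auto simp: energy_space_def)
  ultimately show "u \<in> tilde_H s \<Omega>" using 1 unfolding tilde_H_def by blast
qed

lemma frac_form_eq: "frac_form s v w = frac_const CARD('n) s / 2 * (\<integral>p. kernel_product s v w p \<partial>(lebesgue \<Otimes>\<^sub>M lebesgue))"
  for v w :: "real ^ 'n \<Rightarrow> real"
  by (simp add: frac_form_def kernel_product_def)

lemma frac_const_pos: "0 < s \<Longrightarrow> s < 1 \<Longrightarrow> 0 < frac_const n s"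
  unfolding frac_const_def by (intro divide_pos_pos mult_pos_pos) (auto intro!: Gamma_real_pos)

lemma nn_integral_kernel_product:
  fixes w :: "'a::euclidean_space \<Rightarrow> real"
  assumes [measurable]: "w \<in> borel_measurable borel"
  shows "(\<integral>\<^sup>+ p. ennreal (kernel_product s w w p) \<partial>(lebesgue \<Otimes>\<^sub>M lebesgue)) = gagliardo s w"
proof -
  have "(\<lambda>p. ennreal (kernel_product s w w p)) \<in> borel_measurable (borel \<Otimes>\<^sub>M borel)"
    unfolding kernel_product_def split_beta' by measurable
  from nn_integral_lebesgue_pair[OF this] show ?thesis
    by (simp add: gagliardo_def kernel_product_def power2_eq_square)
qed

lemma borel_energy_space:
  fixes w :: "'a::euclidean_space \<Rightarrow> real"
  assumes m: "w \<in> borel_measurable borel" and w: "\<And>x. x \<notin> \<Omega> \<Longrightarrow> w x = 0" "square_integral w < \<infinity>" "gagliardo s w < \<infinity>"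
  shows "w \<in> energy_space s \<Omega>"
proof -
  have wm: "w \<in> borel_measurable lebesgue" using m by (simp add: measurable_completion)
  have "integrable lebesgue (\<lambda>x. (w x)\<^sup>2)"
    using w(2) wm by (subst integrable_iff_nn_integral_finite) (auto simp: nn_integral_completion square_integral_def)
  moreover have "integrable (lebesgue \<Otimes>\<^sub>M lebesgue) (kernel_product s w w)"
    using w(3) wm by (subst integrable_iff_nn_integral_finite)
      (auto simp: nn_integral_kernel_product[OF m] kernel_product_nonneg intro: kernel_product_measurable)
  ultimately show ?thesis using w wm by (simp add: energy_space_def)
qed

lemma borel_representative:
  fixes u :: "'a::euclidean_space \<Rightarrow> real"
  assumes u: "u \<in> energy_space s \<Omega>" and O: "\<Omega> \<in> sets borel"
  obtains w where "w \<in> borel_measurable borel" "\<And>x. x \<notin> \<Omega> \<Longrightarrow> w x = 0" "AE x in lebesgue. u x = w x"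
proof -
  obtain w where w: "w \<in> borel_measurable lborel" "AE x in lborel. u x = w x"
    using completion_ex_borel_measurable_real[of u lborel] u by (auto simp: energy_space_def)
  show ?thesis
  proof
    show "(\<lambda>x. if x \<in> \<Omega> then w x else 0) \<in> borel_measurable borel"
      using w O by (intro measurable_If_set) auto
    show "AE x in lebesgue. u x = (if x \<in> \<Omega> then w x else 0)"
      using AE_completion[OF w(2)] by eventually_elim (use u in \<open>auto simp: energy_space_def\<close>)
  qed auto
qed

definition energy_inner :: "real \<Rightarrow> ('a::euclidean_space \<Rightarrow> real) \<Rightarrow> ('a \<Rightarrow> real) \<Rightarrow> real" where
  "energy_inner s v w = (\<integral>p. kernel_product s v w p \<partial>(lebesgue \<Otimes>\<^sub>M lebesgue))"

lemma energy_inner_add_left: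
  assumes "v \<in> energy_space s \<Omega>" "w \<in> energy_space s \<Omega>" "z \<in> energy_space s \<Omega>"
  shows "energy_inner s (\<lambda>x. v x + w x) z = energy_inner s v z + energy_inner s w z"
  unfolding energy_inner_def kernel_product_add_left
  by (intro Bochner_Integration.integral_add integrable_kernel_product[of _ s \<Omega>] assms)

lemma energy_inner_scale_left: "energy_inner s (\<lambda>x. c * v x) z = c * energy_inner s v z"
  by (simp add: energy_inner_def kernel_product_scale_left)

lemma energy_inner_commute: "energy_inner s v w = energy_inner s w v"
proof -
  have "kernel_product s v w = kernel_product s w v" by (rule ext) (rule kernel_product_commute)
  then show ?thesis by (simp only: energy_inner_def)
qed

lemma energy_inner_nonneg: "0 \<le> energy_inner s v v"
  unfolding energy_inner_def by (intro integral_nonneg_AE) (simp add: kernel_product_nonneg)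

lemma energy_inner_add_self:
  assumes "v \<in> energy_space s \<Omega>" "w \<in> energy_space s \<Omega>"
  shows "energy_inner s (\<lambda>x. v x + w x) (\<lambda>x. v x + w x) = energy_inner s v v + 2 * energy_inner s v w + energy_inner s w w"
proof -
  have "energy_inner s v (\<lambda>x. v x + w x) = energy_inner s v v + energy_inner s w v"
    by (subst energy_inner_commute) (rule energy_inner_add_left[OF assms assms(1)])
  moreover have "energy_inner s w (\<lambda>x. v x + w x) = energy_inner s v w + energy_inner s w w"
    by (subst energy_inner_commute) (rule energy_inner_add_left[OF assms assms(2)])
  moreover have "energy_inner s w v = energy_inner s v w" by (rule energy_inner_commute)
  ultimately show ?thesis
    using energy_inner_add_left[OF assms energy_space_add[OF assms]] by linarith
qed

lemma energy_inner_cong_AE: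
  assumes "v \<in> borel_measurable lebesgue" "v' \<in> borel_measurable lebesgue" "w \<in> borel_measurable lebesgue"
    and ae: "AE x in lebesgue. v x = v' x"
  shows "energy_inner s v w = energy_inner s v' w"
  unfolding energy_inner_def
proof (rule integral_cong_AE)
  show "AE p in lebesgue \<Otimes>\<^sub>M lebesgue. kernel_product s v w p = kernel_product s v' w p"
    using AE_lebesgue_pair[OF ae] by eventually_elim (simp add: kernel_product_def split_beta')
qed (use assms in \<open>auto intro: kernel_product_measurable\<close>)

lemma ennreal_energy_inner:
  assumes "v \<in> energy_space s \<Omega>"
  shows "ennreal (energy_inner s v v) = (\<integral>\<^sup>+ p. ennreal (kernel_product s v v p) \<partial>(lebesgue \<Otimes>\<^sub>M lebesgue))"
  unfolding energy_inner_def using assms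
  by (intro nn_integral_eq_integral[symmetric]) (auto simp: energy_space_def kernel_product_nonneg)

lemma integral_lebesgue_on_eq:
  fixes g :: "'a::euclidean_space \<Rightarrow> real"
  assumes "\<Omega> \<in> sets lebesgue" "\<And>x. x \<notin> \<Omega> \<Longrightarrow> g x = 0"
  shows "integrable (lebesgue_on \<Omega>) g \<longleftrightarrow> integrable lebesgue g" "(\<integral>x. g x \<partial>(lebesgue_on \<Omega>)) = (\<integral>x. g x \<partial>lebesgue)"
proof -
  have "(\<lambda>x. indicator \<Omega> x *\<^sub>R g x) = g"
  proof
    show "indicator \<Omega> x *\<^sub>R g x = g x" for x using assms(2) by (cases "x \<in> \<Omega>") auto
  qed
  then show "integrable (lebesgue_on \<Omega>) g \<longleftrightarrow> integrable lebesgue g" "(\<integral>x. g x \<partial>(lebesgue_on \<Omega>)) = (\<integral>x. g x \<partial>lebesgue)"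
    using assms(1) integrable_restrict_space[of \<Omega> lebesgue g] integral_restrict_space[of \<Omega> lebesgue g] by auto
qed

lemma integrable_mult_of_squares:
  fixes f g :: "'a \<Rightarrow> real"
  assumes "f \<in> borel_measurable M" "g \<in> borel_measurable M" "integrable M (\<lambda>x. (f x)\<^sup>2)" "integrable M (\<lambda>x. (g x)\<^sup>2)"
  shows "integrable M (\<lambda>x. f x * g x)"
proof (rule Bochner_Integration.integrable_bound)
  show "integrable M (\<lambda>x. (f x)\<^sup>2 + (g x)\<^sup>2)" using assms by auto
  show "(\<lambda>x. f x * g x) \<in> borel_measurable M" using assms by measurable
  have "\<bar>a * b\<bar> \<le> a\<^sup>2 + b\<^sup>2" for a b :: real
  proof -
    have "0 \<le> \<bar>a\<bar> * \<bar>b\<bar>" by simp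
    then show ?thesis
      using sum_squares_bound[of "\<bar>a\<bar>" "\<bar>b\<bar>"] unfolding abs_mult power2_abs mult.assoc by linarith
  qed
  then show "AE x in M. norm (f x * g x) \<le> norm ((f x)\<^sup>2 + (g x)\<^sup>2)" by auto
qed

lemma energy_space_on:
  assumes v: "v \<in> energy_space s \<Omega>" and O: "\<Omega> \<in> sets lebesgue"
  shows "v \<in> borel_measurable (lebesgue_on \<Omega>)" "integrable (lebesgue_on \<Omega>) (\<lambda>x. (v x)\<^sup>2)"
    "(\<integral>x. (v x)\<^sup>2 \<partial>(lebesgue_on \<Omega>)) = (\<integral>x. (v x)\<^sup>2 \<partial>lebesgue)"
  using v integral_lebesgue_on_eq[OF O, of "\<lambda>x. (v x)\<^sup>2"]
  by (auto simp: energy_space_def intro: measurable_restrict_space1)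

section \<open>Regularity of weak solutions\<close>

text \<open>The cross term in the energy of \<open>u + w\<close> is given by the equation tested with \<open>w\<close>, and Young's
  inequality splits the right-hand side.\<close>

lemma energy_inequality_if_weak_solution:
  assumes O: "\<Omega> \<in> sets lebesgue" and c: "0 < c" and u: "u \<in> energy_space s \<Omega>" and w: "w \<in> energy_space s \<Omega>"
    and f: "f \<in> borel_measurable (lebesgue_on \<Omega>)" "integrable (lebesgue_on \<Omega>) (\<lambda>x. (f x)\<^sup>2)"
    and weak: "c / 2 * energy_inner s u w = (\<integral>x. f x * w x \<partial>(lebesgue_on \<Omega>))"
    and \<eta>: "0 < \<eta>"
  shows "energy_inner s w w + energy_inner s u u \<le> energy_inner s (\<lambda>x. u x + w x) (\<lambda>x. u x + w x)
     + 4 / c\<^sup>2 * (\<integral>x. (f x)\<^sup>2 \<partial>(lebesgue_on \<Omega>)) * \<eta> + 1 / \<eta> * (\<integral>x. (w x)\<^sup>2 \<partial>lebesgue)"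
proof -
  note w' = energy_space_on[OF w O]
  have i: "integrable (lebesgue_on \<Omega>) (\<lambda>x. f x * w x)" using f w' by (intro integrable_mult_of_squares)
  have "- (4 / c) * (\<integral>x. f x * w x \<partial>(lebesgue_on \<Omega>)) = (\<integral>x. - (4 / c) * (f x * w x) \<partial>(lebesgue_on \<Omega>))"
    by simp
  also have "\<dots> \<le> (\<integral>x. 4 / c\<^sup>2 * \<eta> * (f x)\<^sup>2 + 1 / \<eta> * (w x)\<^sup>2 \<partial>(lebesgue_on \<Omega>))"
  proof (intro integral_mono)
    fix x
    have "0 \<le> (2 / c * \<eta> * f x + w x)\<^sup>2 / \<eta>" using \<eta> by simp
    also have "\<dots> = 4 / c\<^sup>2 * \<eta> * (f x)\<^sup>2 + 1 / \<eta> * (w x)\<^sup>2 + 4 / c * (f x * w x)"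
      using \<eta> c by (simp add: power2_eq_square field_simps)
    finally show "- (4 / c) * (f x * w x) \<le> 4 / c\<^sup>2 * \<eta> * (f x)\<^sup>2 + 1 / \<eta> * (w x)\<^sup>2" by simp
  qed (use i f w' in auto)
  also have "\<dots> = 4 / c\<^sup>2 * (\<integral>x. (f x)\<^sup>2 \<partial>(lebesgue_on \<Omega>)) * \<eta> + 1 / \<eta> * (\<integral>x. (w x)\<^sup>2 \<partial>lebesgue)"
    using f w' by simp
  finally have "- (4 / c) * (c / 2 * energy_inner s u w) \<le> \<dots>" unfolding weak .
  moreover have "- (4 / c) * (c / 2 * energy_inner s u w) = - 2 * energy_inner s u w" using c by simp
  ultimately show ?thesis using energy_inner_add_self[OF u w] by simp
qed

lemma sobolev_space_restrict:
  fixes v :: "real ^ 'n \<Rightarrow> real"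
  assumes v: "v \<in> energy_space t UNIV" and O: "\<Omega> \<in> sets lebesgue"
  shows "v \<in> sobolev_space t \<Omega>"
proof -
  have vm: "v \<in> borel_measurable lebesgue" using v by (simp add: energy_space_def)
  interpret O: sigma_finite_measure "lebesgue_on \<Omega>"
    using O by (intro sigma_finite_measure_restrict_space sigma_finite_lebesgue)
  have k: "(\<lambda>(x, y). ennreal ((v x - v y)\<^sup>2 / norm (x - y) powr (real CARD('n) + 2 * t))) = (\<lambda>p. ennreal (kernel_product t v v p))"
    by (intro ext) (simp add: kernel_product_def split_beta' power2_eq_square)
  have km: "kernel_product t v v \<in> borel_measurable (lebesgue \<Otimes>\<^sub>M lebesgue)" using vm by (intro kernel_product_measurable)
  have id: "(\<lambda>x. x) \<in> measurable (lebesgue_on \<Omega>) lebesgue" by (rule measurable_restrict_space1) simp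
  have "(\<lambda>p. p) \<in> measurable (lebesgue_on \<Omega> \<Otimes>\<^sub>M lebesgue_on \<Omega>) (lebesgue \<Otimes>\<^sub>M lebesgue)"
    using measurable_compose[OF measurable_fst id, of "lebesgue_on \<Omega>"] measurable_compose[OF measurable_snd id, of "lebesgue_on \<Omega>"]
    by (intro measurable_pair) (simp_all add: comp_def)
  from measurable_compose[OF this km] have km': "kernel_product t v v \<in> borel_measurable (lebesgue_on \<Omega> \<Otimes>\<^sub>M lebesgue_on \<Omega>)" by simp
  have "(\<integral>\<^sup>+ p. ennreal (kernel_product t v v p) \<partial>(lebesgue_on \<Omega> \<Otimes>\<^sub>M lebesgue_on \<Omega>))
      = (\<integral>\<^sup>+ x. \<integral>\<^sup>+ y. ennreal (kernel_product t v v (x, y)) \<partial>lebesgue_on \<Omega> \<partial>lebesgue_on \<Omega>)"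
    using km' by (subst O.nn_integral_fst[symmetric]) auto
  also have "\<dots> \<le> (\<integral>\<^sup>+ x. \<integral>\<^sup>+ y. ennreal (kernel_product t v v (x, y)) \<partial>lebesgue \<partial>lebesgue)"
    using O by (auto simp: nn_integral_restrict_space indicator_def intro!: nn_integral_mono)
  also have "\<dots> = (\<integral>\<^sup>+ p. ennreal (kernel_product t v v p) \<partial>(lebesgue \<Otimes>\<^sub>M lebesgue))"
    using km by (subst lebesgue.nn_integral_fst[symmetric]) auto
  also have "\<dots> < \<infinity>"
    using v integrable_iff_nn_integral_finite[OF km kernel_product_nonneg] by (simp add: energy_space_def)
  finally have 1: "(\<integral>\<^sup>+ p. ennreal (kernel_product t v v p) \<partial>(lebesgue_on \<Omega> \<Otimes>\<^sub>M lebesgue_on \<Omega>)) < \<infinity>" .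
  have "integrable (lebesgue_on \<Omega>) (\<lambda>x. (v x)\<^sup>2)"
    using v O integrable_mult_indicator[OF O, of "\<lambda>x. (v x)\<^sup>2"]
    by (subst integrable_restrict_space) (auto simp: energy_space_def)
  then show ?thesis using 1 vm unfolding sobolev_space_def Lp_space_def k
    by (auto simp: k intro: measurable_restrict_space1)
qed

lemma sobolev_space_Lipschitz_image:
  fixes v w :: "real ^ 'n \<Rightarrow> real"
  assumes v: "v \<in> sobolev_space t \<Omega>" and w: "w \<in> Lp_space 2 \<Omega>" and O: "\<Omega> \<in> sets lebesgue"
    and g: "\<And>a b. \<bar>g a - g b\<bar> \<le> K * \<bar>a - b\<bar>" and ae: "AE x in lebesgue_on \<Omega>. w x = g (v x)"
  shows "w \<in> sobolev_space t \<Omega>"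
proof -
  have sf: "sigma_finite_measure (lebesgue_on \<Omega>)"
    using O by (intro sigma_finite_measure_restrict_space sigma_finite_lebesgue)
  have vm: "v \<in> borel_measurable (lebesgue_on \<Omega>)" using v by (simp add: sobolev_space_def Lp_space_def)
  define N where "N = (\<lambda>p::(real^'n) \<times> (real^'n). norm (fst p - snd p) powr (real CARD('n) + 2 * t))"
  have id: "(\<lambda>x. x) \<in> borel_measurable (lebesgue_on \<Omega>)"
    by (rule measurable_restrict_space1) (rule measurable_ident_lebesgue)
  note [measurable] = measurable_compose[OF measurable_fst vm] measurable_compose[OF measurable_snd vm]
    measurable_compose[OF measurable_fst id] measurable_compose[OF measurable_snd id]
  have [measurable]: "(\<lambda>p. ennreal ((v (fst p) - v (snd p))\<^sup>2 / N p)) \<in> borel_measurable (lebesgue_on \<Omega> \<Otimes>\<^sub>M lebesgue_on \<Omega>)"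
    unfolding N_def by measurable
  have "(\<integral>\<^sup>+ p. ennreal ((w (fst p) - w (snd p))\<^sup>2 / N p) \<partial>(lebesgue_on \<Omega> \<Otimes>\<^sub>M lebesgue_on \<Omega>))
     \<le> (\<integral>\<^sup>+ p. ennreal (K\<^sup>2) * ennreal ((v (fst p) - v (snd p))\<^sup>2 / N p) \<partial>(lebesgue_on \<Omega> \<Otimes>\<^sub>M lebesgue_on \<Omega>))"
  proof (intro nn_integral_mono_AE)
    show "AE p in lebesgue_on \<Omega> \<Otimes>\<^sub>M lebesgue_on \<Omega>. ennreal ((w (fst p) - w (snd p))\<^sup>2 / N p) \<le> ennreal (K\<^sup>2) * ennreal ((v (fst p) - v (snd p))\<^sup>2 / N p)"
      using AE_pair_both[OF sf ae]
    proof eventually_elim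
      case (elim p)
      have "\<bar>w (fst p) - w (snd p)\<bar>\<^sup>2 \<le> (K * \<bar>v (fst p) - v (snd p)\<bar>)\<^sup>2"
        using elim g by (intro power_mono) auto
      then have "(w (fst p) - w (snd p))\<^sup>2 / N p \<le> K\<^sup>2 * (v (fst p) - v (snd p))\<^sup>2 / N p"
        by (intro divide_right_mono) (auto simp: power_mult_distrib N_def)
      then have "ennreal ((w (fst p) - w (snd p))\<^sup>2 / N p) \<le> ennreal (K\<^sup>2 * ((v (fst p) - v (snd p))\<^sup>2 / N p))"
        by (intro ennreal_leI) simp
      then show ?case by (subst ennreal_mult[symmetric]) (auto simp: N_def)
    qed
  qed
  also have "\<dots> = ennreal (K\<^sup>2) * (\<integral>\<^sup>+ p. ennreal ((v (fst p) - v (snd p))\<^sup>2 / N p) \<partial>(lebesgue_on \<Omega> \<Otimes>\<^sub>M lebesgue_on \<Omega>))"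
    by (rule nn_integral_cmult) measurable
  also have "\<dots> < \<infinity>" using v by (simp add: sobolev_space_def N_def split_beta' ennreal_mult_less_top)
  finally show ?thesis using w by (simp add: sobolev_space_def N_def split_beta')
qed

text \<open>The translation argument is applied to a Borel representative of \<open>u\<close>.\<close>

theorem weak_solution_regularity:
  fixes \<Omega> :: "(real ^ 'n) set"
  assumes dom: "bounded_lipschitz_domain \<Omega>" and s: "0 < s" "s < 1 / 2"
    and u: "u \<in> tilde_H s \<Omega>"
    and f: "f \<in> borel_measurable (lebesgue_on \<Omega>)" "integrable (lebesgue_on \<Omega>) (\<lambda>x. (f x)\<^sup>2)"
    and weak: "\<And>v. v \<in> tilde_H s \<Omega> \<Longrightarrow> frac_form s u v = L2_inner \<Omega> f v"
    and t: "0 < t" "t < 2 * s"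
  shows "u \<in> sobolev_space t \<Omega>"
proof -
  have op: "open \<Omega>" "bounded \<Omega>" using dom by (auto simp: bounded_lipschitz_domain_def)
  then have O: "\<Omega> \<in> sets lebesgue" "\<Omega> \<in> sets borel" by auto
  note HE = tilde_H_eq_energy_space[OF dom, of s]
  have uE: "u \<in> energy_space s \<Omega>" using u HE by simp
  then have um: "u \<in> borel_measurable lebesgue" by (simp add: energy_space_def)
  obtain u' where u': "u' \<in> borel_measurable borel" "\<And>x. x \<notin> \<Omega> \<Longrightarrow> u' x = 0" and ae: "AE x in lebesgue. u x = u' x"
    using borel_representative[OF uE O(2)] by blast
  have u'm: "u' \<in> borel_measurable lebesgue" using u'(1) by (simp add: measurable_completion)
  have u'E: "u' \<in> energy_space s \<Omega>" by (rule energy_space_cong_AE[OF uE u'm u'(2) ae])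
  have gag: "gagliardo s w = ennreal (energy_inner s w w)" if "w \<in> energy_space s \<Omega>" "w \<in> borel_measurable borel" for w
    using that by (simp add: ennreal_energy_inner nn_integral_kernel_product)
  have sq: "square_integral w = ennreal (\<integral>x. (w x)\<^sup>2 \<partial>lebesgue)" if "w \<in> energy_space s \<Omega>" "w \<in> borel_measurable borel" for w
    using that by (subst nn_integral_eq_integral[symmetric]) (auto simp: energy_space_def square_integral_def nn_integral_completion)
  define c where "c = frac_const CARD('n) s"
  have c: "0 < c" using s by (simp add: c_def frac_const_pos)
  define F where "F = 4 / c\<^sup>2 * (\<integral>x. (f x)\<^sup>2 \<partial>(lebesgue_on \<Omega>))"
  have F: "0 \<le> F" by (simp add: F_def)
  have "gagliardo t u' < \<infinity>"
  proof (rule gagliardo_finite_if_energy_inequality[OF u'(1) _ _ u'(2) op(2) bounded_lipschitz_domain_cone[OF dom] s F _ t])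
    show "square_integral u' < \<infinity>" "gagliardo s u' < \<infinity>" using gag[OF u'E u'(1)] sq[OF u'E u'(1)] by auto
    fix w and \<eta> :: real
    assume w: "w \<in> borel_measurable borel" "square_integral w < \<infinity>" "gagliardo s w < \<infinity>" "\<And>x. x \<notin> \<Omega> \<Longrightarrow> w x = 0" and \<eta>: "0 < \<eta>"
    have wE: "w \<in> energy_space s \<Omega>" using w by (intro borel_energy_space)
    have wm: "w \<in> borel_measurable lebesgue" using wE by (simp add: energy_space_def)
    have "c / 2 * energy_inner s u w = (\<integral>x. f x * w x \<partial>(lebesgue_on \<Omega>))"
      using weak[of w] wE HE by (simp add: frac_form_eq energy_inner_def c_def L2_inner_def)
    then have "c / 2 * energy_inner s u' w = (\<integral>x. f x * w x \<partial>(lebesgue_on \<Omega>))"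
      using energy_inner_cong_AE[OF um u'm wm ae] by simp
    from energy_inequality_if_weak_solution[OF O(1) c u'E wE f this \<eta>]
    have "ennreal (energy_inner s w w + energy_inner s u' u') \<le> ennreal (energy_inner s (\<lambda>x. u' x + w x) (\<lambda>x. u' x + w x) + F * \<eta> + 1 / \<eta> * (\<integral>x. (w x)\<^sup>2 \<partial>lebesgue))"
      by (intro ennreal_leI) (simp add: F_def)
    also have "\<dots> = ennreal (energy_inner s (\<lambda>x. u' x + w x) (\<lambda>x. u' x + w x)) + ennreal (F * \<eta>)
        + ennreal (1 / \<eta>) * ennreal (\<integral>x. (w x)\<^sup>2 \<partial>lebesgue)"
    proof -
      have split: "ennreal (p + q + r * z) = ennreal p + ennreal q + ennreal r * ennreal z"
        if "0 \<le> p" "0 \<le> q" "0 \<le> r" "0 \<le> z" for p q r z :: real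
        using that by (simp add: ennreal_mult)
      show ?thesis by (rule split) (use F \<eta> in \<open>simp_all add: energy_inner_nonneg\<close>)
    qed
    also have "ennreal (energy_inner s w w + energy_inner s u' u') = gagliardo s w + gagliardo s u'"
      unfolding gag[OF u'E u'(1)] gag[OF wE w(1)] by (intro ennreal_plus energy_inner_nonneg)
    also have "ennreal (energy_inner s (\<lambda>x. u' x + w x) (\<lambda>x. u' x + w x)) = gagliardo s (\<lambda>x. u' x + w x)"
      using u' w by (intro gag[symmetric] energy_space_add[OF u'E wE]) measurable
    also have "ennreal (\<integral>x. (w x)\<^sup>2 \<partial>lebesgue) = square_integral w"
      by (rule sq[OF wE w(1), symmetric])
    finally show "gagliardo s w + gagliardo s u' \<le> gagliardo s (\<lambda>x. u' x + w x) + ennreal (F * \<eta>) + ennreal (1 / \<eta>) * square_integral w" .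
  qed
  then have "u' \<in> energy_space t UNIV"
    using u'(1) sq[OF u'E u'(1)] by (intro borel_energy_space) auto
  moreover have "AE x in lebesgue. u' x = u x" using ae by eventually_elim simp
  ultimately have "u \<in> energy_space t UNIV" using um by (rule_tac energy_space_cong_AE[of u']) simp_all
  then show ?thesis using O(1) by (rule sobolev_space_restrict)
qed

section \<open>Coercivity and comparison\<close>

text \<open>Rounding \<open>u\<close> down to multiples of \<open>1 / 2 ^ n\<close> gives functions with countably many values, for which the
  composition is measurable; continuity passes to the limit.\<close>

lemma caratheodory_measurable:
  fixes g :: "'a \<Rightarrow> real \<Rightarrow> real"
  assumes g [measurable]: "\<And>d. (\<lambda>x. g x d) \<in> borel_measurable M"
    and cont: "\<And>x. x \<in> space M \<Longrightarrow> continuous_on UNIV (g x)"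
    and u [measurable]: "u \<in> borel_measurable M"
  shows "(\<lambda>x. g x (u x)) \<in> borel_measurable M"
proof -
  define U where "U = (\<lambda>n x. real_of_int \<lfloor>2 ^ n * u x\<rfloor> / 2 ^ n)"
  have meas: "(\<lambda>x. g x (U n x)) \<in> borel_measurable M" for n
    unfolding U_def
    by (rule measurable_compose_countable[where f = "\<lambda>i x. g x (real_of_int i / 2 ^ n)"]) measurable
  have lim: "(\<lambda>n. U n x) \<longlonglongrightarrow> u x" for x
  proof (rule LIMSEQ_I)
    fix e :: real assume "0 < e"
    then obtain N where N: "(1 / 2 :: real) ^ N < e" using real_arch_pow_inv[of e "1 / 2"] by auto
    show "\<exists>no. \<forall>n\<ge>no. norm (U n x - u x) < e"
    proof (intro exI[of _ N] allI impI)
      fix n assume n: "N \<le> n"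
      have "U n x \<le> u x" unfolding U_def by (simp add: divide_le_eq mult.commute)
      moreover have "u x - U n x < (1 / 2) ^ n"
      proof -
        have "2 ^ n * u x < real_of_int \<lfloor>2 ^ n * u x\<rfloor> + 1" by linarith
        then have "u x < (real_of_int \<lfloor>2 ^ n * u x\<rfloor> + 1) / 2 ^ n" by (simp add: less_divide_eq mult.commute)
        then show ?thesis by (simp add: U_def add_divide_distrib power_one_over)
      qed
      moreover have "(1 / 2 :: real) ^ n \<le> (1 / 2) ^ N" using n by (intro power_decreasing) auto
      ultimately show "norm (U n x - u x) < e" using N unfolding real_norm_def by linarith
    qed
  qed
  show ?thesis
  proof (rule borel_measurable_LIMSEQ_real[OF _ meas])
    fix x assume "x \<in> space M"
    then show "(\<lambda>n. g x (U n x)) \<longlonglongrightarrow> g x (u x)"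
      using continuous_on_tendsto_compose[OF cont _ _ always_eventually, of x "\<lambda>n. U n x"] lim by auto
  qed
qed

lemma far_ball:
  fixes \<Omega> :: "'a::euclidean_space set"
  assumes "bounded \<Omega>" "0 < s"
  shows "\<exists>c>0. \<exists>y. \<forall>x\<in>\<Omega>. \<forall>z\<in>ball y 1. z \<notin> \<Omega> \<and> c \<le> 1 / norm (x - z) powr (real DIM('a) + 2 * s)"
proof -
  obtain R where R: "0 < R" "\<And>x. x \<in> \<Omega> \<Longrightarrow> norm x \<le> R" using assms(1) by (auto simp: bounded_pos)
  obtain e :: 'a where e: "e \<in> Basis" using nonempty_Basis by blast
  define y where "y = (R + 2) *\<^sub>R e"
  have y: "norm y = R + 2" using e R by (simp add: y_def)
  define c where "c = 1 / (2 * R + 3) powr (real DIM('a) + 2 * s)"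
  show ?thesis
  proof (intro exI[of _ c] exI[of _ y] conjI[of "0 < c"] ballI)
    show "0 < c" using R by (simp add: c_def)
    fix x z assume x: "x \<in> \<Omega>" and z: "z \<in> ball y 1"
    have z1: "R + 1 < norm z" using norm_triangle_ineq2[of y "y - z"] z y by (simp add: dist_norm)
    then have zO: "z \<notin> \<Omega>" using R(2)[of z] by auto
    have "norm z \<le> R + 3" using norm_triangle_ineq4[of y "y - z"] z y by (simp add: dist_norm)
    then have "norm (x - z) \<le> 2 * R + 3" using norm_triangle_ineq4[of x z] R(2)[OF x] by simp
    then have "norm (x - z) powr (real DIM('a) + 2 * s) \<le> (2 * R + 3) powr (real DIM('a) + 2 * s)"
      using assms by (intro powr_mono2) auto
    moreover have "0 < norm (x - z)" using zO x by auto
    ultimately show "z \<notin> \<Omega> \<and> c \<le> 1 / norm (x - z) powr (real DIM('a) + 2 * s)"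
      using zO unfolding c_def by (intro conjI frac_le) auto
  qed
qed

lemma nn_integral_times_indicator_snd:
  fixes g :: "'a::euclidean_space \<Rightarrow> ennreal"
  assumes g: "g \<in> borel_measurable lebesgue" and B: "B \<in> sets lebesgue"
  shows "(\<integral>\<^sup>+ p. g (fst p) * indicator B (snd p) \<partial>(lebesgue \<Otimes>\<^sub>M lebesgue)) = (\<integral>\<^sup>+ x. g x \<partial>lebesgue) * emeasure lebesgue (B :: 'a set)"
proof -
  note [measurable] = measurable_compose[OF measurable_fst g] B
  have "(\<integral>\<^sup>+ p. g (fst p) * indicator B (snd p) \<partial>(lebesgue \<Otimes>\<^sub>M lebesgue)) = (\<integral>\<^sup>+ x. \<integral>\<^sup>+ y. g x * indicator B y \<partial>lebesgue \<partial>lebesgue)"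
    by (subst lebesgue.nn_integral_fst[symmetric]) auto
  also have "\<dots> = (\<integral>\<^sup>+ x. g x * emeasure lebesgue B \<partial>lebesgue)"
    using B by (intro nn_integral_cong nn_integral_cmult_indicator)
  also have "\<dots> = (\<integral>\<^sup>+ x. g x \<partial>lebesgue) * emeasure lebesgue B" using g by (rule nn_integral_multc)
  finally show ?thesis .
qed

text \<open>Outside a bounded set the functions vanish, and the interaction of the kernel with one far
  unit ball already controls the mass inside.\<close>

lemma poincare:
  fixes \<Omega> :: "'a::euclidean_space set"
  assumes "bounded \<Omega>" "0 < s"
  shows "\<exists>k>0. \<forall>v\<in>energy_space s \<Omega>. k * (\<integral>x. (v x)\<^sup>2 \<partial>lebesgue) \<le> energy_inner s v v"
proof -
  obtain c y where c: "0 < c"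
      and far: "\<forall>x\<in>\<Omega>. \<forall>z\<in>ball y 1. z \<notin> \<Omega> \<and> c \<le> 1 / norm (x - z) powr (real DIM('a) + 2 * s)"
    using far_ball[OF assms] by blast
  define V where "V = unit_ball_vol DIM('a)"
  have V: "0 < V" "emeasure lebesgue (ball y 1) = ennreal V" by (simp_all add: V_def emeasure_ball)
  show ?thesis
  proof (intro exI[of _ "c * V"] conjI ballI)
    show "0 < c * V" using c V by simp
    fix v assume v: "v \<in> energy_space s \<Omega>"
    have vm: "v \<in> borel_measurable lebesgue" using v by (simp add: energy_space_def)
    have "ennreal (c * V * (\<integral>x. (v x)\<^sup>2 \<partial>lebesgue)) = ennreal c * (\<integral>\<^sup>+x. ennreal ((v x)\<^sup>2) \<partial>lebesgue) * ennreal V"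
      using v c V by (subst nn_integral_eq_integral) (auto simp: energy_space_def ennreal_mult mult_ac)
    also have "ennreal c * (\<integral>\<^sup>+x. ennreal ((v x)\<^sup>2) \<partial>lebesgue) = (\<integral>\<^sup>+x. ennreal (c * (v x)\<^sup>2) \<partial>lebesgue)"
      using c vm by (subst nn_integral_cmult[symmetric]) (auto simp: ennreal_mult)
    also have "\<dots> * ennreal V = (\<integral>\<^sup>+ p. ennreal (c * (v (fst p))\<^sup>2) * indicator (ball y 1) (snd p) \<partial>(lebesgue \<Otimes>\<^sub>M lebesgue))"
      unfolding V(2)[symmetric] using vm by (intro nn_integral_times_indicator_snd[symmetric]) auto
    also have "\<dots> \<le> (\<integral>\<^sup>+ p. ennreal (kernel_product s v v p) \<partial>(lebesgue \<Otimes>\<^sub>M lebesgue))"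
    proof (intro nn_integral_mono)
      fix p :: "'a \<times> 'a"
      obtain x z where p: "p = (x, z)" by (cases p)
      show "ennreal (c * (v (fst p))\<^sup>2) * indicator (ball y 1) (snd p) \<le> ennreal (kernel_product s v v p)"
      proof (cases "x \<in> \<Omega> \<and> z \<in> ball y 1")
        case True
        then have 1: "v z = 0" "c \<le> 1 / norm (x - z) powr (real DIM('a) + 2 * s)" using far v by (auto simp: energy_space_def)
        have "c * (v x)\<^sup>2 \<le> 1 / norm (x - z) powr (real DIM('a) + 2 * s) * (v x)\<^sup>2" using 1(2) by (rule mult_right_mono) simp
        then show ?thesis using True 1 by (simp add: p kernel_product_def power2_eq_square ennreal_leI)
      next
        case False
        then show ?thesis using v by (auto simp: p energy_space_def indicator_def)
      qed
    qed
    also have "\<dots> = ennreal (energy_inner s v v)" using v by (rule ennreal_energy_inner[symmetric])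
    finally show "c * V * (\<integral>x. (v x)\<^sup>2 \<partial>lebesgue) \<le> energy_inner s v v"
      by (simp add: energy_inner_nonneg)
  qed
qed

lemma energy_space_contraction:
  assumes v: "v \<in> energy_space s \<Omega>" and g: "g 0 = 0" "\<And>a b. \<bar>g a - g b\<bar> \<le> \<bar>a - b\<bar>" "g \<in> borel_measurable borel"
  shows "(\<lambda>x. g (v x)) \<in> energy_space s \<Omega>"
proof -
  have vm: "v \<in> borel_measurable lebesgue" using v by (simp add: energy_space_def)
  then have gm: "(\<lambda>x. g (v x)) \<in> borel_measurable lebesgue" using measurable_compose[OF _ g(3)] by blast
  have "integrable lebesgue (\<lambda>x. (g (v x))\<^sup>2)"
  proof (rule Bochner_Integration.integrable_bound)
    show "integrable lebesgue (\<lambda>x. (v x)\<^sup>2)" using v by (simp add: energy_space_def)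
    show "(\<lambda>x. (g (v x))\<^sup>2) \<in> borel_measurable lebesgue" using gm by measurable
    have "(g a)\<^sup>2 \<le> a\<^sup>2" for a using g(2)[of a 0] g(1) by (simp add: abs_le_square_iff)
    then show "AE x in lebesgue. norm ((g (v x))\<^sup>2) \<le> norm ((v x)\<^sup>2)" by simp
  qed
  moreover have "integrable (lebesgue \<Otimes>\<^sub>M lebesgue) (kernel_product s (\<lambda>x. g (v x)) (\<lambda>x. g (v x)))"
  proof (rule Bochner_Integration.integrable_bound)
    show "integrable (lebesgue \<Otimes>\<^sub>M lebesgue) (kernel_product s v v)" using v by (simp add: energy_space_def)
    show "kernel_product s (\<lambda>x. g (v x)) (\<lambda>x. g (v x)) \<in> borel_measurable (lebesgue \<Otimes>\<^sub>M lebesgue)"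
      by (intro kernel_product_measurable gm)
    have "(g a - g b)\<^sup>2 \<le> (a - b)\<^sup>2" for a b using g(2)[of a b] by (simp add: abs_le_square_iff)
    then show "AE p in lebesgue \<Otimes>\<^sub>M lebesgue. norm (kernel_product s (\<lambda>x. g (v x)) (\<lambda>x. g (v x)) p) \<le> norm (kernel_product s v v p)"
      by (intro AE_I2) (auto simp: kernel_product_def split_beta' power2_eq_square[symmetric] intro!: divide_right_mono)
  qed
  ultimately show ?thesis using v gm g(1) by (auto simp: energy_space_def)
qed

lemma energy_space_integrable:
  fixes v :: "'a::euclidean_space \<Rightarrow> real"
  assumes v: "v \<in> energy_space s \<Omega>" and O: "\<Omega> \<in> sets lebesgue" "bounded \<Omega>"
  shows "integrable lebesgue v"
proof (rule Bochner_Integration.integrable_bound)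
  have "emeasure lebesgue \<Omega> < \<infinity>"
    using O by (metis bounded_set_imp_lmeasurable fmeasurableD2 infinity_ennreal_def less_top)
  then show "integrable lebesgue (\<lambda>x. indicator \<Omega> x + (v x)\<^sup>2)" using v O by (auto simp: energy_space_def)
  show "v \<in> borel_measurable lebesgue" using v by (simp add: energy_space_def)
  have "\<bar>a\<bar> \<le> 1 + a\<^sup>2" for a :: real
    using sum_squares_bound[of "\<bar>a\<bar>" 1] by (simp add: power2_eq_square)
  then have "norm (v x) \<le> norm (indicator \<Omega> x + (v x)\<^sup>2)" for x
    using v by (cases "x \<in> \<Omega>") (auto simp: energy_space_def)
  then show "AE x in lebesgue. norm (v x) \<le> norm (indicator \<Omega> x + (v x)\<^sup>2)" by simp
qed

text \<open>For \<open>y\<close> outside \<open>\<Omega>\<close> the kernel acts like a zero-order term, so a constant is a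
  strict supersolution. Testing with \<open>(\<delta> - k)\<^sup>+\<close> therefore shows that \<open>\<delta>\<close> cannot exceed a
  multiple of the right-hand side.\<close>

lemma supersolution_bound:
  fixes \<Omega> :: "'a::euclidean_space set"
  assumes O: "\<Omega> \<in> sets lebesgue" "bounded \<Omega>" and s: "0 < s" and c: "0 < c"
  shows "\<exists>\<kappa>>0. \<forall>\<delta> \<gamma> h H. \<delta> \<in> energy_space s \<Omega> \<longrightarrow>
      (\<forall>v\<in>energy_space s \<Omega>. integrable lebesgue (\<lambda>x. \<gamma> x * v x) \<and> integrable lebesgue (\<lambda>x. h x * v x)
         \<and> c / 2 * energy_inner s \<delta> v + (\<integral>x. \<gamma> x * v x \<partial>lebesgue) = (\<integral>x. h x * v x \<partial>lebesgue)) \<longrightarrow>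
      (AE x in lebesgue. 0 \<le> \<delta> x \<longrightarrow> 0 \<le> \<gamma> x) \<longrightarrow> (AE x in lebesgue. h x \<le> H) \<longrightarrow> 0 < H \<longrightarrow>
      (AE x in lebesgue. \<delta> x \<le> \<kappa> * H)"
proof -
  obtain c1 y where c1: "0 < c1"
      and far: "\<forall>x\<in>\<Omega>. \<forall>z\<in>ball y 1. z \<notin> \<Omega> \<and> c1 \<le> 1 / norm (x - z) powr (real DIM('a) + 2 * s)"
    using far_ball[OF O(2) s] by blast
  obtain k0 where k0: "0 < k0" "\<And>v. v \<in> energy_space s \<Omega> \<Longrightarrow> k0 * (\<integral>x. (v x)\<^sup>2 \<partial>lebesgue) \<le> energy_inner s v v"
    using poincare[OF O(2) s] by auto
  define V where "V = unit_ball_vol DIM('a)"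
  have V: "0 < V" "emeasure lebesgue (ball y 1) = ennreal V" by (simp_all add: V_def emeasure_ball)
  \<comment> \<open>For \<open>K = \<kappa> * H\<close> the interaction with the far ball exactly balances the right-hand side \<open>H\<close>.\<close>
  define \<kappa> where "\<kappa> = 2 / (c * c1 * V)"
  have k: "0 < \<kappa>" using c c1 V by (simp add: \<kappa>_def)
  show ?thesis
  proof (intro exI[of _ \<kappa>] conjI[OF k] allI impI)
    fix \<delta> \<gamma> h H
    assume d: "\<delta> \<in> energy_space s \<Omega>"
      and eq': "\<forall>v\<in>energy_space s \<Omega>. integrable lebesgue (\<lambda>x. \<gamma> x * v x) \<and> integrable lebesgue (\<lambda>x. h x * v x)
         \<and> c / 2 * energy_inner s \<delta> v + (\<integral>x. \<gamma> x * v x \<partial>lebesgue) = (\<integral>x. h x * v x \<partial>lebesgue)"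
      and g: "AE x in lebesgue. 0 \<le> \<delta> x \<longrightarrow> 0 \<le> \<gamma> x" and h: "AE x in lebesgue. h x \<le> H" and H: "0 < H"
    note eq = bspec[OF eq']
    define K where "K = \<kappa> * H"
    have K: "0 < K" using k H by (simp add: K_def)
    define v where "v = (\<lambda>x. max (\<delta> x - K) 0)"
    have v: "v \<in> energy_space s \<Omega>" unfolding v_def
      by (rule energy_space_contraction[OF d, of "\<lambda>a. max (a - K) 0"]) (use K in auto)
    have vm: "v \<in> borel_measurable lebesgue" using v by (simp add: energy_space_def)
    have v0: "0 \<le> v x" for x by (simp add: v_def)
    have vi: "integrable lebesgue v" using v O by (rule energy_space_integrable)
    have key: "kernel_product s v v p + K * c1 * v (fst p) * indicator (ball y 1) (snd p) \<le> kernel_product s \<delta> v p" for p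
    proof -
      obtain x z where p: "p = (x, z)" by (cases p)
      define N where "N = norm (x - z) powr (real DIM('a) + 2 * s)"
      have N: "0 \<le> N" by (simp add: N_def)
      have base: "(v x - v z) * (v x - v z) \<le> (\<delta> x - \<delta> z) * (v x - v z)"
      proof -
        \<comment> \<open>\<open>\<delta>\<close> is the sum of \<open>v\<close> and \<open>min \<delta> K\<close>, both of which are monotone in \<open>\<delta>\<close>.\<close>
        have "0 \<le> (min (\<delta> x) K - min (\<delta> z) K) * (v x - v z)"
        proof (cases "\<delta> x \<le> \<delta> z")
          case True
          then show ?thesis by (intro mult_nonpos_nonpos) (auto simp: v_def)
        next
          case False
          then show ?thesis by (intro mult_nonneg_nonneg) (auto simp: v_def)
        qed
        moreover have "\<delta> x = v x + min (\<delta> x) K" "\<delta> z = v z + min (\<delta> z) K" by (auto simp: v_def)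
        then have "(\<delta> x - \<delta> z) * (v x - v z) = (v x - v z) * (v x - v z) + (min (\<delta> x) K - min (\<delta> z) K) * (v x - v z)"
          by (metis (no_types, opaque_lifting) add_diff_add distrib_right)
        ultimately show ?thesis by linarith
      qed
      show ?thesis
      proof (cases "x \<in> \<Omega> \<and> z \<in> ball y 1")
        case True
        then have 1: "\<delta> z = 0" "v z = 0" "c1 \<le> 1 / N" using far d v by (auto simp: energy_space_def N_def)
        have "\<delta> x * v x = v x * v x + K * v x" by (auto simp: v_def max_def algebra_simps)
        then have "kernel_product s \<delta> v p = kernel_product s v v p + K * v x * (1 / N)"
          using 1 by (simp add: p kernel_product_def N_def add_divide_distrib)
        moreover have "K * v x * c1 \<le> K * v x * (1 / N)" using 1 K v0[of x] by (intro mult_left_mono) auto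
        ultimately show ?thesis using True by (simp add: p mult_ac)
      next
        case False
        then have "v (fst p) * indicator (ball y 1) (snd p) = 0" using v by (auto simp: p energy_space_def)
        moreover have "kernel_product s v v p \<le> kernel_product s \<delta> v p"
          using divide_right_mono[OF base N] by (simp add: p kernel_product_def N_def)
        ultimately show ?thesis by auto
      qed
    qed
    have "ennreal (energy_inner s v v + K * c1 * (\<integral>x. v x \<partial>lebesgue) * V) =
       (\<integral>\<^sup>+ p. ennreal (kernel_product s v v p) \<partial>(lebesgue \<Otimes>\<^sub>M lebesgue)) + (\<integral>\<^sup>+ x. ennreal (K * c1 * v x) \<partial>lebesgue) * emeasure lebesgue (ball y 1)"
    proof -
      have "(\<integral>\<^sup>+ x. ennreal (K * c1 * v x) \<partial>lebesgue) = ennreal (K * c1 * (\<integral>x. v x \<partial>lebesgue))"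
        using vi v0 K c1 by (subst nn_integral_eq_integral) auto
      moreover have "0 \<le> (\<integral>x. v x \<partial>lebesgue)" using v0 by simp
      ultimately show ?thesis using v V K c1
        by (subst ennreal_plus) (auto simp: ennreal_energy_inner[OF v] energy_inner_nonneg ennreal_mult)
    qed
    also have "(\<integral>\<^sup>+ x. ennreal (K * c1 * v x) \<partial>lebesgue) * emeasure lebesgue (ball y 1)
        = (\<integral>\<^sup>+ p. ennreal (K * c1 * v (fst p)) * indicator (ball y 1) (snd p) \<partial>(lebesgue \<Otimes>\<^sub>M lebesgue))"
      using vm by (intro nn_integral_times_indicator_snd[symmetric]) auto
    also have "(\<integral>\<^sup>+ p. ennreal (kernel_product s v v p) \<partial>(lebesgue \<Otimes>\<^sub>M lebesgue)) + \<dots>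
       = (\<integral>\<^sup>+ p. ennreal (kernel_product s v v p) + ennreal (K * c1 * v (fst p)) * indicator (ball y 1) (snd p) \<partial>(lebesgue \<Otimes>\<^sub>M lebesgue))"
    proof (rule nn_integral_add[symmetric])
      note [measurable] = kernel_product_measurable[OF vm vm] measurable_compose[OF measurable_fst vm]
      show "(\<lambda>p. ennreal (kernel_product s v v p)) \<in> borel_measurable (lebesgue \<Otimes>\<^sub>M lebesgue)" by measurable
      have [measurable]: "ball y 1 \<in> sets lebesgue" by simp
      show "(\<lambda>p. ennreal (K * c1 * v (fst p)) * indicator (ball y 1) (snd p)) \<in> borel_measurable (lebesgue \<Otimes>\<^sub>M lebesgue)" by measurable
    qed
    also have "\<dots> \<le> (\<integral>\<^sup>+ p. ennreal (kernel_product s \<delta> v p) \<partial>(lebesgue \<Otimes>\<^sub>M lebesgue))"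
    proof (intro nn_integral_mono)
      fix p
      have "ennreal (kernel_product s v v p) + ennreal (K * c1 * v (fst p)) * indicator (ball y 1) (snd p)
          = ennreal (kernel_product s v v p + K * c1 * v (fst p) * indicator (ball y 1) (snd p))"
        using K c1 v0 by (auto simp: kernel_product_nonneg indicator_def)
      also have "\<dots> \<le> ennreal (kernel_product s \<delta> v p)" by (intro ennreal_leI key)
      finally show "ennreal (kernel_product s v v p) + ennreal (K * c1 * v (fst p)) * indicator (ball y 1) (snd p) \<le> ennreal (kernel_product s \<delta> v p)" .
    qed
    also have "\<dots> = ennreal (energy_inner s \<delta> v)"
      unfolding energy_inner_def
    proof (rule nn_integral_eq_integral[OF integrable_kernel_product[OF d v]], rule AE_I2)
      fix p show "0 \<le> kernel_product s \<delta> v p"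
        using key[of p] K c1 v0[of "fst p"] kernel_product_nonneg[of s v p] by (smt (verit) indicator_pos_le mult_nonneg_nonneg)
    qed
    finally have low: "energy_inner s v v + K * c1 * (\<integral>x. v x \<partial>lebesgue) * V \<le> energy_inner s \<delta> v"
    proof (subst (asm) ennreal_le_iff2, elim disjE)
      assume "energy_inner s v v + K * c1 * (\<integral>x. v x \<partial>lebesgue) * V \<le> 0 \<and> energy_inner s \<delta> v \<le> 0"
      moreover have "0 \<le> energy_inner s \<delta> v"
        unfolding energy_inner_def
      proof (intro integral_nonneg_AE AE_I2)
        fix p show "0 \<le> kernel_product s \<delta> v p"
          using key[of p] K c1 v0[of "fst p"] kernel_product_nonneg[of s v p] by (smt (verit) indicator_pos_le mult_nonneg_nonneg)
      qed
      ultimately show ?thesis by simp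
    qed simp
    have "0 \<le> (\<integral>x. \<gamma> x * v x \<partial>lebesgue)"
      using g K by (intro integral_nonneg_AE) (auto simp: v_def max_def elim!: eventually_mono)
    then have "c / 2 * energy_inner s \<delta> v \<le> (\<integral>x. h x * v x \<partial>lebesgue)" using eq[OF v] by simp
    also have "\<dots> \<le> (\<integral>x. H * v x \<partial>lebesgue)"
      using h eq[OF v] vi v0 by (intro integral_mono_AE) (auto elim!: eventually_mono intro: mult_right_mono)
    finally have "energy_inner s \<delta> v \<le> 2 * H / c * (\<integral>x. v x \<partial>lebesgue)" using c by (simp add: field_simps)
    moreover have "K * c1 * (\<integral>x. v x \<partial>lebesgue) * V = 2 * H / c * (\<integral>x. v x \<partial>lebesgue)"
      using c c1 V by (simp add: K_def \<kappa>_def)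
    ultimately have "energy_inner s v v \<le> 0" using low by simp
    then have "k0 * (\<integral>x. (v x)\<^sup>2 \<partial>lebesgue) \<le> 0" using k0(2)[OF v] by simp
    then have "(\<integral>x. (v x)\<^sup>2 \<partial>lebesgue) = 0" using k0(1) by (simp add: mult_le_0_iff antisym)
    then have "AE x in lebesgue. (v x)\<^sup>2 = 0"
      using v by (subst (asm) integral_nonneg_eq_0_iff_AE) (auto simp: energy_space_def)
    then show "AE x in lebesgue. \<delta> x \<le> \<kappa> * H"
      by eventually_elim (auto simp: v_def K_def max_def split: if_splits)
  qed
qed

section \<open>Monotone semilinear equations\<close>

text \<open>The primitive of \<open>g\<close> that vanishes at 0. Scaling the integral to the fixed interval from 0 to 1 makes
  joint measurability in a parameter immediate.\<close>

definition primitive :: "(real \<Rightarrow> real) \<Rightarrow> real \<Rightarrow> real" where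
  "primitive g d = (\<integral>\<tau>. d * g (\<tau> * d) * indicator {0..1} \<tau> \<partial>lborel)"

text \<open>The primitive of a nondecreasing function is convex, and \<open>g d\<close> is its slope at \<open>d\<close>.\<close>

lemma primitive_mono:
  assumes mono: "\<And>d e. d \<le> e \<Longrightarrow> g d \<le> g e" and cont: "continuous_on UNIV g"
  shows "g d * (e - d) \<le> primitive g e - primitive g d"
proof -
  have "\<exists>F. \<forall>x. (- \<infinity> :: ereal) < ereal x \<longrightarrow> ereal x < \<infinity> \<longrightarrow> (F has_vector_derivative g x) (at x)"
    by (rule einterval_antiderivative) (use cont in \<open>auto simp: continuous_on_eq_continuous_at\<close>)
  then obtain F where F: "\<And>x. (F has_real_derivative g x) (at x)"
    by (auto simp: has_real_derivative_iff_has_vector_derivative)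
  have P: "primitive g d = F d - F 0" for d
  proof -
    have c1: "isCont (\<lambda>\<tau>. d * g (\<tau> * d)) \<tau>" for \<tau>
      using continuous_on_compose2[OF cont, of UNIV "\<lambda>\<tau>. \<tau> * d"] by (auto intro!: continuous_intros simp: continuous_on_eq_continuous_at)
    have "has_bochner_integral lborel (\<lambda>\<tau>. d * g (\<tau> * d) * indicator {0..1} \<tau>) (F (1 * d) - F (0 * d))"
    proof (rule has_bochner_integral_FTC_Icc_real)
      fix \<tau> :: real
      show "((\<lambda>\<tau>. F (\<tau> * d)) has_real_derivative d * g (\<tau> * d)) (at \<tau>)"
      proof -
        have "((\<lambda>\<tau>. \<tau> * d) has_real_derivative d) (at \<tau>)" by (auto intro!: derivative_eq_intros)
        from DERIV_chain2[OF F this] show ?thesis by (simp add: mult.commute)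
      qed
    qed (use c1 in auto)
    then show ?thesis by (simp add: primitive_def has_bochner_integral_integral_eq)
  qed
  have "g d * (e - d) \<le> F e - F d"
  proof (cases d e rule: linorder_cases)
    case less
    then obtain z where z: "d < z" "F e - F d = (e - d) * g z" using MVT2[of d e F g] F by blast
    have "g d * (e - d) \<le> g z * (e - d)" using mono[of d z] z less by (intro mult_right_mono) auto
    then show ?thesis using z by (simp add: mult.commute)
  next
    case greater
    then obtain z where z: "z < d" "F d - F e = (d - e) * g z" using MVT2[of e d F g] F by blast
    have "g z * (d - e) \<le> g d * (d - e)" using mono[of z d] z greater by (intro mult_right_mono) auto
    then show ?thesis using z by (simp add: algebra_simps)
  qed simp
  then show ?thesis by (simp add: P)
qed

lemma nn_integral_le_of_limit:
  fixes f :: "nat \<Rightarrow> 'a \<Rightarrow> real"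
  assumes [measurable]: "\<And>i. f i \<in> borel_measurable M"
    and lim: "AE x in M. (\<lambda>i. f i x) \<longlonglongrightarrow> F x"
    and le: "\<And>i. N \<le> i \<Longrightarrow> (\<integral>\<^sup>+x. ennreal (f i x) \<partial>M) \<le> C"
  shows "(\<integral>\<^sup>+x. ennreal (F x) \<partial>M) \<le> C"
proof -
  have "(\<integral>\<^sup>+x. ennreal (F x) \<partial>M) \<le> (\<integral>\<^sup>+x. liminf (\<lambda>i. ennreal (f i x)) \<partial>M)"
  proof (rule nn_integral_mono_AE)
    show "AE x in M. ennreal (F x) \<le> liminf (\<lambda>i. ennreal (f i x))"
      using lim
    proof eventually_elim
      case (elim x)
      then have "(\<lambda>i. ennreal (f i x)) \<longlonglongrightarrow> ennreal (F x)" by (intro tendsto_ennrealI)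
      then show ?case by (simp add: lim_imp_Liminf)
    qed
  qed
  also have "\<dots> \<le> liminf (\<lambda>i. \<integral>\<^sup>+x. ennreal (f i x) \<partial>M)" by (rule nn_integral_liminf) measurable
  also have "\<dots> \<le> limsup (\<lambda>i. \<integral>\<^sup>+x. ennreal (f i x) \<partial>M)" by (intro Liminf_le_Limsup) simp
  also have "\<dots> \<le> C"
    using le by (intro Limsup_bounded) (auto simp: eventually_sequentially)
  finally show ?thesis .
qed

text \<open>By the Poincare inequality a Cauchy sequence for the energy is Cauchy in \<open>L\<^sup>1\<close> of the bounded set, so
  a subsequence converges almost everywhere, and Fatou's lemma bounds the energy of the remainders.\<close>

lemma energy_space_complete:
  fixes \<Omega> :: "'a::euclidean_space set" and v :: "nat \<Rightarrow> 'a \<Rightarrow> real"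
  assumes O: "\<Omega> \<in> sets lebesgue" "bounded \<Omega>" and s: "0 < s"
    and v: "\<And>i. v i \<in> energy_space s \<Omega>"
    and cauchy: "\<And>e. 0 < e \<Longrightarrow> \<exists>N. \<forall>i\<ge>N. \<forall>j\<ge>N. energy_inner s (\<lambda>x. v i x - v j x) (\<lambda>x. v i x - v j x) < e"
  shows "\<exists>\<delta>\<in>energy_space s \<Omega>. \<forall>e>0. \<exists>N. \<forall>j\<ge>N. energy_inner s (\<lambda>x. \<delta> x - v j x) (\<lambda>x. \<delta> x - v j x) \<le> e"
proof -
  obtain k0 where k0: "0 < k0" "\<And>v. v \<in> energy_space s \<Omega> \<Longrightarrow> k0 * (\<integral>x. (v x)\<^sup>2 \<partial>lebesgue) \<le> energy_inner s v v"
    using poincare[OF O(2) s] by blast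
  have vm [measurable]: "v i \<in> borel_measurable lebesgue" for i using v by (simp add: energy_space_def)
  have d: "(\<lambda>x. v i x - v j x) \<in> energy_space s \<Omega>" for i j by (intro energy_space_diff v)
  have fin: "emeasure lebesgue \<Omega> < \<infinity>"
    using O by (metis bounded_set_imp_lmeasurable fmeasurableD2 infinity_ennreal_def less_top)
  define \<mu> where "\<mu> = measure lebesgue \<Omega>"
  have \<mu>: "0 \<le> \<mu>" by (simp add: \<mu>_def)
  have L1: "\<exists>N. \<forall>i\<ge>N. \<forall>j\<ge>N. (\<integral>x. norm (v i x - v j x) \<partial>lebesgue) < e" if e: "0 < e" for e
  proof -
    define \<eta> where "\<eta> = e / 2 / (\<mu> + 1)"
    have "0 < \<eta>" using e \<mu> by (simp add: \<eta>_def)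
    moreover have "\<eta> * (\<mu> + 1) = e / 2"
      using \<mu> by (subst nonzero_eq_divide_eq[symmetric]) (auto simp: \<eta>_def)
    ultimately have \<eta>: "0 < \<eta>" "\<eta> * \<mu> < e" using e by (simp_all add: distrib_left)
    \<comment> \<open>From \<open>\<bar>a\<bar> \<le> \<eta> + a\<^sup>2 / \<eta>\<close>: the first part uses up \<open>\<eta> * \<mu>\<close> of the allowance \<open>e\<close>, the energy the rest.\<close>
    define b where "b = (e - \<eta> * \<mu>) * \<eta> * k0"
    have b: "0 < b" using \<eta> k0 by (simp add: b_def)
    obtain N where N: "\<And>i j. N \<le> i \<Longrightarrow> N \<le> j \<Longrightarrow> energy_inner s (\<lambda>x. v i x - v j x) (\<lambda>x. v i x - v j x) < b"
      using cauchy[OF b] by blast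
    have "(\<integral>x. norm (v i x - v j x) \<partial>lebesgue) < e" if "N \<le> i" "N \<le> j" for i j
    proof -
      have "(\<integral>x. norm (v i x - v j x) \<partial>lebesgue) \<le> (\<integral>x. \<eta> * indicator \<Omega> x + 1 / \<eta> * (v i x - v j x)\<^sup>2 \<partial>lebesgue)"
      proof (intro integral_mono)
        show "integrable lebesgue (\<lambda>x. norm (v i x - v j x))"
          using energy_space_integrable[OF d O] by (intro integrable_norm)
        show "integrable lebesgue (\<lambda>x. \<eta> * indicator \<Omega> x + 1 / \<eta> * (v i x - v j x)\<^sup>2)"
          using d[of i j] O fin by (auto simp: energy_space_def)
        fix x
        have "a \<le> \<eta> + 1 / \<eta> * a\<^sup>2" for a
        proof -
          have "0 \<le> (a - \<eta>)\<^sup>2 / \<eta> + a" if "0 \<le> a" using \<eta> that by simp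
          moreover have "(a - \<eta>)\<^sup>2 / \<eta> + a = \<eta> + 1 / \<eta> * a\<^sup>2 - a" using \<eta> by (simp add: power2_eq_square field_simps)
          ultimately show ?thesis using \<eta> by (cases "0 \<le> a") (auto intro: order_trans[of _ 0])
        qed
        from this[of "\<bar>v i x - v j x\<bar>"] show "norm (v i x - v j x) \<le> \<eta> * indicator \<Omega> x + 1 / \<eta> * (v i x - v j x)\<^sup>2"
          using v by (cases "x \<in> \<Omega>") (auto simp: energy_space_def)
      qed
      also have "\<dots> = \<eta> * \<mu> + 1 / \<eta> * (\<integral>x. (v i x - v j x)\<^sup>2 \<partial>lebesgue)"
        using d[of i j] O fin by (subst Bochner_Integration.integral_add) (auto simp: energy_space_def \<mu>_def)
      also have "\<dots> < e"
      proof -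
        have "k0 * (\<integral>x. (v i x - v j x)\<^sup>2 \<partial>lebesgue) < b" using k0(2)[OF d, of i j] N[OF that] by simp
        then have "(\<integral>x. (v i x - v j x)\<^sup>2 \<partial>lebesgue) < (e - \<eta> * \<mu>) * \<eta>"
          using k0 by (simp add: b_def mult.commute[of k0])
        then show ?thesis using \<eta> by (simp add: field_simps)
      qed
      finally show ?thesis .
    qed
    then show ?thesis by blast
  qed
  obtain r where r: "strict_mono r" "AE x in lebesgue. Cauchy (\<lambda>i. v (r i) x)"
    using cauchy_L1_AE_cauchy_subseq[of lebesgue v] energy_space_integrable[OF v O] L1 by blast
  define \<delta> where "\<delta> = (\<lambda>x. lim (\<lambda>i. v (r i) x))"
  have \<delta>m [measurable]: "\<delta> \<in> borel_measurable lebesgue" unfolding \<delta>_def by (rule borel_measurable_lim_metric) measurable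
  have \<delta>lim: "AE x in lebesgue. (\<lambda>i. v (r i) x) \<longlonglongrightarrow> \<delta> x"
    using r(2) by eventually_elim (simp add: \<delta>_def Cauchy_convergent_iff convergent_LIMSEQ_iff)
  have \<delta>0: "\<delta> x = 0" if "x \<notin> \<Omega>" for x
    using v that by (simp add: \<delta>_def energy_space_def)
  have main: "(\<lambda>x. \<delta> x - v j x) \<in> energy_space s \<Omega> \<and> energy_inner s (\<lambda>x. \<delta> x - v j x) (\<lambda>x. \<delta> x - v j x) \<le> e"
    if N: "\<And>i j. N \<le> i \<Longrightarrow> N \<le> j \<Longrightarrow> energy_inner s (\<lambda>x. v i x - v j x) (\<lambda>x. v i x - v j x) < e" and j: "N \<le> j" and e: "0 < e" for N j e
  proof -
    have rN: "N \<le> r i" if "N \<le> i" for i using seq_suble[OF r(1), of i] that by simp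
    have small: "energy_inner s (\<lambda>x. v (r i) x - v j x) (\<lambda>x. v (r i) x - v j x) \<le> e" if "N \<le> i" for i
      using N[OF rN[OF that] j] by simp
    have 1: "(\<integral>\<^sup>+x. ennreal ((\<delta> x - v j x)\<^sup>2) \<partial>lebesgue) \<le> ennreal (e / k0)"
    proof (rule nn_integral_le_of_limit[of "\<lambda>i x. (v (r i) x - v j x)\<^sup>2" _ _ N])
      show "AE x in lebesgue. (\<lambda>i. (v (r i) x - v j x)\<^sup>2) \<longlonglongrightarrow> (\<delta> x - v j x)\<^sup>2"
        using \<delta>lim by eventually_elim (intro tendsto_intros)
      fix i assume i: "N \<le> i"
      have "(\<integral>\<^sup>+x. ennreal ((v (r i) x - v j x)\<^sup>2) \<partial>lebesgue) = ennreal (\<integral>x. (v (r i) x - v j x)\<^sup>2 \<partial>lebesgue)"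
        using d by (intro nn_integral_eq_integral) (auto simp: energy_space_def)
      also have "\<dots> \<le> ennreal (e / k0)"
        using k0(2)[OF d, of "r i" j] k0(1) small[OF i] by (intro ennreal_leI) (simp add: field_simps)
      finally show "(\<integral>\<^sup>+x. ennreal ((v (r i) x - v j x)\<^sup>2) \<partial>lebesgue) \<le> ennreal (e / k0)" .
    qed measurable
    have dm: "(\<lambda>x. \<delta> x - v j x) \<in> borel_measurable lebesgue" by measurable
    have 2: "(\<integral>\<^sup>+p. ennreal (kernel_product s (\<lambda>x. \<delta> x - v j x) (\<lambda>x. \<delta> x - v j x) p) \<partial>(lebesgue \<Otimes>\<^sub>M lebesgue)) \<le> ennreal e"
    proof (rule nn_integral_le_of_limit[of "\<lambda>i. kernel_product s (\<lambda>x. v (r i) x - v j x) (\<lambda>x. v (r i) x - v j x)" _ _ N])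
      show "kernel_product s (\<lambda>x. v (r i) x - v j x) (\<lambda>x. v (r i) x - v j x) \<in> borel_measurable (lebesgue \<Otimes>\<^sub>M lebesgue)" for i
        by (intro kernel_product_measurable) measurable
      show "AE p in lebesgue \<Otimes>\<^sub>M lebesgue. (\<lambda>i. kernel_product s (\<lambda>x. v (r i) x - v j x) (\<lambda>x. v (r i) x - v j x) p)
         \<longlonglongrightarrow> kernel_product s (\<lambda>x. \<delta> x - v j x) (\<lambda>x. \<delta> x - v j x) p"
        using AE_lebesgue_pair[OF \<delta>lim]
      proof eventually_elim
        case (elim p)
        then show ?case unfolding kernel_product_def split_beta' divide_inverse by (intro tendsto_intros) auto
      qed
      fix i assume i: "N \<le> i"
      show "(\<integral>\<^sup>+p. ennreal (kernel_product s (\<lambda>x. v (r i) x - v j x) (\<lambda>x. v (r i) x - v j x) p) \<partial>(lebesgue \<Otimes>\<^sub>M lebesgue)) \<le> ennreal e"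
        unfolding ennreal_energy_inner[OF d, symmetric] by (intro ennreal_leI small i)
    qed
    have in1: "(\<lambda>x. \<delta> x - v j x) \<in> energy_space s \<Omega>"
      unfolding energy_space_def
    proof (intro CollectI conjI dm)
      show "\<forall>x. x \<notin> \<Omega> \<longrightarrow> \<delta> x - v j x = 0" using \<delta>0 v by (simp add: energy_space_def)
      show "integrable lebesgue (\<lambda>x. (\<delta> x - v j x)\<^sup>2)"
        using 1 by (subst integrable_iff_nn_integral_finite) (auto intro: order.strict_trans1)
      show "integrable (lebesgue \<Otimes>\<^sub>M lebesgue) (kernel_product s (\<lambda>x. \<delta> x - v j x) (\<lambda>x. \<delta> x - v j x))"
        using 2 by (subst integrable_iff_nn_integral_finite[OF kernel_product_measurable[OF dm dm] kernel_product_nonneg])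
          (auto intro: order.strict_trans1)
    qed
    then show ?thesis using 2 e unfolding ennreal_energy_inner[OF in1, symmetric] by simp
  qed
  have "\<delta> \<in> energy_space s \<Omega>"
  proof -
    obtain N where "\<And>i j. N \<le> i \<Longrightarrow> N \<le> j \<Longrightarrow> energy_inner s (\<lambda>x. v i x - v j x) (\<lambda>x. v i x - v j x) < 1"
      using cauchy[of 1] by auto
    from main[OF this order_refl] have "(\<lambda>x. (\<delta> x - v N x) + v N x) \<in> energy_space s \<Omega>"
      by (intro energy_space_add v) auto
    then show ?thesis by simp
  qed
  moreover have "\<exists>N. \<forall>j\<ge>N. energy_inner s (\<lambda>x. \<delta> x - v j x) (\<lambda>x. \<delta> x - v j x) \<le> e" if "0 < e" for e
    using cauchy[OF that] main that by blast
  ultimately show ?thesis by blast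
qed

lemma abs_energy_inner_le:
  assumes v: "v \<in> energy_space s \<Omega>" and w: "w \<in> energy_space s \<Omega>" and \<eta>: "0 < \<eta>"
  shows "2 * \<bar>energy_inner s v w\<bar> \<le> energy_inner s v v / \<eta> + \<eta> * energy_inner s w w"
proof -
  have sq: "0 \<le> energy_inner s v v + 2 * (t * energy_inner s v w) + t\<^sup>2 * energy_inner s w w" for t
  proof -
    note tw = energy_space_scale[OF w, of t]
    have "energy_inner s v (\<lambda>x. t * w x) = t * energy_inner s v w"
      by (subst energy_inner_commute, subst energy_inner_scale_left, subst energy_inner_commute) simp
    moreover have "energy_inner s (\<lambda>x. t * w x) (\<lambda>x. t * w x) = t\<^sup>2 * energy_inner s w w"
      by (subst energy_inner_scale_left, subst energy_inner_commute, subst energy_inner_scale_left) (simp add: power2_eq_square)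
    ultimately show ?thesis
      using energy_inner_add_self[OF v tw] energy_inner_nonneg[of s "\<lambda>x. v x + t * w x"] by simp
  qed
  have "2 * \<bar>energy_inner s v w\<bar> * \<eta> \<le> energy_inner s v v + \<eta>\<^sup>2 * energy_inner s w w"
    using sq[of \<eta>] sq[of "- \<eta>"] by (simp add: abs_if algebra_simps)
  then show ?thesis using \<eta> by (simp add: field_simps power2_eq_square)
qed

text \<open>The solution minimises the energy plus the integral of the convex primitive of \<open>g\<close> minus the linear
  term. By the parallelogram identity for the quadratic part every minimising sequence is Cauchy, so no weak
  compactness is needed. The Euler--Lagrange equation is obtained for the limit directly: the members of the
  sequence satisfy it up to an error that tends to 0, and each of its terms is continuous along the sequence.\<close>

lemma monotone_problem_solvable:
  fixes \<Omega> :: "'a::euclidean_space set" and g :: "'a \<Rightarrow> real \<Rightarrow> real"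
  assumes O: "\<Omega> \<in> sets lebesgue" "bounded \<Omega>" and s: "0 < s" and c: "0 < c"
    and gm: "\<And>d. (\<lambda>x. g x d) \<in> borel_measurable lebesgue"
    and g0: "\<And>x. g x 0 = 0"
    and mono: "\<And>x d e. d \<le> e \<Longrightarrow> g x d \<le> g x e"
    and K: "0 \<le> K" "\<And>x d e. \<bar>g x d - g x e\<bar> \<le> K * \<bar>d - e\<bar>"
    and h: "h \<in> borel_measurable lebesgue" "integrable lebesgue (\<lambda>x. (h x)\<^sup>2)"
  shows "\<exists>\<delta>\<in>energy_space s \<Omega>. \<forall>v\<in>energy_space s \<Omega>.
     c / 2 * energy_inner s \<delta> v + (\<integral>x. g x (\<delta> x) * v x \<partial>lebesgue) = (\<integral>x. h x * v x \<partial>lebesgue)"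
proof -
  define E where "E = energy_space s \<Omega>"
  obtain k0 where k0: "0 < k0" "\<And>v. v \<in> E \<Longrightarrow> k0 * (\<integral>x. (v x)\<^sup>2 \<partial>lebesgue) \<le> energy_inner s v v"
    using poincare[OF O(2) s] unfolding E_def by blast
  have Em: "v \<in> borel_measurable lebesgue" and Ei: "integrable lebesgue (\<lambda>x. (v x)\<^sup>2)" if "v \<in> E" for v
    using that by (auto simp: E_def energy_space_def)
  have gcont: "continuous_on UNIV (g x)" for x
  proof (rule continuous_on_iff[THEN iffD2], intro ballI allI impI)
    fix d e :: real assume e: "0 < e"
    show "\<exists>r>0. \<forall>x'\<in>UNIV. dist x' d < r \<longrightarrow> dist (g x x') (g x d) < e"
    proof (intro exI[of _ "e / (K + 1)"] conjI ballI impI)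
      show "0 < e / (K + 1)" using e K by simp
      fix y assume "dist y d < e / (K + 1)"
      then have "(K + 1) * \<bar>y - d\<bar> < e" using K by (simp add: dist_real_def field_simps)
      then show "dist (g x y) (g x d) < e"
        using K(2)[of x y d] unfolding dist_real_def by (simp add: distrib_right)
    qed
  qed
  define G where "G = (\<lambda>x. primitive (g x))"
  have sub: "g x d * (e - d) \<le> G x e - G x d" for x d e
    unfolding G_def using mono gcont by (rule primitive_mono)
  have G0: "G x 0 = 0" for x by (simp add: G_def primitive_def)
  have up: "G x e - G x d \<le> g x d * (e - d) + K * (e - d)\<^sup>2" for x d e
  proof -
    have "G x e - G x d \<le> g x e * (e - d)" using sub[of x e d] by (simp add: algebra_simps)
    also have "\<dots> = g x d * (e - d) + (g x e - g x d) * (e - d)" by (simp add: algebra_simps)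
    also have "(g x e - g x d) * (e - d) \<le> \<bar>g x e - g x d\<bar> * \<bar>e - d\<bar>" by (metis abs_ge_self abs_mult)
    also have "\<dots> \<le> K * \<bar>e - d\<bar> * \<bar>e - d\<bar>" using K(2)[of x e d] by (intro mult_right_mono) auto
    finally show ?thesis by (simp add: power2_eq_square mult.assoc)
  qed
  have Gb: "0 \<le> G x d" "G x d \<le> K * d\<^sup>2" for x d
    using sub[of x 0 d] up[of x d 0] by (auto simp: G0 g0)
  have gb: "\<bar>g x d\<bar> \<le> K * \<bar>d\<bar>" for x d using K(2)[of x d 0] by (simp add: g0)
  have gvm: "(\<lambda>x. g x (v x)) \<in> borel_measurable lebesgue" if "v \<in> E" for v
    by (rule caratheodory_measurable[OF gm gcont Em[OF that]])
  have Gvm: "(\<lambda>x. G x (v x)) \<in> borel_measurable lebesgue" if v: "v \<in> E" for v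
  proof -
    note [measurable] = measurable_compose[OF measurable_fst Em[OF v], of lborel]
    have 1: "(\<lambda>p. g (fst p) (snd p * v (fst p))) \<in> borel_measurable (lebesgue \<Otimes>\<^sub>M lborel)"
      using caratheodory_measurable[of "\<lambda>p. g (fst p)" "lebesgue \<Otimes>\<^sub>M lborel" "\<lambda>p. snd p * v (fst p)"]
        measurable_compose[OF measurable_fst gm] gcont by measurable
    then have "(\<lambda>p. v (fst p) * g (fst p) (snd p * v (fst p)) * indicator {0..1} (snd p)) \<in> borel_measurable (lebesgue \<Otimes>\<^sub>M lborel)"
      by measurable
    then show ?thesis
      unfolding G_def primitive_def by (intro lborel.borel_measurable_lebesgue_integral) (simp add: split_beta')
  qed
  have Gvi: "integrable lebesgue (\<lambda>x. G x (v x))" if v: "v \<in> E" for v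
  proof (rule Bochner_Integration.integrable_bound)
    show "integrable lebesgue (\<lambda>x. K * (v x)\<^sup>2)" using Ei[OF v] by simp
    show "AE x in lebesgue. norm (G x (v x)) \<le> norm (K * (v x)\<^sup>2)" using Gb K by (intro AE_I2) (simp add: abs_of_nonneg)
  qed (rule Gvm[OF v])
  have gsq: "integrable lebesgue (\<lambda>x. (g x (v x))\<^sup>2)" if v: "v \<in> E" for v
  proof (rule Bochner_Integration.integrable_bound)
    show "integrable lebesgue (\<lambda>x. K\<^sup>2 * (v x)\<^sup>2)" using Ei[OF v] by simp
    have "(g x d)\<^sup>2 \<le> K\<^sup>2 * d\<^sup>2" for x d
      using power_mono[OF gb[of x d], of 2] by (simp add: power_mult_distrib)
    then show "AE x in lebesgue. norm ((g x (v x))\<^sup>2) \<le> norm (K\<^sup>2 * (v x)\<^sup>2)" by simp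
    show "(\<lambda>x. (g x (v x))\<^sup>2) \<in> borel_measurable lebesgue" using gvm[OF v] by measurable
  qed
  have gwi: "integrable lebesgue (\<lambda>x. g x (v x) * w x)" if "v \<in> E" "w \<in> E" for v w
    using gvm gsq Em Ei that by (intro integrable_mult_of_squares) auto
  have hwi: "integrable lebesgue (\<lambda>x. h x * w x)" if "w \<in> E" for w
    using h Em Ei that by (intro integrable_mult_of_squares) auto
  have add: "(\<lambda>x. v x + w x) \<in> E" if "v \<in> E" "w \<in> E" for v w using that unfolding E_def by (rule energy_space_add)
  have diff: "(\<lambda>x. v x - w x) \<in> E" if "v \<in> E" "w \<in> E" for v w using that unfolding E_def by (rule energy_space_diff)
  have scale: "(\<lambda>x. t * w x) \<in> E" if "w \<in> E" for w t using that unfolding E_def by (rule energy_space_scale)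
  define \<Phi> where "\<Phi> = (\<lambda>v. c / 4 * energy_inner s v v + (\<integral>x. G x (v x) \<partial>lebesgue) - (\<integral>x. h x * v x \<partial>lebesgue))"
  define R where "R = (\<lambda>v w. c / 2 * energy_inner s v w + (\<integral>x. g x (v x) * w x \<partial>lebesgue) - (\<integral>x. h x * w x \<partial>lebesgue))"
  define Q where "Q = (\<lambda>w::'a \<Rightarrow> real. c / 4 * energy_inner s w w + K * (\<integral>x. (w x)\<^sup>2 \<partial>lebesgue))"
  have upper: "\<Phi> (\<lambda>x. v x + w x) \<le> \<Phi> v + R v w + Q w" if v: "v \<in> E" and w: "w \<in> E" for v w
  proof -
    have "(\<integral>x. G x (v x + w x) \<partial>lebesgue) \<le> (\<integral>x. G x (v x) + g x (v x) * w x + K * (w x)\<^sup>2 \<partial>lebesgue)"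
    proof (intro integral_mono)
      show "integrable lebesgue (\<lambda>x. G x (v x + w x))" by (rule Gvi[OF add[OF v w]])
      show "integrable lebesgue (\<lambda>x. G x (v x) + g x (v x) * w x + K * (w x)\<^sup>2)"
        using Gvi[OF v] gwi[OF v w] Ei[OF w] by auto
      show "G x (v x + w x) \<le> G x (v x) + g x (v x) * w x + K * (w x)\<^sup>2" for x
        using up[of x "v x + w x" "v x"] by simp
    qed
    also have "\<dots> = (\<integral>x. G x (v x) \<partial>lebesgue) + (\<integral>x. g x (v x) * w x \<partial>lebesgue) + K * (\<integral>x. (w x)\<^sup>2 \<partial>lebesgue)"
      using Gvi[OF v] gwi[OF v w] Ei[OF w] by simp
    moreover have "(\<integral>x. h x * (v x + w x) \<partial>lebesgue) = (\<integral>x. h x * v x \<partial>lebesgue) + (\<integral>x. h x * w x \<partial>lebesgue)"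
      using hwi[OF v] hwi[OF w] by (simp add: distrib_left)
    ultimately show ?thesis
      using energy_inner_add_self[of v s \<Omega> w] v w unfolding \<Phi>_def R_def Q_def E_def by (simp add: distrib_left)
  qed
  have lower: "- ((\<integral>x. (h x)\<^sup>2 \<partial>lebesgue) / (c * k0)) \<le> \<Phi> v" if v: "v \<in> E" for v
  proof -
    have "(\<integral>x. h x * v x \<partial>lebesgue) \<le> (\<integral>x. (h x)\<^sup>2 / (c * k0) + c * k0 / 4 * (v x)\<^sup>2 \<partial>lebesgue)"
    proof (intro integral_mono hwi[OF v])
      show "integrable lebesgue (\<lambda>x. (h x)\<^sup>2 / (c * k0) + c * k0 / 4 * (v x)\<^sup>2)" using h Ei[OF v] by simp
      fix x
      have "0 \<le> (h x - c * k0 / 2 * v x)\<^sup>2 / (c * k0)" using c k0 by simp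
      also have "\<dots> = (h x)\<^sup>2 / (c * k0) + c * k0 / 4 * (v x)\<^sup>2 - h x * v x"
        using c k0(1) by (simp add: power2_eq_square field_simps)
      finally show "h x * v x \<le> (h x)\<^sup>2 / (c * k0) + c * k0 / 4 * (v x)\<^sup>2" by simp
    qed
    also have "\<dots> = (\<integral>x. (h x)\<^sup>2 \<partial>lebesgue) / (c * k0) + c / 4 * (k0 * (\<integral>x. (v x)\<^sup>2 \<partial>lebesgue))"
      using h Ei[OF v] by simp
    also have "\<dots> \<le> (\<integral>x. (h x)\<^sup>2 \<partial>lebesgue) / (c * k0) + c / 4 * energy_inner s v v"
      using k0(2)[OF v] c by (intro add_left_mono mult_left_mono) auto
    moreover have "0 \<le> (\<integral>x. G x (v x) \<partial>lebesgue)" using Gb by simp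
    ultimately show ?thesis unfolding \<Phi>_def by linarith
  qed
  define I where "I = Inf (\<Phi> ` E)"
  have E0: "(\<lambda>x. 0) \<in> E" by (auto simp: E_def energy_space_def kernel_product_def split_beta')
  have bdd: "bdd_below (\<Phi> ` E)" using lower by (intro bdd_belowI2)
  have I: "I \<le> \<Phi> v" if "v \<in> E" for v unfolding I_def using bdd that by (intro cInf_lower) auto
  have "\<exists>v\<in>E. \<Phi> v < I + 1 / (real n + 1)" for n :: nat
    using cInf_lessD[of "\<Phi> ` E" "I + 1 / (real n + 1)"] E0 by (auto simp: I_def)
  then obtain v where v: "\<And>n::nat. v n \<in> E" "\<And>n. \<Phi> (v n) < I + 1 / (real n + 1)" by metis
  have mid: "c / 16 * energy_inner s (\<lambda>x. v i x - v j x) (\<lambda>x. v i x - v j x) \<le> \<Phi> (v i) / 2 + \<Phi> (v j) / 2 - I" for i j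
  proof -
    define m where "m = (\<lambda>x. v j x + 1 / 2 * (v i x - v j x))"
    define w where "w = (\<lambda>x. 1 / 2 * (v i x - v j x))"
    have w: "w \<in> E" unfolding w_def by (intro scale diff v)
    have m: "m \<in> E" using add[OF v(1)[of j] w] by (simp add: m_def w_def)
    have mw: "(\<lambda>x. - 1 * w x) \<in> E" by (rule scale[OF w])
    have vi: "v i = (\<lambda>x. m x + w x)" and vj: "v j = (\<lambda>x. m x + - 1 * w x)"
      by (auto simp: m_def w_def field_simps)
    have e1: "energy_inner s (v i) (v i) = energy_inner s m m + 2 * energy_inner s m w + energy_inner s w w"
      unfolding vi using m w unfolding E_def by (rule energy_inner_add_self)
    have "energy_inner s (v j) (v j) = energy_inner s m m + 2 * energy_inner s m (\<lambda>x. - 1 * w x) + energy_inner s (\<lambda>x. - 1 * w x) (\<lambda>x. - 1 * w x)"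
      unfolding vj using m mw unfolding E_def by (rule energy_inner_add_self)
    moreover have "energy_inner s m (\<lambda>x. - 1 * w x) = - energy_inner s m w"
      using energy_inner_scale_left[of s "-1" w m] by (simp add: energy_inner_commute[of s m])
    moreover have "energy_inner s (\<lambda>x. - 1 * w x) (\<lambda>x. - 1 * w x) = energy_inner s w w"
      using energy_inner_scale_left[of s "-1" w "\<lambda>x. - 1 * w x"] energy_inner_scale_left[of s "-1" w w] energy_inner_commute[of s w "\<lambda>x. - 1 * w x"] by simp
    ultimately have e2: "energy_inner s (v j) (v j) = energy_inner s m m - 2 * energy_inner s m w + energy_inner s w w" by simp
    have e3: "energy_inner s (\<lambda>x. v i x - v j x) (\<lambda>x. v i x - v j x) = 4 * energy_inner s w w"
    proof -
      have "(\<lambda>x. v i x - v j x) = (\<lambda>x. 2 * w x)" by (auto simp: w_def field_simps)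
      then show ?thesis
        using energy_inner_scale_left[of s 2 w "\<lambda>x. 2 * w x"] energy_inner_scale_left[of s 2 w w] energy_inner_commute[of s w "\<lambda>x. 2 * w x"] by simp
    qed
    have "(\<integral>x. G x (m x) \<partial>lebesgue) \<le> (\<integral>x. G x (v i x) / 2 + G x (v j x) / 2 \<partial>lebesgue)"
    proof (intro integral_mono Gvi m)
      show "integrable lebesgue (\<lambda>x. G x (v i x) / 2 + G x (v j x) / 2)" using Gvi v by auto
      show "G x (m x) \<le> G x (v i x) / 2 + G x (v j x) / 2" for x
        using sub[of x "m x" "v i x"] sub[of x "m x" "v j x"] by (simp add: vi vj)
    qed
    also have "\<dots> = (\<integral>x. G x (v i x) \<partial>lebesgue) / 2 + (\<integral>x. G x (v j x) \<partial>lebesgue) / 2" using Gvi v by simp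
    finally have e4: "(\<integral>x. G x (m x) \<partial>lebesgue) \<le> (\<integral>x. G x (v i x) \<partial>lebesgue) / 2 + (\<integral>x. G x (v j x) \<partial>lebesgue) / 2" .
    have e5: "(\<integral>x. h x * m x \<partial>lebesgue) = (\<integral>x. h x * v i x \<partial>lebesgue) / 2 + (\<integral>x. h x * v j x \<partial>lebesgue) / 2"
    proof -
      have "(\<lambda>x. h x * m x) = (\<lambda>x. h x * v i x / 2 + h x * v j x / 2)" by (auto simp: m_def field_simps)
      then show ?thesis using hwi v by simp
    qed
    have "\<Phi> (v i) = c / 4 * energy_inner s m m + c / 2 * energy_inner s m w + c / 4 * energy_inner s w w
        + (\<integral>x. G x (v i x) \<partial>lebesgue) - (\<integral>x. h x * v i x \<partial>lebesgue)"
      unfolding \<Phi>_def e1 by (simp add: field_simps)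
    moreover have "\<Phi> (v j) = c / 4 * energy_inner s m m - c / 2 * energy_inner s m w + c / 4 * energy_inner s w w
        + (\<integral>x. G x (v j x) \<partial>lebesgue) - (\<integral>x. h x * v j x \<partial>lebesgue)"
      unfolding \<Phi>_def e2 by (simp add: field_simps)
    moreover have "c / 16 * (4 * energy_inner s w w) = c / 4 * energy_inner s w w" by simp
    moreover have "I \<le> c / 4 * energy_inner s m m + (\<integral>x. G x (m x) \<partial>lebesgue) - (\<integral>x. h x * m x \<partial>lebesgue)"
      using I[OF m] by (simp add: \<Phi>_def)
    ultimately show ?thesis using e4 e5 unfolding e3 by linarith
  qed
  have "\<exists>\<delta>\<in>energy_space s \<Omega>. \<forall>e>0. \<exists>N. \<forall>j\<ge>N. energy_inner s (\<lambda>x. \<delta> x - v j x) (\<lambda>x. \<delta> x - v j x) \<le> e"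
  proof (rule energy_space_complete[OF O s])
    show "v i \<in> energy_space s \<Omega>" for i using v by (simp add: E_def)
    fix e :: real assume e: "0 < e"
    obtain N :: nat where N: "16 / (c * e) < real N" using reals_Archimedean2 by blast
    have "energy_inner s (\<lambda>x. v i x - v j x) (\<lambda>x. v i x - v j x) < e" if "N \<le> i" "N \<le> j" for i j
    proof -
      have "1 / (real i + 1) \<le> 1 / (real N + 1)" "1 / (real j + 1) \<le> 1 / (real N + 1)" using that by (auto intro!: frac_le)
      then have "c / 16 * energy_inner s (\<lambda>x. v i x - v j x) (\<lambda>x. v i x - v j x) \<le> 1 / (real N + 1)"
        using mid[of i j] v(2)[of i] v(2)[of j] by linarith
      also have "\<dots> < c / 16 * e"
      proof -
        have "16 < real N * (c * e)" using N c e by (simp add: pos_divide_less_eq)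
        also have "\<dots> \<le> (real N + 1) * (c * e)" using c e by (intro mult_right_mono) auto
        finally show ?thesis by (simp add: pos_divide_less_eq mult.commute)
      qed
      finally show ?thesis using c by simp
    qed
    then show "\<exists>N. \<forall>i\<ge>N. \<forall>j\<ge>N. energy_inner s (\<lambda>x. v i x - v j x) (\<lambda>x. v i x - v j x) < e" by blast
  qed
  then obtain \<delta> where d: "\<delta> \<in> E" and dN: "\<And>e. 0 < e \<Longrightarrow> \<exists>N. \<forall>j\<ge>N. energy_inner s (\<lambda>x. \<delta> x - v j x) (\<lambda>x. \<delta> x - v j x) \<le> e"
    unfolding E_def by blast
  have nonneg: "0 \<le> R \<delta> w" if w: "w \<in> E" for w
  proof -
    \<comment> \<open>The constant collects the second-order term, the minimisation defect, and the two continuity errors.\<close>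
    define W where "W = Q w + 1 + (c / 4 * (1 + energy_inner s w w) + K * (1 / k0 + (\<integral>x. (w x)\<^sup>2 \<partial>lebesgue)))"
    have Wn: "0 \<le> energy_inner s w w" "0 \<le> (\<integral>x. (w x)\<^sup>2 \<partial>lebesgue)" by (auto simp: energy_inner_nonneg)
    have W: "0 < W" unfolding W_def Q_def using Wn c K k0 by (intro add_pos_nonneg add_nonneg_pos add_nonneg_nonneg mult_nonneg_nonneg) auto
    have est: "- (W * \<eta>) \<le> R \<delta> w" if \<eta>: "0 < \<eta>" for \<eta>
    proof -
      obtain N where N: "\<And>j. N \<le> j \<Longrightarrow> energy_inner s (\<lambda>x. \<delta> x - v j x) (\<lambda>x. \<delta> x - v j x) \<le> \<eta>\<^sup>2"
        using dN[of "\<eta>\<^sup>2"] \<eta> by auto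
      obtain M :: nat where M: "1 / \<eta>\<^sup>2 < real M" using reals_Archimedean2 by blast
      define j where "j = max N M"
      define z where "z = (\<lambda>x. \<delta> x - v j x)"
      have z: "z \<in> E" unfolding z_def by (intro diff d v)
      have zb: "energy_inner s z z \<le> \<eta>\<^sup>2" unfolding z_def by (rule N) (simp add: j_def)
      have "1 / (real j + 1) \<le> \<eta>\<^sup>2"
      proof -
        have "1 < real M * \<eta>\<^sup>2" using M \<eta> by (simp add: pos_divide_less_eq)
        also have "\<dots> \<le> (real j + 1) * \<eta>\<^sup>2" by (intro mult_right_mono) (auto simp: j_def)
        finally show ?thesis by (simp add: pos_divide_le_eq mult.commute)
      qed
      then have "\<Phi> (v j) - \<eta>\<^sup>2 \<le> I" using v(2)[of j] by simp
      also have "I \<le> \<Phi> (\<lambda>x. v j x + \<eta> * w x)" by (intro I add scale v w)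
      also have "\<dots> \<le> \<Phi> (v j) + R (v j) (\<lambda>x. \<eta> * w x) + Q (\<lambda>x. \<eta> * w x)" by (intro upper scale v w)
      finally have "- \<eta>\<^sup>2 \<le> R (v j) (\<lambda>x. \<eta> * w x) + Q (\<lambda>x. \<eta> * w x)" by simp
      moreover have ee: "energy_inner s y (\<lambda>x. \<eta> * w x) = \<eta> * energy_inner s y w" for y
        using energy_inner_scale_left[of s \<eta> w y] by (simp add: energy_inner_commute[of s y])
      have "R (v j) (\<lambda>x. \<eta> * w x) = \<eta> * R (v j) w"
        unfolding R_def ee by (simp add: algebra_simps)
      moreover have "Q (\<lambda>x. \<eta> * w x) = \<eta>\<^sup>2 * Q w"
        unfolding Q_def ee energy_inner_scale_left by (simp add: power_mult_distrib power2_eq_square algebra_simps)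
      ultimately have "- \<eta>\<^sup>2 \<le> \<eta> * R (v j) w + \<eta>\<^sup>2 * Q w" by simp
      then have "\<eta> * 0 \<le> \<eta> * (R (v j) w + \<eta> * Q w + \<eta>)" by (simp add: power2_eq_square algebra_simps)
      then have low: "0 \<le> R (v j) w + \<eta> * Q w + \<eta>" using \<eta> by (simp only: mult_le_cancel_left_pos)
      have "R (v j) w - R \<delta> w \<le> \<eta> * (c / 4 * (1 + energy_inner s w w) + K * (1 / k0 + (\<integral>x. (w x)\<^sup>2 \<partial>lebesgue)))"
      proof -
        have "energy_inner s \<delta> w = energy_inner s z w + energy_inner s (v j) w"
          using energy_inner_add_left[of z s \<Omega> "v j" w] z v w by (simp add: E_def z_def)
        moreover have "2 * \<bar>energy_inner s z w\<bar> \<le> energy_inner s z z / \<eta> + \<eta> * energy_inner s w w"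
          using z w \<eta> unfolding E_def by (intro abs_energy_inner_le)
        moreover have "energy_inner s z z / \<eta> \<le> \<eta>" using zb \<eta> by (simp add: pos_divide_le_eq power2_eq_square)
        ultimately have "energy_inner s (v j) w - energy_inner s \<delta> w \<le> \<eta> * (1 + energy_inner s w w) / 2"
          by (simp add: distrib_left)
        then have A: "c / 2 * (energy_inner s (v j) w - energy_inner s \<delta> w) \<le> c / 2 * (\<eta> * (1 + energy_inner s w w) / 2)"
          using c by (intro mult_left_mono) auto
        have "(\<integral>x. g x (v j x) * w x \<partial>lebesgue) - (\<integral>x. g x (\<delta> x) * w x \<partial>lebesgue) = (\<integral>x. g x (v j x) * w x - g x (\<delta> x) * w x \<partial>lebesgue)"
          using gwi v d w by simp
        also have "\<dots> \<le> (\<integral>x. K * (1 / \<eta> * (z x)\<^sup>2 + \<eta> * (w x)\<^sup>2) \<partial>lebesgue)"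
        proof (intro integral_mono)
          show "integrable lebesgue (\<lambda>x. g x (v j x) * w x - g x (\<delta> x) * w x)" using gwi v d w by simp
          show "integrable lebesgue (\<lambda>x. K * (1 / \<eta> * (z x)\<^sup>2 + \<eta> * (w x)\<^sup>2))" using Ei z w by simp
          fix x
          have "g x (v j x) * w x - g x (\<delta> x) * w x = (g x (v j x) - g x (\<delta> x)) * w x" by (simp add: left_diff_distrib)
          also have "\<dots> \<le> \<bar>g x (v j x) - g x (\<delta> x)\<bar> * \<bar>w x\<bar>" by (metis abs_ge_self abs_mult)
          also have "\<dots> \<le> (K * \<bar>z x\<bar>) * \<bar>w x\<bar>"
            using K(2)[of x "v j x" "\<delta> x"] by (intro mult_right_mono) (auto simp: z_def abs_minus_commute)
          also have "\<dots> \<le> K * (1 / \<eta> * (z x)\<^sup>2 + \<eta> * (w x)\<^sup>2)"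
          proof -
            have "0 \<le> (\<bar>z x\<bar> - \<eta> * \<bar>w x\<bar>)\<^sup>2 / \<eta> + \<bar>z x\<bar> * \<bar>w x\<bar>" using \<eta> by simp
            also have "(\<bar>z x\<bar> - \<eta> * \<bar>w x\<bar>)\<^sup>2 / \<eta> + \<bar>z x\<bar> * \<bar>w x\<bar> = 1 / \<eta> * \<bar>z x\<bar>\<^sup>2 + \<eta> * \<bar>w x\<bar>\<^sup>2 - \<bar>z x\<bar> * \<bar>w x\<bar>"
            proof -
              have "(a - \<eta> * b)\<^sup>2 / \<eta> + a * b = 1 / \<eta> * a\<^sup>2 + \<eta> * b\<^sup>2 - a * b" for a b
                using \<eta> by (simp add: power2_eq_square field_simps)
              then show ?thesis .
            qed
            finally have "\<bar>z x\<bar> * \<bar>w x\<bar> \<le> 1 / \<eta> * (z x)\<^sup>2 + \<eta> * (w x)\<^sup>2" by simp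
            from mult_left_mono[OF this K(1)] show ?thesis by (simp add: mult.assoc)
          qed
          finally show "g x (v j x) * w x - g x (\<delta> x) * w x \<le> K * (1 / \<eta> * (z x)\<^sup>2 + \<eta> * (w x)\<^sup>2)" .
        qed
        also have "\<dots> = K * (1 / \<eta> * (\<integral>x. (z x)\<^sup>2 \<partial>lebesgue) + \<eta> * (\<integral>x. (w x)\<^sup>2 \<partial>lebesgue))" using Ei z w by simp
        also have "\<dots> \<le> K * (\<eta> / k0 + \<eta> * (\<integral>x. (w x)\<^sup>2 \<partial>lebesgue))"
        proof (intro mult_left_mono add_right_mono K)
          have "k0 * (\<integral>x. (z x)\<^sup>2 \<partial>lebesgue) \<le> \<eta>\<^sup>2" using k0(2)[OF z] zb by simp
          then show "1 / \<eta> * (\<integral>x. (z x)\<^sup>2 \<partial>lebesgue) \<le> \<eta> / k0" using k0(1) \<eta> by (simp add: field_simps power2_eq_square)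
        qed
        finally have B: "(\<integral>x. g x (v j x) * w x \<partial>lebesgue) - (\<integral>x. g x (\<delta> x) * w x \<partial>lebesgue)
            \<le> K * (\<eta> / k0 + \<eta> * (\<integral>x. (w x)\<^sup>2 \<partial>lebesgue))" .
        have "R (v j) w - R \<delta> w = c / 2 * (energy_inner s (v j) w - energy_inner s \<delta> w)
            + ((\<integral>x. g x (v j x) * w x \<partial>lebesgue) - (\<integral>x. g x (\<delta> x) * w x \<partial>lebesgue))"
          by (simp add: R_def algebra_simps)
        moreover have "\<eta> * (c / 4 * (1 + energy_inner s w w) + K * (1 / k0 + (\<integral>x. (w x)\<^sup>2 \<partial>lebesgue)))
            = c / 2 * (\<eta> * (1 + energy_inner s w w) / 2) + K * (\<eta> / k0 + \<eta> * (\<integral>x. (w x)\<^sup>2 \<partial>lebesgue))"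
          by (simp add: algebra_simps)
        ultimately show ?thesis using A B by linarith
      qed
      then show ?thesis using low unfolding W_def by (simp add: algebra_simps)
    qed
    show ?thesis
    proof (rule ccontr)
      assume "\<not> 0 \<le> R \<delta> w"
      then have "0 < - R \<delta> w / (2 * W)" using W by (intro divide_pos_pos) auto
      from est[OF this] have "R \<delta> w / 2 \<le> R \<delta> w" using W by simp
      then show False using \<open>\<not> 0 \<le> R \<delta> w\<close> by simp
    qed
  qed
  have "c / 2 * energy_inner s \<delta> w + (\<integral>x. g x (\<delta> x) * w x \<partial>lebesgue) = (\<integral>x. h x * w x \<partial>lebesgue)" if w: "w \<in> E" for w
  proof -
    have "R \<delta> (\<lambda>x. - 1 * w x) = - R \<delta> w"
      using energy_inner_scale_left[of s "-1" w \<delta>] unfolding R_def by (simp add: energy_inner_commute[of s \<delta>])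
    then have "R \<delta> w = 0" using nonneg[OF w] nonneg[OF scale[OF w, of "-1"]] by simp
    then show ?thesis by (simp add: R_def)
  qed
  then show ?thesis using d unfolding E_def by blast
qed

section \<open>Perturbing the control\<close>

text \<open>The two functions differ on a subset of a null set, and such subsets are measurable because Lebesgue
  measure is complete.\<close>

lemma borel_measurable_lebesgue_on_AE:
  fixes f g :: "'a::euclidean_space \<Rightarrow> real"
  assumes S: "S \<in> sets lebesgue" and f: "f \<in> borel_measurable (lebesgue_on S)" and ae: "AE x in lebesgue_on S. f x = g x"
  shows "g \<in> borel_measurable (lebesgue_on S)"
proof -
  define F where "F = (\<lambda>x. indicator S x *\<^sub>R f x)"
  define G where "G = (\<lambda>x. indicator S x *\<^sub>R g x)"
  have F: "F \<in> borel_measurable lebesgue"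
    using f S borel_measurable_restrict_space_iff[of S lebesgue f] by (simp add: F_def)
  have "AE x in lebesgue. x \<in> S \<longrightarrow> f x = g x" using ae S by (simp add: AE_restrict_space_iff)
  then have "AE x in lebesgue. F x = G x" by eventually_elim (auto simp: F_def G_def indicator_def)
  then have N: "{x. F x \<noteq> G x} \<in> null_sets lebesgue" by (simp add: completion.AE_iff_null_sets)
  have "G \<in> borel_measurable lebesgue"
  proof (subst borel_measurable_iff_le, intro allI)
    fix a
    have 1: "{x. F x \<noteq> G x} \<inter> {x. G x \<le> a} \<in> sets lebesgue"
      using null_sets_completion_subset[OF _ N, of "{x. F x \<noteq> G x} \<inter> {x. G x \<le> a}"] by auto
    have 2: "{x. F x \<le> a} - {x. F x \<noteq> G x} \<in> sets lebesgue"
      using F N borel_measurable_iff_le[of F lebesgue] by (intro sets.Diff) auto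
    have eq: "{x \<in> space lebesgue. G x \<le> a} = ({x. F x \<le> a} - {x. F x \<noteq> G x}) \<union> ({x. F x \<noteq> G x} \<inter> {x. G x \<le> a})"
      by auto
    show "{x \<in> space lebesgue. G x \<le> a} \<in> sets lebesgue" unfolding eq by (rule sets.Un[OF 2 1])
  qed
  then show ?thesis using S borel_measurable_restrict_space_iff[of S lebesgue g] by (simp add: G_def)
qed

lemma AE_lebesgue_on_null_set:
  fixes S :: "'a::euclidean_space set"
  assumes S: "S \<in> sets lebesgue" and ae: "AE x in lebesgue_on S. P x"
  shows "\<exists>N\<in>null_sets lebesgue. \<forall>x\<in>S - N. P x"
proof -
  have "AE x in lebesgue. x \<in> S \<longrightarrow> P x" using ae S by (simp add: AE_restrict_space_iff)
  then obtain N where "N \<in> null_sets lebesgue" "{x. \<not> (x \<in> S \<longrightarrow> P x)} \<subseteq> N" by (auto simp: eventually_ae_filter)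
  then show ?thesis by (intro bexI[of _ N]) auto
qed

lemma caratheodory_composition:
  fixes S :: "(real ^ 'n) set"
  assumes S: "S \<in> sets lebesgue" and g: "caratheodory S g" and u: "u \<in> borel_measurable (lebesgue_on S)"
  shows "(\<lambda>x. g x (u x)) \<in> borel_measurable (lebesgue_on S)"
proof -
  have "AE x in lebesgue_on S. continuous_on UNIV (g x)" using g by (simp add: caratheodory_def)
  from AE_lebesgue_on_null_set[OF S this] obtain N
    where N0: "N \<in> null_sets lebesgue" and N1: "\<forall>x\<in>S - N. continuous_on UNIV (g x)" by blast
  note N = N0 bspec[OF N1]
  define g' where "g' = (\<lambda>x d. if x \<in> N then 0 else g x d)"
  have Ns: "N \<inter> space (lebesgue_on S) \<in> sets (lebesgue_on S)"
    using N(1) S by (auto simp: sets_restrict_space space_restrict_space)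
  have "(\<lambda>x. g' x (u x)) \<in> borel_measurable (lebesgue_on S)"
  proof (rule caratheodory_measurable[OF _ _ u])
    show "(\<lambda>x. g' x d) \<in> borel_measurable (lebesgue_on S)" for d
      unfolding g'_def using g Ns by (intro measurable_If_set) (auto simp: caratheodory_def)
    show "continuous_on UNIV (g' x)" if "x \<in> space (lebesgue_on S)" for x
      using N(2)[of x] that by (cases "x \<in> N") (auto simp: g'_def space_restrict_space)
  qed
  moreover have "AE x in lebesgue_on S. g' x (u x) = g x (u x)"
  proof -
    have "AE x in lebesgue. x \<in> S \<longrightarrow> g' x (u x) = g x (u x)"
      using AE_not_in[OF N(1)] by eventually_elim (auto simp: g'_def)
    then show ?thesis using S by (simp add: AE_restrict_space_iff)
  qed
  ultimately show ?thesis by (rule borel_measurable_lebesgue_on_AE[OF S])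
qed

text \<open>The derivative is a limit of difference quotients, each of which is a measurable composition.\<close>

lemma D1_composition_measurable:
  fixes S :: "(real ^ 'n) set"
  assumes S: "S \<in> sets lebesgue" and g: "caratheodory S g" "C2_second S g" and u [measurable]: "u \<in> borel_measurable (lebesgue_on S)"
  shows "(\<lambda>x. D1 g x (u x)) \<in> borel_measurable (lebesgue_on S)"
proof -
  have "AE x in lebesgue_on S. \<forall>u. g x field_differentiable (at u)"
    using g(2) by (auto simp: C2_second_def elim!: eventually_mono)
  from AE_lebesgue_on_null_set[OF S this] obtain N
    where N0: "N \<in> null_sets lebesgue" and N1: "\<forall>x\<in>S - N. \<forall>u. g x field_differentiable (at u)" by blast
  note N = N0 bspec[OF N1]
  define q where "q = (\<lambda>(n::nat) x. if x \<in> N then 0 else (g x (u x + inverse (real (Suc n))) - g x (u x)) / inverse (real (Suc n)))"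
  have Ns: "N \<inter> space (lebesgue_on S) \<in> sets (lebesgue_on S)"
    using N(1) S by (auto simp: sets_restrict_space space_restrict_space)
  have qm: "q n \<in> borel_measurable (lebesgue_on S)" for n
  proof -
    have "(\<lambda>x. (g x (u x + d) - g x (u x)) / d) \<in> borel_measurable (lebesgue_on S)" for d
    proof -
      have [measurable]: "(\<lambda>x. g x (u x + d)) \<in> borel_measurable (lebesgue_on S)" "(\<lambda>x. g x (u x)) \<in> borel_measurable (lebesgue_on S)"
        by (intro caratheodory_composition[OF S g(1)]; measurable)+
      show ?thesis by measurable
    qed
    then show ?thesis unfolding q_def by (intro measurable_If_set[OF _ _ Ns]) auto
  qed
  have "(\<lambda>x. if x \<in> N then 0 else D1 g x (u x)) \<in> borel_measurable (lebesgue_on S)"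
  proof (rule borel_measurable_LIMSEQ_real[OF _ qm])
    fix x assume x: "x \<in> space (lebesgue_on S)"
    show "(\<lambda>n. q n x) \<longlonglongrightarrow> (if x \<in> N then 0 else D1 g x (u x))"
    proof (cases "x \<in> N")
      case False
      then have "(g x has_field_derivative D1 g x (u x)) (at (u x))"
        using N(2)[of x] x by (auto simp: D1_def space_restrict_space DERIV_deriv_iff_field_differentiable)
      then have "((\<lambda>h. (g x (u x + h) - g x (u x)) / h) \<longlongrightarrow> D1 g x (u x)) (at 0)" by (simp add: DERIV_def)
      moreover have "filterlim (\<lambda>n. inverse (real (Suc n))) (at 0) sequentially"
        by (intro filterlim_atI LIMSEQ_inverse_real_of_nat) auto
      ultimately have "(\<lambda>n. (g x (u x + inverse (real (Suc n))) - g x (u x)) / inverse (real (Suc n))) \<longlonglongrightarrow> D1 g x (u x)"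
        by (rule filterlim_compose)
      then show ?thesis using False by (simp add: q_def)
    qed (simp add: q_def)
  qed
  moreover have "AE x in lebesgue_on S. (if x \<in> N then 0 else D1 g x (u x)) = D1 g x (u x)"
  proof -
    have "AE x in lebesgue. x \<in> S \<longrightarrow> (if x \<in> N then 0 else D1 g x (u x)) = D1 g x (u x)"
      using AE_not_in[OF N(1)] by eventually_elim auto
    then show ?thesis using S by (simp add: AE_restrict_space_iff)
  qed
  ultimately show ?thesis by (rule borel_measurable_lebesgue_on_AE[OF S])
qed

lemma difference_le_derivative_bound:
  fixes f f' :: "real \<Rightarrow> real"
  assumes f: "\<And>u. (f has_real_derivative f' u) (at u)"
    and b: "\<And>u. u \<in> {-m..m} \<Longrightarrow> \<bar>f' u\<bar> \<le> C" and pq: "p \<in> {-m..m}" "q \<in> {-m..m}"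
  shows "\<bar>f p - f q\<bar> \<le> C * \<bar>p - q\<bar>"
  using field_differentiable_bound[of "{-m..m}" f f' C p q] assms
  by (auto intro: has_field_derivative_at_within)

text \<open>By the mean value theorem, applied to \<open>f\<close> and then to its derivative; the usual factor 1/2 is lost.\<close>

lemma taylor_quadratic_bound:
  fixes f f' f'' :: "real \<Rightarrow> real"
  assumes f: "\<And>u. (f has_real_derivative f' u) (at u)" and f': "\<And>u. (f' has_real_derivative f'' u) (at u)"
    and b: "\<And>u. u \<in> {-m..m} \<Longrightarrow> \<bar>f'' u\<bar> \<le> C" and pq: "p \<in> {-m..m}" "p + d \<in> {-m..m}"
  shows "\<bar>f (p + d) - f p - f' p * d\<bar> \<le> C * d\<^sup>2"
proof (cases "d = 0")
  case False
  obtain z where z: "z \<in> {-m..m}" "\<bar>z - p\<bar> \<le> \<bar>d\<bar>" "f (p + d) - f p = d * f' z"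
  proof (cases "0 < d")
    case True
    then obtain z where "p < z" "z < p + d" "f (p + d) - f p = (p + d - p) * f' z"
      using MVT2[of p "p + d" f f'] f by auto
    then show ?thesis using pq True by (intro that[of z]) auto
  next
    case neg: False
    then obtain z where "p + d < z" "z < p" "f p - f (p + d) = (p - (p + d)) * f' z"
      using MVT2[of "p + d" p f f'] f False by auto
    then show ?thesis using pq neg by (intro that[of z]) auto
  qed
  have C: "0 \<le> C" using b[OF pq(1)] by simp
  have "\<bar>f' z - f' p\<bar> \<le> C * \<bar>z - p\<bar>" by (rule difference_le_derivative_bound[OF f' b z(1) pq(1)])
  also have "\<dots> \<le> C * \<bar>d\<bar>" using z(2) C by (rule mult_left_mono)
  finally have "\<bar>d\<bar> * \<bar>f' z - f' p\<bar> \<le> \<bar>d\<bar> * (C * \<bar>d\<bar>)" by (rule mult_left_mono) simp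
  moreover have "f (p + d) - f p - f' p * d = d * (f' z - f' p)" using z(3) by (simp add: algebra_simps)
  ultimately show ?thesis by (simp add: abs_mult power2_eq_square mult_ac)
qed simp

lemma Lp_space_power:
  fixes f :: "real ^ 'n \<Rightarrow> real"
  assumes S: "S \<in> lmeasurable" and f: "f \<in> Lp_space r S" and k: "real k \<le> r" "0 < k"
  shows "integrable (lebesgue_on S) (\<lambda>x. \<bar>f x\<bar> ^ k)"
proof (rule Bochner_Integration.integrable_bound)
  interpret finite_measure "lebesgue_on S" using S by (rule finite_measure_lebesgue_on)
  show "integrable (lebesgue_on S) (\<lambda>x. 1 + \<bar>f x\<bar> powr r)"
    using f by (auto simp: Lp_space_def)
  have [measurable]: "f \<in> borel_measurable (lebesgue_on S)" using f by (simp add: Lp_space_def)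
  show "(\<lambda>x. \<bar>f x\<bar> ^ k) \<in> borel_measurable (lebesgue_on S)" by measurable
  have "\<bar>a\<bar> ^ k \<le> 1 + \<bar>a\<bar> powr r" for a :: real
  proof (cases "\<bar>a\<bar> \<le> 1")
    case True
    then have "\<bar>a\<bar> ^ k \<le> 1" by (intro power_le_one) auto
    then show ?thesis by (smt (verit) powr_ge_zero)
  next
    case False
    then have "\<bar>a\<bar> powr real k \<le> \<bar>a\<bar> powr r" using k by (intro powr_mono) auto
    then show ?thesis using False by (simp add: powr_realpow)
  qed
  then show "AE x in lebesgue_on S. norm (\<bar>f x\<bar> ^ k) \<le> norm (1 + \<bar>f x\<bar> powr r)" by auto
qed

lemma square_integrable_add_multiple:
  fixes f g w :: "'a \<Rightarrow> real"
  assumes m: "w \<in> borel_measurable M" and f: "integrable M (\<lambda>x. (f x)\<^sup>2)" and g: "integrable M (\<lambda>x. (g x)\<^sup>2)"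
    and ae: "AE x in M. \<bar>w x\<bar> \<le> \<bar>f x\<bar> + C * \<bar>g x\<bar>" and C: "0 \<le> C"
  shows "integrable M (\<lambda>x. (w x)\<^sup>2)"
proof (rule Bochner_Integration.integrable_bound)
  show "integrable M (\<lambda>x. 2 * (f x)\<^sup>2 + 2 * C\<^sup>2 * (g x)\<^sup>2)" using f g by auto
  show "(\<lambda>x. (w x)\<^sup>2) \<in> borel_measurable M" using m by measurable
  show "AE x in M. norm ((w x)\<^sup>2) \<le> norm (2 * (f x)\<^sup>2 + 2 * C\<^sup>2 * (g x)\<^sup>2)"
    using ae
  proof eventually_elim
    case (elim x)
    have "\<bar>w x\<bar>\<^sup>2 \<le> (\<bar>f x\<bar> + C * \<bar>g x\<bar>)\<^sup>2" using elim by (intro power_mono) auto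
    also have "\<dots> \<le> 2 * \<bar>f x\<bar>\<^sup>2 + 2 * (C * \<bar>g x\<bar>)\<^sup>2"
      using square_diff_le[of "\<bar>f x\<bar>" "- (C * \<bar>g x\<bar>)" 0] by simp
    finally show ?case by (simp add: power_mult_distrib)
  qed
qed

text \<open>The perturbed state is sought in the form \<open>ub + \<delta>\<close>. The increment of the nonlinearity is
  truncated to make it globally Lipschitz, and the supersolution bound shows afterwards that the
  truncation was inactive. The same bound gives the Lipschitz dependence on the data.\<close>

lemma perturbed_state:
  fixes \<Omega> :: "(real ^ 'n) set" and a :: "real ^ 'n \<Rightarrow> real \<Rightarrow> real"
  assumes O: "\<Omega> \<in> sets lebesgue" "bounded \<Omega>" and s: "0 < s" and c: "0 < c"
    and a: "standing_a s \<Omega> a"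
    and ub: "ub \<in> borel_measurable (lebesgue_on \<Omega>)" "AE x in lebesgue_on \<Omega>. \<bar>ub x\<bar> \<le> M" and M: "0 \<le> M"
  shows "\<exists>\<kappa>>0. \<forall>H h. 0 < H \<longrightarrow> \<kappa> * H \<le> 1 \<longrightarrow> h \<in> borel_measurable lebesgue \<longrightarrow> integrable lebesgue (\<lambda>x. (h x)\<^sup>2) \<longrightarrow>
     (AE x in lebesgue. \<bar>h x\<bar> \<le> H) \<longrightarrow>
     (\<exists>\<delta>\<in>energy_space s \<Omega>. (AE x in lebesgue. \<bar>\<delta> x\<bar> \<le> \<kappa> * H) \<and>
        (\<forall>v\<in>energy_space s \<Omega>. integrable (lebesgue_on \<Omega>) (\<lambda>x. (a x (ub x + \<delta> x) - a x (ub x)) * v x) \<and>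
          c / 2 * energy_inner s \<delta> v + (\<integral>x. (a x (ub x + \<delta> x) - a x (ub x)) * v x \<partial>lebesgue_on \<Omega>) = (\<integral>x. h x * v x \<partial>lebesgue)))"
proof -
  obtain C where C: "C > 0" and AC: "AE x in lebesgue_on \<Omega>.
        \<forall>u \<in> {-(M+1)..M+1}. \<forall>v \<in> {-(M+1)..M+1}. \<forall>w \<in> {-(M+1)..M+1}.
          \<bar>D1 a x u\<bar> + \<bar>D2 a x u\<bar> \<le> C \<and> \<bar>D2 a x v - D2 a x w\<bar> \<le> C * \<bar>v - w\<bar>"
    using a M unfolding standing_a_def by (meson add_nonneg_pos zero_less_one)
  define good where "good = (\<lambda>x. \<bar>ub x\<bar> \<le> M \<and> (\<forall>u. (a x has_real_derivative D1 a x u) (at u)) \<and> (\<forall>u. 0 \<le> D1 a x u)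
      \<and> (\<forall>u\<in>{-(M+1)..M+1}. \<bar>D1 a x u\<bar> \<le> C))"
  have "AE x in lebesgue_on \<Omega>. (\<forall>u. a x field_differentiable (at u)) \<and> (\<forall>u. D1 a x field_differentiable (at u)) \<and> continuous_on UNIV (D2 a x)"
    "AE x in lebesgue_on \<Omega>. \<forall>u. D1 a x u \<ge> 0"
    using a by (auto simp: standing_a_def C2_second_def)
  with ub(2) AC have "AE x in lebesgue_on \<Omega>. good x"
  proof eventually_elim
    case (elim x)
    have "\<bar>D1 a x u\<bar> \<le> C" if "u \<in> {-(M+1)..M+1}" for u
      using elim(2) that abs_ge_zero[of "D2 a x u"] by (smt (verit, best))
    then show ?case using elim by (auto simp: good_def D1_def DERIV_deriv_iff_field_differentiable)
  qed
  from AE_lebesgue_on_null_set[OF O(1) this] obtain N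
    where N0: "N \<in> null_sets lebesgue" and N1: "\<forall>x\<in>\<Omega> - N. good x" by blast
  note N = N0 bspec[OF N1]
  \<comment> \<open>Monotonicity and the Lipschitz bound are needed at every point, hence the value 0 on the exceptional set \<open>N\<close> below.\<close>
  define cl where "cl = (\<lambda>d::real. max (-1) (min 1 d))"
  have cl: "\<bar>cl d\<bar> \<le> 1" "cl 0 = 0" "\<bar>cl d - cl e\<bar> \<le> \<bar>d - e\<bar>" "d \<le> e \<Longrightarrow> cl d \<le> cl e" for d e
    by (auto simp: cl_def)
  define g where "g = (\<lambda>x d. if x \<in> \<Omega> - N then a x (ub x + cl d) - a x (ub x) else 0)"
  have ON: "\<Omega> - N \<in> sets lebesgue" using O N by auto
  have gm: "(\<lambda>x. g x d) \<in> borel_measurable lebesgue" for d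
  proof -
    have ac: "caratheodory \<Omega> a" using a by (simp add: standing_a_def)
    have "(\<lambda>x. a x (ub x + cl d) - a x (ub x)) \<in> borel_measurable (lebesgue_on \<Omega>)"
      using ub(1) by (intro borel_measurable_diff caratheodory_composition[OF O(1) ac]) auto
    then have "(\<lambda>x. indicator \<Omega> x *\<^sub>R (a x (ub x + cl d) - a x (ub x))) \<in> borel_measurable lebesgue"
      using O borel_measurable_restrict_space_iff[of \<Omega> lebesgue "\<lambda>x. a x (ub x + cl d) - a x (ub x)"] by simp
    then have "(\<lambda>x. if x \<in> \<Omega> - N then indicator \<Omega> x *\<^sub>R (a x (ub x + cl d) - a x (ub x)) else 0) \<in> borel_measurable lebesgue"
      using ON by (intro measurable_If_set) auto
    also have "(\<lambda>x. if x \<in> \<Omega> - N then indicator \<Omega> x *\<^sub>R (a x (ub x + cl d) - a x (ub x)) else 0) = (\<lambda>x. g x d)"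
      by (auto simp: g_def)
    finally show ?thesis .
  qed
  have in_range: "ub x + cl d \<in> {-(M+1)..M+1}" "ub x \<in> {-(M+1)..M+1}" if "x \<in> \<Omega> - N" for x d
    using N(2)[OF that] cl(1)[of d] unfolding good_def by (auto simp: abs_le_iff)
  have g0: "g x 0 = 0" for x by (simp add: g_def cl)
  have mono: "g x d \<le> g x e" if "d \<le> e" for x d e
  proof (cases "x \<in> \<Omega> - N")
    case True
    have "a x (ub x + cl d) \<le> a x (ub x + cl e)"
    proof (rule DERIV_nonneg_imp_nondecreasing[where f = "a x"])
      show "ub x + cl d \<le> ub x + cl e" using cl(4)[OF that] by simp
      fix u show "\<exists>y. (a x has_real_derivative y) (at u) \<and> 0 \<le> y" using N(2)[OF True] by (auto simp: good_def)
    qed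
    then show ?thesis using True by (simp add: g_def)
  qed (auto simp: g_def)
  have lip: "\<bar>g x d - g x e\<bar> \<le> C * \<bar>d - e\<bar>" for x d e
  proof (cases "x \<in> \<Omega> - N")
    case True
    have "\<bar>a x (ub x + cl d) - a x (ub x + cl e)\<bar> \<le> C * \<bar>(ub x + cl d) - (ub x + cl e)\<bar>"
      by (rule difference_le_derivative_bound[of "a x" "D1 a x" "M + 1"])
        (use N(2)[OF True] in_range[OF True] in \<open>auto simp: good_def\<close>)
    also have "\<dots> \<le> C * \<bar>d - e\<bar>" using cl(3)[of d e] C by (intro mult_left_mono) auto
    finally show ?thesis using True by (simp add: g_def)
  qed (use C in \<open>auto simp: g_def\<close>)
  obtain \<kappa> where k: "0 < \<kappa>" and bound: "\<forall>\<delta> \<gamma> h H. \<delta> \<in> energy_space s \<Omega> \<longrightarrow>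
      (\<forall>v\<in>energy_space s \<Omega>. integrable lebesgue (\<lambda>x. \<gamma> x * v x) \<and> integrable lebesgue (\<lambda>x. h x * v x)
         \<and> c / 2 * energy_inner s \<delta> v + (\<integral>x. \<gamma> x * v x \<partial>lebesgue) = (\<integral>x. h x * v x \<partial>lebesgue)) \<longrightarrow>
      (AE x in lebesgue. 0 \<le> \<delta> x \<longrightarrow> 0 \<le> \<gamma> x) \<longrightarrow> (AE x in lebesgue. h x \<le> H) \<longrightarrow> 0 < H \<longrightarrow>
      (AE x in lebesgue. \<delta> x \<le> \<kappa> * H)"
    using supersolution_bound[OF O s c] by blast
  show ?thesis
  proof (intro exI[of _ \<kappa>] conjI[OF k] allI impI)
    fix H and h :: "real ^ 'n \<Rightarrow> real"
    assume H: "0 < H" "\<kappa> * H \<le> 1" and h: "h \<in> borel_measurable lebesgue" "integrable lebesgue (\<lambda>x. (h x)\<^sup>2)"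
      and hH: "AE x in lebesgue. \<bar>h x\<bar> \<le> H"
    obtain \<delta> where d: "\<delta> \<in> energy_space s \<Omega>" and eq: "\<And>v. v \<in> energy_space s \<Omega> \<Longrightarrow>
        c / 2 * energy_inner s \<delta> v + (\<integral>x. g x (\<delta> x) * v x \<partial>lebesgue) = (\<integral>x. h x * v x \<partial>lebesgue)"
      using monotone_problem_solvable[OF O s c gm g0 mono _ lip h] C by auto
    have dm: "\<delta> \<in> borel_measurable lebesgue" "integrable lebesgue (\<lambda>x. (\<delta> x)\<^sup>2)" using d by (auto simp: energy_space_def)
    have gcont: "continuous_on UNIV (g x)" for x
    proof (rule continuous_on_iff[THEN iffD2], intro ballI allI impI)
      fix d e :: real assume e: "0 < e"
      show "\<exists>r>0. \<forall>x'\<in>UNIV. dist x' d < r \<longrightarrow> dist (g x x') (g x d) < e"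
      proof (intro exI[of _ "e / C"] conjI ballI impI)
        show "0 < e / C" using e C by simp
        fix y assume "dist y d < e / C"
        then have "C * \<bar>y - d\<bar> < e" using C by (simp add: dist_real_def field_simps)
        then show "dist (g x y) (g x d) < e" using lip[of x y d] unfolding dist_real_def by simp
      qed
    qed
    have gdm: "(\<lambda>x. g x (\<delta> x)) \<in> borel_measurable lebesgue" by (rule caratheodory_measurable[OF gm gcont dm(1)])
    have gdi: "integrable lebesgue (\<lambda>x. (g x (\<delta> x))\<^sup>2)"
      by (rule square_integrable_add_multiple[OF gdm _ dm(2), of "\<lambda>_. 0" C])
        (use lip[of _ _ 0] g0 C in auto)
    have int: "integrable lebesgue (\<lambda>x. g x (\<delta> x) * v x)" "integrable lebesgue (\<lambda>x. h x * v x)" if "v \<in> energy_space s \<Omega>" for v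
      using that by (auto simp: energy_space_def intro!: integrable_mult_of_squares gdm gdi h)
    have upper: "AE x in lebesgue. \<delta> x \<le> \<kappa> * H"
    proof (rule bound[rule_format, OF d])
      show "AE x in lebesgue. 0 \<le> \<delta> x \<longrightarrow> 0 \<le> g x (\<delta> x)" using mono[of 0] g0 by auto
      show "AE x in lebesgue. h x \<le> H" using hH by eventually_elim auto
    qed (use int eq H in auto)
    have lower: "AE x in lebesgue. - \<delta> x \<le> \<kappa> * H"
    proof (rule bound[rule_format, of "\<lambda>x. - \<delta> x" "\<lambda>x. - g x (\<delta> x)" "\<lambda>x. - h x"])
      show "(\<lambda>x. - \<delta> x) \<in> energy_space s \<Omega>" using energy_space_scale[OF d, of "-1"] by simp
      show "AE x in lebesgue. 0 \<le> - \<delta> x \<longrightarrow> 0 \<le> - g x (\<delta> x)"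
        using mono[of _ 0] g0 by (intro AE_I2) (metis neg_0_le_iff_le)
      show "AE x in lebesgue. - h x \<le> H" using hH by eventually_elim auto
      fix v assume v: "v \<in> energy_space s \<Omega>"
      show "integrable lebesgue (\<lambda>x. - g x (\<delta> x) * v x) \<and> integrable lebesgue (\<lambda>x. - h x * v x) \<and>
        c / 2 * energy_inner s (\<lambda>x. - \<delta> x) v + (\<integral>x. - g x (\<delta> x) * v x \<partial>lebesgue) = (\<integral>x. - h x * v x \<partial>lebesgue)"
        using int[OF v] eq[OF v] energy_inner_scale_left[of s "-1" \<delta> v] by simp
    qed (use H in auto)
    have db: "AE x in lebesgue. \<bar>\<delta> x\<bar> \<le> \<kappa> * H" using upper lower by eventually_elim (auto simp: abs_le_iff)
    have ga: "AE x in lebesgue. indicator \<Omega> x *\<^sub>R ((a x (ub x + \<delta> x) - a x (ub x)) * v x) = g x (\<delta> x) * v x" for v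
      using db AE_not_in[OF N(1)]
    proof eventually_elim
      case (elim x)
      then have "cl (\<delta> x) = \<delta> x" using H by (auto simp: cl_def)
      then show ?case using elim by (auto simp: g_def indicator_def)
    qed
    have am: "(\<lambda>x. indicator \<Omega> x *\<^sub>R ((a x (ub x + \<delta> x) - a x (ub x)) * v x)) \<in> borel_measurable lebesgue" if v: "v \<in> energy_space s \<Omega>" for v
    proof -
      have ac: "caratheodory \<Omega> a" using a by (simp add: standing_a_def)
      have [measurable]: "\<delta> \<in> borel_measurable (lebesgue_on \<Omega>)" "v \<in> borel_measurable (lebesgue_on \<Omega>)" "ub \<in> borel_measurable (lebesgue_on \<Omega>)"
        using energy_space_on[OF d O(1)] energy_space_on[OF v O(1)] ub by auto
      have [measurable]: "(\<lambda>x. a x (ub x + \<delta> x)) \<in> borel_measurable (lebesgue_on \<Omega>)" "(\<lambda>x. a x (ub x)) \<in> borel_measurable (lebesgue_on \<Omega>)"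
        by (intro caratheodory_composition[OF O(1) ac]; measurable)+
      have "(\<lambda>x. (a x (ub x + \<delta> x) - a x (ub x)) * v x) \<in> borel_measurable (lebesgue_on \<Omega>)" by measurable
      then show ?thesis using O borel_measurable_restrict_space_iff[of \<Omega> lebesgue "\<lambda>x. (a x (ub x + \<delta> x) - a x (ub x)) * v x"] by simp
    qed
    have res: "integrable (lebesgue_on \<Omega>) (\<lambda>x. (a x (ub x + \<delta> x) - a x (ub x)) * v x) \<and>
          c / 2 * energy_inner s \<delta> v + (\<integral>x. (a x (ub x + \<delta> x) - a x (ub x)) * v x \<partial>lebesgue_on \<Omega>) = (\<integral>x. h x * v x \<partial>lebesgue)"
      if v: "v \<in> energy_space s \<Omega>" for v
    proof -
      have gv: "(\<lambda>x. g x (\<delta> x) * v x) \<in> borel_measurable lebesgue" using int[OF v] by auto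
      have "integrable (lebesgue_on \<Omega>) (\<lambda>x. (a x (ub x + \<delta> x) - a x (ub x)) * v x)"
        using int(1)[OF v] integrable_cong_AE[OF am[OF v] gv ga] O by (simp add: integrable_restrict_space)
      moreover have "(\<integral>x. (a x (ub x + \<delta> x) - a x (ub x)) * v x \<partial>lebesgue_on \<Omega>) = (\<integral>x. g x (\<delta> x) * v x \<partial>lebesgue)"
        using integral_cong_AE[OF am[OF v] gv ga] O by (simp add: integral_restrict_space)
      ultimately show ?thesis using eq[OF v] by simp
    qed
    show "\<exists>\<delta>\<in>energy_space s \<Omega>. (AE x in lebesgue. \<bar>\<delta> x\<bar> \<le> \<kappa> * H) \<and>
        (\<forall>v\<in>energy_space s \<Omega>. integrable (lebesgue_on \<Omega>) (\<lambda>x. (a x (ub x + \<delta> x) - a x (ub x)) * v x) \<and>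
          c / 2 * energy_inner s \<delta> v + (\<integral>x. (a x (ub x + \<delta> x) - a x (ub x)) * v x \<partial>lebesgue_on \<Omega>) = (\<integral>x. h x * v x \<partial>lebesgue))"
      using d db res by (intro bexI[of _ \<delta>]) auto
  qed
qed

lemma Lp_space_2_iff: "f \<in> Lp_space 2 S \<longleftrightarrow> f \<in> borel_measurable (lebesgue_on S) \<and> integrable (lebesgue_on S) (\<lambda>x. (f x)\<^sup>2)"
proof -
  have "(\<lambda>x. \<bar>f x\<bar> powr 2) = (\<lambda>x. (f x)\<^sup>2)" by simp
  then show ?thesis by (simp add: Lp_space_def)
qed

lemma standing_a_local_bounds:
  fixes \<Omega> :: "(real ^ 'n) set"
  assumes a: "standing_a s \<Omega> a" and u: "AE x in lebesgue_on \<Omega>. \<bar>u x\<bar> \<le> M" and M: "0 \<le> M"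
  shows "\<exists>C>0. AE x in lebesgue_on \<Omega>. \<bar>D1 a x (u x)\<bar> \<le> C \<and> \<bar>a x (u x) - a x 0\<bar> \<le> C * \<bar>u x\<bar> \<and>
     (\<forall>d. \<bar>d\<bar> \<le> 1 \<longrightarrow> \<bar>a x (u x + d) - a x (u x) - D1 a x (u x) * d\<bar> \<le> C * d\<^sup>2)"
proof -
  obtain C where C: "C > 0" and AC: "AE x in lebesgue_on \<Omega>.
        \<forall>u \<in> {-(M+1)..M+1}. \<forall>v \<in> {-(M+1)..M+1}. \<forall>w \<in> {-(M+1)..M+1}.
          \<bar>D1 a x u\<bar> + \<bar>D2 a x u\<bar> \<le> C \<and> \<bar>D2 a x v - D2 a x w\<bar> \<le> C * \<bar>v - w\<bar>"
    using a M unfolding standing_a_def by (meson add_nonneg_pos zero_less_one)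
  have "AE x in lebesgue_on \<Omega>. (\<forall>u. a x field_differentiable (at u)) \<and> (\<forall>u. D1 a x field_differentiable (at u)) \<and> continuous_on UNIV (D2 a x)"
    using a by (auto simp: standing_a_def C2_second_def)
  with u AC have "AE x in lebesgue_on \<Omega>. \<bar>D1 a x (u x)\<bar> \<le> C \<and> \<bar>a x (u x) - a x 0\<bar> \<le> C * \<bar>u x\<bar> \<and>
     (\<forall>d. \<bar>d\<bar> \<le> 1 \<longrightarrow> \<bar>a x (u x + d) - a x (u x) - D1 a x (u x) * d\<bar> \<le> C * d\<^sup>2)"
  proof eventually_elim
    case (elim x)
    have d1: "(a x has_real_derivative D1 a x v) (at v)" for v
      using elim by (auto simp: D1_def DERIV_deriv_iff_field_differentiable)
    have d2: "(D1 a x has_real_derivative D2 a x v) (at v)" for v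
      using elim by (auto simp: D2_def DERIV_deriv_iff_field_differentiable)
    have b: "\<bar>D1 a x v\<bar> \<le> C" "\<bar>D2 a x v\<bar> \<le> C" if "v \<in> {-(M+1)..M+1}" for v
      using elim(2) that abs_ge_zero[of "D2 a x v"] abs_ge_zero[of "D1 a x v"] by (smt (verit, best))+
    have r: "u x \<in> {-(M+1)..M+1}" "0 \<in> {-(M+1)..M+1}" using elim(1) M by (auto simp: abs_le_iff)
    have "\<bar>a x (u x) - a x 0\<bar> \<le> C * \<bar>u x - 0\<bar>"
      by (rule difference_le_derivative_bound[OF d1 b(1) r])
    moreover have "\<bar>a x (u x + d) - a x (u x) - D1 a x (u x) * d\<bar> \<le> C * d\<^sup>2" if "\<bar>d\<bar> \<le> 1" for d
    proof (rule taylor_quadratic_bound[OF d1 d2 b(2) r(1)])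
      show "u x + d \<in> {-(M+1)..M+1}" using elim(1) that by (auto simp: abs_le_iff)
    qed
    ultimately show ?case using b(1)[OF r(1)] by simp
  qed
  then show ?thesis using C by blast
qed

text \<open>The integrability exponent of the bounds on \<open>L\<close> exceeds 2, so on a set of finite measure they are square
  integrable.\<close>

lemma standing_L_local_bounds:
  fixes \<Omega> :: "(real ^ 'n) set"
  assumes L: "standing_L s \<Omega> L" and u: "AE x in lebesgue_on \<Omega>. \<bar>u x\<bar> \<le> M" and M: "0 \<le> M"
    and r2: "2 \<le> real CARD('n) / (2 * s)" and lm: "\<Omega> \<in> lmeasurable"
  shows "\<exists>\<psi> \<phi>. \<psi> \<in> borel_measurable (lebesgue_on \<Omega>) \<and> integrable (lebesgue_on \<Omega>) (\<lambda>x. (\<psi> x)\<^sup>2) \<and>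
     integrable (lebesgue_on \<Omega>) \<psi> \<and> integrable (lebesgue_on \<Omega>) \<phi> \<and>
     (AE x in lebesgue_on \<Omega>. \<bar>D1 L x (u x)\<bar> \<le> \<psi> x \<and> \<bar>L x (u x) - L x 0\<bar> \<le> \<psi> x * \<bar>u x\<bar> \<and>
     (\<forall>d. \<bar>d\<bar> \<le> 1 \<longrightarrow> \<bar>L x (u x + d) - L x (u x) - D1 L x (u x) * d\<bar> \<le> \<phi> x * d\<^sup>2))"
proof -
  obtain r where r: "r > real CARD('n) / (2 * s)" and ex: "\<forall>m > 0. \<exists>\<psi> \<in> Lp_space r \<Omega>. \<exists>\<phi> \<in> Lp_space r \<Omega>.
          AE x in lebesgue_on \<Omega>. \<forall>u \<in> {-m..m}. \<bar>D1 L x u\<bar> \<le> \<psi> x \<and> \<bar>D2 L x u\<bar> \<le> \<phi> x"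
    using L unfolding standing_L_def by blast
  have "0 < M + 1" using M by simp
  from ex[rule_format, OF this] obtain \<psi> where \<psi>: "\<psi> \<in> Lp_space r \<Omega>"
    and ex2: "\<exists>\<phi> \<in> Lp_space r \<Omega>. AE x in lebesgue_on \<Omega>. \<forall>u \<in> {-(M+1)..M+1}. \<bar>D1 L x u\<bar> \<le> \<psi> x \<and> \<bar>D2 L x u\<bar> \<le> \<phi> x"
    by (rule bexE)
  from ex2 obtain \<phi> where \<phi>: "\<phi> \<in> Lp_space r \<Omega>"
    and AL: "AE x in lebesgue_on \<Omega>. \<forall>u \<in> {-(M+1)..M+1}. \<bar>D1 L x u\<bar> \<le> \<psi> x \<and> \<bar>D2 L x u\<bar> \<le> \<phi> x"
    by (rule bexE)
  have \<psi>m: "\<psi> \<in> borel_measurable (lebesgue_on \<Omega>)" and \<phi>m: "\<phi> \<in> borel_measurable (lebesgue_on \<Omega>)" using \<psi> \<phi> by (auto simp: Lp_space_def)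
  have i1: "integrable (lebesgue_on \<Omega>) f" if "f \<in> Lp_space r \<Omega>" for f
  proof -
    have "integrable (lebesgue_on \<Omega>) (\<lambda>x. \<bar>f x\<bar>)" using Lp_space_power[OF lm that, of 1] r r2 by simp
    moreover have "f \<in> borel_measurable (lebesgue_on \<Omega>)" using that by (simp add: Lp_space_def)
    ultimately show ?thesis by (rule integrable_abs_cancel)
  qed
  have i2: "integrable (lebesgue_on \<Omega>) (\<lambda>x. (\<psi> x)\<^sup>2)"
    using Lp_space_power[OF lm \<psi>, of 2] r r2 by simp
  have "AE x in lebesgue_on \<Omega>. (\<forall>u. L x field_differentiable (at u)) \<and> (\<forall>u. D1 L x field_differentiable (at u)) \<and> continuous_on UNIV (D2 L x)"
    using L by (auto simp: standing_L_def C2_second_def)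
  with u AL have "AE x in lebesgue_on \<Omega>. \<bar>D1 L x (u x)\<bar> \<le> \<psi> x \<and> \<bar>L x (u x) - L x 0\<bar> \<le> \<psi> x * \<bar>u x\<bar> \<and>
     (\<forall>d. \<bar>d\<bar> \<le> 1 \<longrightarrow> \<bar>L x (u x + d) - L x (u x) - D1 L x (u x) * d\<bar> \<le> \<phi> x * d\<^sup>2)"
  proof eventually_elim
    case (elim x)
    have d1: "(L x has_real_derivative D1 L x v) (at v)" for v
      using elim by (auto simp: D1_def DERIV_deriv_iff_field_differentiable)
    have d2: "(D1 L x has_real_derivative D2 L x v) (at v)" for v
      using elim by (auto simp: D2_def DERIV_deriv_iff_field_differentiable)
    have b: "\<bar>D1 L x v\<bar> \<le> \<psi> x" "\<bar>D2 L x v\<bar> \<le> \<phi> x" if "v \<in> {-(M+1)..M+1}" for v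
      using elim(2) that by auto
    have r: "u x \<in> {-(M+1)..M+1}" "0 \<in> {-(M+1)..M+1}" using elim(1) M by (auto simp: abs_le_iff)
    have "\<bar>L x (u x) - L x 0\<bar> \<le> \<psi> x * \<bar>u x - 0\<bar>"
      by (rule difference_le_derivative_bound[OF d1 b(1) r])
    moreover have "\<bar>L x (u x + d) - L x (u x) - D1 L x (u x) * d\<bar> \<le> \<phi> x * d\<^sup>2" if "\<bar>d\<bar> \<le> 1" for d
    proof (rule taylor_quadratic_bound[OF d1 d2 b(2) r(1)])
      show "u x + d \<in> {-(M+1)..M+1}" using elim(1) that by (auto simp: abs_le_iff)
    qed
    ultimately show ?case using b(1)[OF r(1)] by simp
  qed
  then show ?thesis using i1[OF \<psi>] i1[OF \<phi>] i2 \<psi>m by blast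
qed

section \<open>The optimality condition\<close>

lemma L2_norm_square: "(L2_norm S f)\<^sup>2 = (\<integral>x. (f x)\<^sup>2 \<partial>lebesgue_on S)"
  by (simp add: L2_norm_def L2_inner_def power2_eq_square)

lemma Linf_space_bound:
  assumes "f \<in> Linf_space S"
  shows "\<exists>M\<ge>0. AE x in lebesgue_on S. \<bar>f x\<bar> \<le> M"
proof -
  obtain M where "AE x in lebesgue_on S. \<bar>f x\<bar> \<le> M" using assms by (auto simp: Linf_space_def)
  then have "AE x in lebesgue_on S. \<bar>f x\<bar> \<le> max M 0" by eventually_elim simp
  then show ?thesis by (intro exI[of _ "max M 0"]) simp
qed

lemma state_term_square_integrable:
  fixes \<Omega> :: "(real ^ 'n) set"
  assumes O: "\<Omega> \<in> sets lebesgue" and a: "standing_a s \<Omega> a" and a0: "(\<lambda>x. a x 0) \<in> Lp_space 2 \<Omega>"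
    and u: "u \<in> Lp_space 2 \<Omega>" "AE x in lebesgue_on \<Omega>. \<bar>u x\<bar> \<le> M" and M: "0 \<le> M"
  shows "(\<lambda>x. a x (u x)) \<in> Lp_space 2 \<Omega>"
proof -
  obtain C where C: "0 < C" and AC: "AE x in lebesgue_on \<Omega>. \<bar>D1 a x (u x)\<bar> \<le> C \<and> \<bar>a x (u x) - a x 0\<bar> \<le> C * \<bar>u x\<bar> \<and>
     (\<forall>d. \<bar>d\<bar> \<le> 1 \<longrightarrow> \<bar>a x (u x + d) - a x (u x) - D1 a x (u x) * d\<bar> \<le> C * d\<^sup>2)"
    using standing_a_local_bounds[OF a u(2) M] by blast
  have am: "(\<lambda>x. a x (u x)) \<in> borel_measurable (lebesgue_on \<Omega>)"
  proof -
    have ac: "caratheodory \<Omega> a" using a by (simp add: standing_a_def)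
    have um: "u \<in> borel_measurable (lebesgue_on \<Omega>)" using u(1) by (simp add: Lp_space_2_iff)
    show ?thesis by (rule caratheodory_composition[OF O ac um])
  qed
  have "integrable (lebesgue_on \<Omega>) (\<lambda>x. (a x (u x))\<^sup>2)"
  proof (rule square_integrable_add_multiple[OF am])
    show "integrable (lebesgue_on \<Omega>) (\<lambda>x. (a x 0)\<^sup>2)" "integrable (lebesgue_on \<Omega>) (\<lambda>x. (u x)\<^sup>2)"
      using a0 u(1) by (auto simp: Lp_space_2_iff)
    show "AE x in lebesgue_on \<Omega>. \<bar>a x (u x)\<bar> \<le> \<bar>a x 0\<bar> + C * \<bar>u x\<bar>" using AC by eventually_elim linarith
  qed (use C in simp)
  then show ?thesis using am by (simp add: Lp_space_2_iff)
qed

lemma adjoint_rhs_square_integrable: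
  fixes \<Omega> :: "(real ^ 'n) set"
  assumes lm: "\<Omega> \<in> lmeasurable" and L: "standing_L s \<Omega> L" and r2: "2 \<le> real CARD('n) / (2 * s)"
    and u: "u \<in> borel_measurable (lebesgue_on \<Omega>)" "AE x in lebesgue_on \<Omega>. \<bar>u x\<bar> \<le> M" and M: "0 \<le> M"
  shows "(\<lambda>x. D1 L x (u x)) \<in> Lp_space 2 \<Omega>"
proof -
  obtain \<psi> \<phi> where \<psi>: "integrable (lebesgue_on \<Omega>) (\<lambda>x. (\<psi> x)\<^sup>2)"
    and AL: "AE x in lebesgue_on \<Omega>. \<bar>D1 L x (u x)\<bar> \<le> \<psi> x \<and> \<bar>L x (u x) - L x 0\<bar> \<le> \<psi> x * \<bar>u x\<bar> \<and>
     (\<forall>d. \<bar>d\<bar> \<le> 1 \<longrightarrow> \<bar>L x (u x + d) - L x (u x) - D1 L x (u x) * d\<bar> \<le> \<phi> x * d\<^sup>2)"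
    using standing_L_local_bounds[OF L u(2) M r2 lm] by (elim exE conjE) (rule that)
  have Lm: "(\<lambda>x. D1 L x (u x)) \<in> borel_measurable (lebesgue_on \<Omega>)"
    using L by (intro D1_composition_measurable[OF fmeasurableD[OF lm] _ _ u(1)]) (simp_all add: standing_L_def)
  have "integrable (lebesgue_on \<Omega>) (\<lambda>x. (D1 L x (u x))\<^sup>2)"
  proof (rule square_integrable_add_multiple[OF Lm \<psi> \<psi>, of 0])
    show "AE x in lebesgue_on \<Omega>. \<bar>D1 L x (u x)\<bar> \<le> \<bar>\<psi> x\<bar> + 0 * \<bar>\<psi> x\<bar>" using AL by eventually_elim linarith
  qed simp
  then show ?thesis using Lm by (simp add: Lp_space_2_iff)
qed

text \<open>Let \<open>\<zeta>\<close> be the projection and perturb the control to \<open>zb + t * (\<zeta> - zb)\<close>. The state changes by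
  \<open>\<delta>\<close> with \<open>\<bar>\<delta>\<bar> \<le> const * t\<close>. The first-order change of the cost in \<open>\<delta>\<close> is rewritten by means of the
  adjoint equation tested with \<open>\<delta>\<close> and the equation for \<open>\<delta>\<close> tested with \<open>pb\<close>. Up to terms of order
  \<open>t\<^sup>2\<close> the cost therefore changes by \<open>t\<close> times the integral of \<open>(\<zeta> - zb) * (pb + \<alpha> * zb)\<close>, which local
  optimality forces to be nonnegative. But the integrand is at most \<open>- \<alpha> * (\<zeta> - zb)\<^sup>2\<close>, because \<open>\<zeta>\<close> is a
  projection.\<close>

lemma control_is_projection:
  fixes \<Omega> :: "(real ^ 'n) set"
  assumes dom: "bounded_lipschitz_domain \<Omega>" and s: "0 < s" "s < 1 / 2" and dim: "CARD('n) \<ge> 2"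
    and a: "standing_a s \<Omega> a" and L: "standing_L s \<Omega> L" and a0: "(\<lambda>x. a x 0) \<in> Lp_space 2 \<Omega>"
    and alpha: "\<alpha> > 0" and bounds: "lo < hi"
    and triplet: "optimal_triplet s \<Omega> a L \<alpha> lo hi ub pb zb"
  shows "AE x in lebesgue_on \<Omega>. zb x = max lo (min hi (- pb x / \<alpha>))"
proof -
  define M where "M = lebesgue_on \<Omega>"
  have op: "open \<Omega>" "bounded \<Omega>" using dom by (auto simp: bounded_lipschitz_domain_def)
  then have O: "\<Omega> \<in> sets lebesgue" "bounded \<Omega>" and lm: "\<Omega> \<in> lmeasurable" by (auto simp: lmeasurable_open)
  interpret finite_measure M unfolding M_def using lm by (rule finite_measure_lebesgue_on)
  note HE = tilde_H_eq_energy_space[OF dom, of s]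
  define E where "E = energy_space s \<Omega>"
  define c where "c = frac_const CARD('n) s"
  have c: "0 < c" using s by (simp add: c_def frac_const_pos)
  have ff: "frac_form s v w = c / 2 * energy_inner s v w" for v w :: "real ^ 'n \<Rightarrow> real"
    by (simp add: frac_form_eq energy_inner_def c_def)
  have opt: "locally_optimal s \<Omega> a L \<alpha> lo hi zb" and state: "is_state s \<Omega> a zb ub" and adj: "is_adjoint_state s \<Omega> a L ub pb"
    using triplet by (auto simp: optimal_triplet_def)
  have zad: "zb \<in> Z_ad \<Omega> lo hi" using opt by (simp add: locally_optimal_def)
  have zm [measurable]: "zb \<in> borel_measurable M" and z2: "integrable M (\<lambda>x. (zb x)\<^sup>2)" and zb: "AE x in M. lo \<le> zb x \<and> zb x \<le> hi"
    using zad unfolding Z_ad_def Lp_space_2_iff M_def by auto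
  have ubE: "ub \<in> E" and ubL: "ub \<in> Linf_space \<Omega>" and pbE: "pb \<in> E" and pbL: "pb \<in> Linf_space \<Omega>"
    using state adj HE by (auto simp: is_state_def is_adjoint_state_def E_def)
  obtain m where m: "0 \<le> m" "AE x in M. \<bar>ub x\<bar> \<le> m" using Linf_space_bound[OF ubL] unfolding M_def by blast
  obtain P where P: "0 \<le> P" "AE x in M. \<bar>pb x\<bar> \<le> P" using Linf_space_bound[OF pbL] unfolding M_def by blast
  have Em: "v \<in> borel_measurable M" and E2: "integrable M (\<lambda>x. (v x)\<^sup>2)" if "v \<in> E" for v
    using energy_space_on[of v s \<Omega>] that O unfolding M_def E_def by auto
  note [measurable] = Em[OF ubE] Em[OF pbE]
  have ac: "caratheodory \<Omega> a" and Lc: "caratheodory \<Omega> L" and a2: "C2_second \<Omega> a" and L2: "C2_second \<Omega> L"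
    using a L by (auto simp: standing_a_def standing_L_def)
  obtain C where C: "0 < C" and AC: "AE x in M. \<bar>D1 a x (ub x)\<bar> \<le> C \<and> \<bar>a x (ub x) - a x 0\<bar> \<le> C * \<bar>ub x\<bar> \<and>
     (\<forall>d. \<bar>d\<bar> \<le> 1 \<longrightarrow> \<bar>a x (ub x + d) - a x (ub x) - D1 a x (ub x) * d\<bar> \<le> C * d\<^sup>2)"
    using standing_a_local_bounds[OF a _ m(1), of ub] m(2) unfolding M_def by blast
  have r2: "2 \<le> real CARD('n) / (2 * s)"
  proof -
    have "2 * (2 * s) \<le> real CARD('n)" using s dim by linarith
    then show ?thesis using s by (simp add: pos_le_divide_eq)
  qed
  obtain \<psi> \<phi> where \<psi>: "\<psi> \<in> borel_measurable M" "integrable M (\<lambda>x. (\<psi> x)\<^sup>2)" "integrable M \<psi>" and \<phi>: "integrable M \<phi>"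
    and AL: "AE x in M. \<bar>D1 L x (ub x)\<bar> \<le> \<psi> x \<and> \<bar>L x (ub x) - L x 0\<bar> \<le> \<psi> x * \<bar>ub x\<bar> \<and>
     (\<forall>d. \<bar>d\<bar> \<le> 1 \<longrightarrow> \<bar>L x (ub x + d) - L x (ub x) - D1 L x (ub x) * d\<bar> \<le> \<phi> x * d\<^sup>2)"
    using standing_L_local_bounds[OF L _ m(1) r2 lm, of ub] m(2) unfolding M_def by blast
  have am [measurable]: "(\<lambda>x. a x (ub x)) \<in> borel_measurable M" "(\<lambda>x. L x (ub x)) \<in> borel_measurable M"
    "(\<lambda>x. D1 a x (ub x)) \<in> borel_measurable M" "(\<lambda>x. D1 L x (ub x)) \<in> borel_measurable M"
    using caratheodory_composition[OF O(1) ac] caratheodory_composition[OF O(1) Lc]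
      D1_composition_measurable[OF O(1) ac a2] D1_composition_measurable[OF O(1) Lc L2] Em[OF ubE] by (auto simp: M_def)
  have r: "ub \<in> Lp_space 2 \<Omega>" using Em[OF ubE] E2[OF ubE] by (simp add: Lp_space_2_iff M_def)
  have asq: "integrable M (\<lambda>x. (a x (ub x))\<^sup>2)"
    using state_term_square_integrable[OF O(1) a a0 r m(2)[unfolded M_def] m(1)] by (simp add: Lp_space_2_iff M_def)
  have D1Lsq: "integrable M (\<lambda>x. (D1 L x (ub x))\<^sup>2)"
    using adjoint_rhs_square_integrable[OF lm L r2 _ m(2)[unfolded M_def] m(1)] r by (simp add: Lp_space_2_iff M_def)
  have Li: "integrable M (\<lambda>x. L x (ub x))"
  proof (rule Bochner_Integration.integrable_bound[OF _ am(2)])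
    have "integrable M (\<lambda>x. \<bar>L x 0\<bar>)" using L by (auto simp: standing_L_def Lp_space_def M_def)
    then show "integrable M (\<lambda>x. \<bar>L x 0\<bar> + \<psi> x * m)" using \<psi>(3) by simp
    show "AE x in M. norm (L x (ub x)) \<le> norm (\<bar>L x 0\<bar> + \<psi> x * m)"
      using AL m(2)
    proof eventually_elim
      case (elim x)
      have "0 \<le> \<psi> x" using elim by linarith
      then have "\<psi> x * \<bar>ub x\<bar> \<le> \<psi> x * m" using elim by (intro mult_left_mono) auto
      then have "\<bar>L x (ub x)\<bar> \<le> \<bar>L x 0\<bar> + \<psi> x * m" using elim by linarith
      then show ?case unfolding real_norm_def by (rule order_trans[OF _ abs_ge_self])
    qed
  qed
  define \<zeta> where "\<zeta> = (\<lambda>x. max lo (min hi (- pb x / \<alpha>)))"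
  define \<eta> where "\<eta> = (\<lambda>x. \<zeta> x - zb x)"
  define D where "D = hi - lo"
  have D: "0 < D" using bounds by (simp add: D_def)
  have \<zeta>b: "lo \<le> \<zeta> x" "\<zeta> x \<le> hi" for x using bounds by (auto simp: \<zeta>_def)
  have \<eta>m [measurable]: "\<eta> \<in> borel_measurable M" unfolding \<eta>_def \<zeta>_def by measurable
  have \<eta>b: "AE x in M. \<bar>\<eta> x\<bar> \<le> D"
    using zb
  proof eventually_elim
    case (elim x)
    then show ?case using \<zeta>b[of x] unfolding \<eta>_def D_def by linarith
  qed
  have \<eta>2: "integrable M (\<lambda>x. (\<eta> x)\<^sup>2)"
  proof (rule integrable_const_bound[of _ "D\<^sup>2"])
    show "AE x in M. norm ((\<eta> x)\<^sup>2) \<le> D\<^sup>2"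
      using \<eta>b
    proof eventually_elim
      case (elim x)
      have "\<bar>\<eta> x\<bar>\<^sup>2 \<le> D\<^sup>2" using elim by (rule power_mono) simp
      then show ?case by simp
    qed
  qed measurable
  have pi: "integrable M (\<lambda>x. f x * g x)" if "f \<in> borel_measurable M" "g \<in> borel_measurable M" "integrable M (\<lambda>x. (f x)\<^sup>2)" "integrable M (\<lambda>x. (g x)\<^sup>2)" for f g :: "real ^ 'n \<Rightarrow> real"
    using that by (rule integrable_mult_of_squares)
  define h0 where "h0 = (\<lambda>x. indicator \<Omega> x *\<^sub>R \<eta> x)"
  have h0m: "h0 \<in> borel_measurable lebesgue"
    using \<eta>m O borel_measurable_restrict_space_iff[of \<Omega> lebesgue \<eta>] by (simp add: h0_def M_def)
  have h02: "integrable lebesgue (\<lambda>x. (h0 x)\<^sup>2)"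
  proof -
    have "(\<lambda>x. (h0 x)\<^sup>2) = (\<lambda>x. indicator \<Omega> x *\<^sub>R (\<eta> x)\<^sup>2)" by (auto simp: h0_def indicator_def)
    then show ?thesis using \<eta>2 O integrable_restrict_space[of \<Omega> lebesgue "\<lambda>x. (\<eta> x)\<^sup>2"] by (simp add: M_def)
  qed
  have h0v: "(\<integral>x. h0 x * v x \<partial>lebesgue) = (\<integral>x. \<eta> x * v x \<partial>M)" for v
    using O integral_restrict_space[of \<Omega> lebesgue "\<lambda>x. \<eta> x * v x"] by (simp add: h0_def M_def mult.assoc)
  have h0b: "AE x in lebesgue. \<bar>h0 x\<bar> \<le> D"
  proof -
    have "AE x in lebesgue. x \<in> \<Omega> \<longrightarrow> \<bar>\<eta> x\<bar> \<le> D" using \<eta>b O unfolding M_def by (simp add: AE_restrict_space_iff)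
    then show ?thesis by eventually_elim (use D in \<open>auto simp: h0_def indicator_def\<close>)
  qed
  have ubM: "ub \<in> borel_measurable (lebesgue_on \<Omega>)" "AE x in lebesgue_on \<Omega>. \<bar>ub x\<bar> \<le> m"
    using Em[OF ubE] m(2) unfolding M_def by this+
  obtain \<kappa> where k: "0 < \<kappa>" and pert: "\<forall>H h. 0 < H \<longrightarrow> \<kappa> * H \<le> 1 \<longrightarrow> h \<in> borel_measurable lebesgue \<longrightarrow> integrable lebesgue (\<lambda>x. (h x)\<^sup>2) \<longrightarrow>
     (AE x in lebesgue. \<bar>h x\<bar> \<le> H) \<longrightarrow>
     (\<exists>\<delta>\<in>E. (AE x in lebesgue. \<bar>\<delta> x\<bar> \<le> \<kappa> * H) \<and>
        (\<forall>v\<in>E. integrable M (\<lambda>x. (a x (ub x + \<delta> x) - a x (ub x)) * v x) \<and>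
          c / 2 * energy_inner s \<delta> v + (\<integral>x. (a x (ub x + \<delta> x) - a x (ub x)) * v x \<partial>M) = (\<integral>x. h x * v x \<partial>lebesgue)))"
    using perturbed_state[OF O s(1) c a ubM m(1)] unfolding M_def E_def by blast
  obtain \<rho> where \<rho>: "0 < \<rho>" and locopt: "\<And>z u. z \<in> Z_ad \<Omega> lo hi \<Longrightarrow> L2_norm \<Omega> (\<lambda>x. z x - zb x) \<le> \<rho> \<Longrightarrow>
      is_state s \<Omega> a z u \<Longrightarrow> cost \<Omega> L \<alpha> ub zb \<le> cost \<Omega> L \<alpha> u z"
    using opt state unfolding locally_optimal_def by blast
  define X where "X = (\<integral>x. \<eta> x * (pb x + \<alpha> * zb x) \<partial>M)"
  define Y where "Y = (\<kappa> * D)\<^sup>2 * (C * P * measure M (space M) + (\<integral>x. \<phi> x \<partial>M)) + \<alpha> / 2 * (\<integral>x. (\<eta> x)\<^sup>2 \<partial>M)"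
  have expand: "0 \<le> t * X + t\<^sup>2 * Y" if t: "0 < t" "t \<le> 1" "\<kappa> * (t * D) \<le> 1" "t * L2_norm \<Omega> \<eta> \<le> \<rho>" for t
  proof -
    define H where "H = t * D"
    have H: "0 < H" using t D by (simp add: H_def)
    have th: "(\<lambda>x. t * h0 x) \<in> borel_measurable lebesgue" "integrable lebesgue (\<lambda>x. (t * h0 x)\<^sup>2)"
      using h0m h02 by (auto simp: power_mult_distrib)
    have "AE x in lebesgue. \<bar>t * h0 x\<bar> \<le> H"
      using h0b by eventually_elim (use t in \<open>auto simp: H_def abs_mult intro: mult_left_mono\<close>)
    from pert[rule_format, OF H _ th this] t obtain \<delta> where d: "\<delta> \<in> E" and db': "AE x in lebesgue. \<bar>\<delta> x\<bar> \<le> \<kappa> * H"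
      and eq: "\<And>v. v \<in> E \<Longrightarrow> integrable M (\<lambda>x. (a x (ub x + \<delta> x) - a x (ub x)) * v x) \<and>
          c / 2 * energy_inner s \<delta> v + (\<integral>x. (a x (ub x + \<delta> x) - a x (ub x)) * v x \<partial>M) = (\<integral>x. (t * h0 x) * v x \<partial>lebesgue)"
      unfolding H_def by blast
    note [measurable] = Em[OF d]
    have kH: "\<kappa> * H \<le> 1" using t by (simp add: H_def)
    have db: "AE x in M. \<bar>\<delta> x\<bar> \<le> \<kappa> * H"
      unfolding M_def using db' O by (subst AE_restrict_space_iff) (auto elim: eventually_mono)
    define u where "u = (\<lambda>x. ub x + \<delta> x)"
    define z where "z = (\<lambda>x. zb x + t * \<eta> x)"
    have uE: "u \<in> E" using ubE d unfolding u_def E_def by (rule energy_space_add)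
    note [measurable] = Em[OF uE]
    have zm' [measurable]: "z \<in> borel_measurable M" unfolding z_def by measurable
    have ei: "c / 2 * energy_inner s \<delta> v + (\<integral>x. (a x (u x) - a x (ub x)) * v x \<partial>M) = t * (\<integral>x. \<eta> x * v x \<partial>M)" if "v \<in> E" for v
      using eq[OF that] h0v[of v] by (simp add: u_def mult.assoc)
    have z_ad: "z \<in> Z_ad \<Omega> lo hi"
    proof -
      have "integrable M (\<lambda>x. (z x)\<^sup>2)"
        by (rule square_integrable_add_multiple[OF zm' z2 \<eta>2, of t])
          (use t in \<open>auto simp: z_def abs_mult intro!: AE_I2 order_trans[OF abs_triangle_ineq]\<close>)
      moreover have "AE x in M. lo \<le> z x \<and> z x \<le> hi"
        using zb
      proof eventually_elim
        case (elim x)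
        have "z x = (1 - t) * zb x + t * \<zeta> x" by (simp add: z_def \<eta>_def algebra_simps)
        moreover have "(1 - t) * lo + t * lo \<le> (1 - t) * zb x + t * \<zeta> x" "(1 - t) * zb x + t * \<zeta> x \<le> (1 - t) * hi + t * hi"
          using elim t \<zeta>b[of x] by (intro add_mono mult_left_mono; simp)+
        ultimately show ?case by (simp add: left_diff_distrib)
      qed
      ultimately show ?thesis using zm' unfolding Z_ad_def Lp_space_2_iff M_def by blast
    qed
    have near: "L2_norm \<Omega> (\<lambda>x. z x - zb x) \<le> \<rho>"
    proof -
      have "L2_norm \<Omega> (\<lambda>x. z x - zb x) = sqrt (t\<^sup>2 * (\<integral>x. \<eta> x * \<eta> x \<partial>lebesgue_on \<Omega>))"
        by (simp add: L2_norm_def L2_inner_def z_def power2_eq_square mult_ac)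
      also have "\<dots> = t * L2_norm \<Omega> \<eta>" using t by (simp add: real_sqrt_mult L2_norm_def L2_inner_def)
      finally show ?thesis using t by simp
    qed
    have st: "is_state s \<Omega> a z u"
      unfolding is_state_def HE
    proof (intro conjI IntI ballI)
      show "u \<in> energy_space s \<Omega>" using uE by (simp add: E_def)
      have "AE x in M. \<bar>u x\<bar> \<le> m + \<kappa> * H" using m(2) db by eventually_elim (simp add: u_def)
      then show "u \<in> Linf_space \<Omega>" using Em[OF uE] unfolding Linf_space_def M_def by blast
      fix v assume "v \<in> energy_space s \<Omega>"
      then have v: "v \<in> E" by (simp add: E_def)
      note [measurable] = Em[OF v]
      have i: "integrable M (\<lambda>x. a x (ub x) * v x)" "integrable M (\<lambda>x. (a x (u x) - a x (ub x)) * v x)"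
        "integrable M (\<lambda>x. zb x * v x)" "integrable M (\<lambda>x. \<eta> x * v x)"
        using eq[OF v] Em[OF v] E2[OF v] asq am z2 zm \<eta>2 \<eta>m by (auto intro!: pi simp: u_def)
      have "(\<integral>x. a x (u x) * v x \<partial>M) = (\<integral>x. a x (ub x) * v x + (a x (u x) - a x (ub x)) * v x \<partial>M)"
        by (simp add: algebra_simps)
      also have "\<dots> = (\<integral>x. a x (ub x) * v x \<partial>M) + (\<integral>x. (a x (u x) - a x (ub x)) * v x \<partial>M)" using i by simp
      finally have 1: "(\<integral>x. a x (u x) * v x \<partial>M) = (\<integral>x. a x (ub x) * v x \<partial>M) + (\<integral>x. (a x (u x) - a x (ub x)) * v x \<partial>M)" .
      have "(\<integral>x. z x * v x \<partial>M) = (\<integral>x. zb x * v x + t * (\<eta> x * v x) \<partial>M)" by (simp add: z_def algebra_simps)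
      also have "\<dots> = (\<integral>x. zb x * v x \<partial>M) + t * (\<integral>x. \<eta> x * v x \<partial>M)" using i by simp
      finally have 2: "(\<integral>x. z x * v x \<partial>M) = (\<integral>x. zb x * v x \<partial>M) + t * (\<integral>x. \<eta> x * v x \<partial>M)" .
      have 3: "c / 2 * energy_inner s ub v + (\<integral>x. a x (ub x) * v x \<partial>M) = (\<integral>x. zb x * v x \<partial>M)"
        using state v HE by (simp add: is_state_def ff L2_inner_def M_def E_def)
      have "energy_inner s u v = energy_inner s ub v + energy_inner s \<delta> v"
        unfolding u_def using ubE d v unfolding E_def by (intro energy_inner_add_left)
      then show "frac_form s u v + L2_inner \<Omega> (\<lambda>x. a x (u x)) v = L2_inner \<Omega> z v"
        using 1 2 3 ei[OF v] by (simp add: ff L2_inner_def M_def[symmetric] distrib_left)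
    qed
    have "cost \<Omega> L \<alpha> ub zb \<le> cost \<Omega> L \<alpha> u z" by (rule locopt[OF z_ad near st])
    then have cost: "0 \<le> (\<integral>x. L x (u x) \<partial>M) - (\<integral>x. L x (ub x) \<partial>M) + \<alpha> / 2 * ((\<integral>x. (z x)\<^sup>2 \<partial>M) - (\<integral>x. (zb x)\<^sup>2 \<partial>M))"
      by (simp add: cost_def L2_norm_square M_def algebra_simps)
    have zexp: "(\<integral>x. (z x)\<^sup>2 \<partial>M) = (\<integral>x. (zb x)\<^sup>2 \<partial>M) + 2 * t * (\<integral>x. \<eta> x * zb x \<partial>M) + t\<^sup>2 * (\<integral>x. (\<eta> x)\<^sup>2 \<partial>M)"
    proof -
      have "(\<lambda>x. (z x)\<^sup>2) = (\<lambda>x. (zb x)\<^sup>2 + 2 * t * (\<eta> x * zb x) + t\<^sup>2 * (\<eta> x)\<^sup>2)"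
        by (auto simp: z_def power2_eq_square algebra_simps)
      then show ?thesis using z2 \<eta>2 pi[OF \<eta>m zm \<eta>2 z2] by simp
    qed
    define q where "q = (\<kappa> * H)\<^sup>2"
    have dq: "AE x in M. (\<delta> x)\<^sup>2 \<le> q \<and> \<bar>\<delta> x\<bar> \<le> 1"
      using db
    proof eventually_elim
      case (elim x)
      have "\<bar>\<delta> x\<bar>\<^sup>2 \<le> (\<kappa> * H)\<^sup>2" using elim by (intro power_mono) auto
      then show ?case using elim kH by (simp add: q_def)
    qed
    have \<phi>0: "AE x in M. 0 \<le> \<phi> x"
      using AL
    proof eventually_elim
      case (elim x)
      then have "\<bar>L x (ub x + 1) - L x (ub x) - D1 L x (ub x) * 1\<bar> \<le> \<phi> x * 1\<^sup>2" by (metis abs_one order_refl)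
      then show ?case by simp
    qed
    have Lum: "(\<lambda>x. L x (u x)) \<in> borel_measurable M"
      using caratheodory_composition[OF O(1) Lc] Em[OF uE] by (auto simp: M_def)
    have D1i: "integrable M (\<lambda>x. D1 L x (ub x) * \<delta> x)" using am(4) D1Lsq Em[OF d] E2[OF d] by (intro pi)
    have Ltay: "AE x in M. \<bar>L x (u x) - L x (ub x) - D1 L x (ub x) * \<delta> x\<bar> \<le> \<phi> x * q"
      using AL dq \<phi>0
    proof eventually_elim
      case (elim x)
      have "\<bar>L x (u x) - L x (ub x) - D1 L x (ub x) * \<delta> x\<bar> \<le> \<phi> x * (\<delta> x)\<^sup>2" using elim by (simp add: u_def)
      also have "\<dots> \<le> \<phi> x * q" using elim by (intro mult_left_mono) auto
      finally show ?case .
    qed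
    have Lui: "integrable M (\<lambda>x. L x (u x))"
    proof (rule Bochner_Integration.integrable_bound[OF _ Lum])
      show "integrable M (\<lambda>x. \<bar>L x (ub x)\<bar> + \<bar>D1 L x (ub x) * \<delta> x\<bar> + \<phi> x * q)" using Li D1i \<phi> by auto
      show "AE x in M. norm (L x (u x)) \<le> norm (\<bar>L x (ub x)\<bar> + \<bar>D1 L x (ub x) * \<delta> x\<bar> + \<phi> x * q)"
        using Ltay by eventually_elim (unfold real_norm_def, linarith)
    qed
    have "(\<integral>x. L x (u x) \<partial>M) \<le> (\<integral>x. L x (ub x) + D1 L x (ub x) * \<delta> x + \<phi> x * q \<partial>M)"
      using Ltay Li D1i \<phi> Lui by (intro integral_mono_AE) (auto elim!: eventually_mono)
    also have "\<dots> = (\<integral>x. L x (ub x) \<partial>M) + (\<integral>x. D1 L x (ub x) * \<delta> x \<partial>M) + (\<integral>x. \<phi> x \<partial>M) * q" using Li D1i \<phi> by simp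
    finally have Lexp: "(\<integral>x. L x (u x) \<partial>M) - (\<integral>x. L x (ub x) \<partial>M) \<le> (\<integral>x. D1 L x (ub x) * \<delta> x \<partial>M) + (\<integral>x. \<phi> x \<partial>M) * q" by simp
    have adjd: "c / 2 * energy_inner s \<delta> pb + (\<integral>x. D1 a x (ub x) * pb x * \<delta> x \<partial>M) = (\<integral>x. D1 L x (ub x) * \<delta> x \<partial>M)"
      using adj d HE by (simp add: is_adjoint_state_def ff L2_inner_def M_def E_def)
    have Da: "integrable M (\<lambda>x. D1 a x (ub x) * pb x * \<delta> x)"
    proof (rule Bochner_Integration.integrable_bound)
      show "integrable M (\<lambda>x. C * (pb x * \<delta> x))" using pi[OF Em[OF pbE] Em[OF d] E2[OF pbE] E2[OF d]] by simp
      show "AE x in M. norm (D1 a x (ub x) * pb x * \<delta> x) \<le> norm (C * (pb x * \<delta> x))"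
        using AC
      proof eventually_elim
        case (elim x)
        have "\<bar>D1 a x (ub x)\<bar> * \<bar>pb x * \<delta> x\<bar> \<le> C * \<bar>pb x * \<delta> x\<bar>" using elim by (intro mult_right_mono) auto
        then show ?case using C by (simp add: abs_mult mult.assoc)
      qed
    qed measurable
    have "(\<integral>x. D1 a x (ub x) * pb x * \<delta> x \<partial>M) - (\<integral>x. (a x (u x) - a x (ub x)) * pb x \<partial>M)
        = (\<integral>x. D1 a x (ub x) * pb x * \<delta> x - (a x (u x) - a x (ub x)) * pb x \<partial>M)"
      using Da eq[OF pbE] by (simp add: u_def)
    also have "\<dots> \<le> (\<integral>x. C * q * P \<partial>M)"
    proof (intro integral_mono_AE)
      show "integrable M (\<lambda>x. D1 a x (ub x) * pb x * \<delta> x - (a x (u x) - a x (ub x)) * pb x)" using Da eq[OF pbE] by (simp add: u_def)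
      show "AE x in M. D1 a x (ub x) * pb x * \<delta> x - (a x (u x) - a x (ub x)) * pb x \<le> C * q * P"
        using AC dq P(2)
      proof eventually_elim
        case (elim x)
        have "D1 a x (ub x) * pb x * \<delta> x - (a x (u x) - a x (ub x)) * pb x
            = - (a x (ub x + \<delta> x) - a x (ub x) - D1 a x (ub x) * \<delta> x) * pb x"
          by (simp add: u_def algebra_simps)
        also have "\<dots> \<le> \<bar>a x (ub x + \<delta> x) - a x (ub x) - D1 a x (ub x) * \<delta> x\<bar> * \<bar>pb x\<bar>"
          by (metis abs_ge_self abs_minus_cancel abs_mult)
        also have "\<dots> \<le> (C * (\<delta> x)\<^sup>2) * P" using elim C by (intro mult_mono) auto
        also have "\<dots> \<le> (C * q) * P" using elim C P by (intro mult_right_mono mult_left_mono) auto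
        finally show ?case .
      qed
    qed simp
    also have "\<dots> = C * q * P * measure M (space M)" by simp
    finally have aexp: "(\<integral>x. D1 a x (ub x) * pb x * \<delta> x \<partial>M) - (\<integral>x. (a x (u x) - a x (ub x)) * pb x \<partial>M) \<le> C * q * P * measure M (space M)" .
    have "(\<integral>x. D1 L x (ub x) * \<delta> x \<partial>M) \<le> t * (\<integral>x. \<eta> x * pb x \<partial>M) + C * q * P * measure M (space M)"
      using aexp adjd ei[OF pbE] by linarith
    then have "0 \<le> t * (\<integral>x. \<eta> x * pb x \<partial>M) + C * q * P * measure M (space M) + (\<integral>x. \<phi> x \<partial>M) * q
        + \<alpha> / 2 * (2 * t * (\<integral>x. \<eta> x * zb x \<partial>M) + t\<^sup>2 * (\<integral>x. (\<eta> x)\<^sup>2 \<partial>M))"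
      using cost Lexp unfolding zexp by (simp add: add.assoc)
    also have "\<dots> = t * X + t\<^sup>2 * Y"
    proof -
      have "X = (\<integral>x. \<eta> x * pb x + \<alpha> * (\<eta> x * zb x) \<partial>M)" unfolding X_def by (simp add: algebra_simps)
      also have "\<dots> = (\<integral>x. \<eta> x * pb x \<partial>M) + \<alpha> * (\<integral>x. \<eta> x * zb x \<partial>M)"
        using pi[OF \<eta>m Em[OF pbE] \<eta>2 E2[OF pbE]] pi[OF \<eta>m zm \<eta>2 z2] by simp
      finally have X': "X = (\<integral>x. \<eta> x * pb x \<partial>M) + \<alpha> * (\<integral>x. \<eta> x * zb x \<partial>M)" .
      have q': "q = t\<^sup>2 * (\<kappa> * D)\<^sup>2" by (simp add: q_def H_def power_mult_distrib)
      show ?thesis unfolding X' Y_def q' by (simp add: algebra_simps)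
    qed
    finally show ?thesis .
  qed
  have "0 \<le> X"
  proof (rule ccontr)
    assume "\<not> 0 \<le> X"
    then have X: "X < 0" by simp
    define N where "N = L2_norm \<Omega> \<eta>"
    have N: "0 \<le> N" by (simp add: N_def L2_norm_def L2_inner_def)
    \<comment> \<open>The first three bounds make the perturbation admissible; the last one makes \<open>t * Y\<close> smaller than \<open>- X\<close>.\<close>
    define t where "t = Min {1, 1 / (\<kappa> * D), \<rho> / (N + 1), - X / (2 * (\<bar>Y\<bar> + 1))}"
    have pos: "0 < 1 / (\<kappa> * D)" "0 < \<rho> / (N + 1)" "0 < - X / (2 * (\<bar>Y\<bar> + 1))"
      using k D \<rho> N X by (intro divide_pos_pos mult_pos_pos; linarith)+
    have t: "0 < t" "t \<le> 1" "t \<le> 1 / (\<kappa> * D)" "t \<le> \<rho> / (N + 1)" "t \<le> - X / (2 * (\<bar>Y\<bar> + 1))"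
      using pos by (auto simp: t_def)
    have 1: "\<kappa> * (t * D) \<le> 1" using t(3) k D by (simp add: pos_le_divide_eq mult_ac)
    have 2: "t * N \<le> \<rho>"
    proof -
      have "t * N \<le> t * (N + 1)" using t by (intro mult_left_mono) auto
      also have "\<dots> \<le> \<rho>" using t(4) N by (simp add: pos_le_divide_eq)
      finally show ?thesis .
    qed
    have "0 \<le> t * (X + t * Y)" using expand[OF t(1,2) 1] 2 by (simp add: N_def power2_eq_square algebra_simps)
    then have 3: "0 \<le> X + t * Y" using t(1) by (simp add: zero_le_mult_iff)
    have "t * Y \<le> t * (\<bar>Y\<bar> + 1)" using t by (intro mult_left_mono) auto
    also have "\<dots> \<le> - X / 2"
    proof -
      have "t * (2 * (\<bar>Y\<bar> + 1)) \<le> - X" using t(5) by (subst (asm) pos_le_divide_eq) auto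
      moreover have "t * (2 * (\<bar>Y\<bar> + 1)) = 2 * (t * (\<bar>Y\<bar> + 1))" by (rule mult.left_commute)
      ultimately show ?thesis by linarith
    qed
    finally show False using 3 X by simp
  qed
  also have "X \<le> (\<integral>x. - \<alpha> * (\<eta> x)\<^sup>2 \<partial>M)"
    unfolding X_def
  proof (intro integral_mono_AE)
    have "integrable M (\<lambda>x. \<eta> x * pb x + \<alpha> * (\<eta> x * zb x))"
      using pi[OF \<eta>m Em[OF pbE] \<eta>2 E2[OF pbE]] pi[OF \<eta>m zm \<eta>2 z2] by simp
    then show "integrable M (\<lambda>x. \<eta> x * (pb x + \<alpha> * zb x))" by (simp add: algebra_simps)
    show "integrable M (\<lambda>x. - \<alpha> * (\<eta> x)\<^sup>2)" using \<eta>2 by simp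
    show "AE x in M. \<eta> x * (pb x + \<alpha> * zb x) \<le> - \<alpha> * (\<eta> x)\<^sup>2"
      using zb
    proof eventually_elim
      case (elim x)
      define y where "y = - pb x / \<alpha>"
      have y: "pb x = - \<alpha> * y" using alpha by (simp add: y_def)
      have \<zeta>y: "\<zeta> x = max lo (min hi y)" unfolding \<zeta>_def y_def ..
      have "(y - \<zeta> x) * (zb x - \<zeta> x) \<le> 0"
      proof (cases "y \<le> lo")
        case True
        then have "\<zeta> x = lo" using bounds by (simp add: \<zeta>y)
        then show ?thesis using True elim by (intro mult_nonpos_nonneg) auto
      next
        case False
        show ?thesis
        proof (cases "hi \<le> y")
          case True
          then have "\<zeta> x = hi" using bounds by (simp add: \<zeta>y)
          then show ?thesis using True elim by (intro mult_nonneg_nonpos) auto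
        qed (use False in \<open>simp add: \<zeta>y\<close>)
      qed
      then have "\<alpha> * ((y - \<zeta> x) * (zb x - \<zeta> x)) \<le> 0" using alpha by (simp add: mult_le_0_iff)
      then show ?case unfolding y \<eta>_def by (simp add: power2_eq_square algebra_simps)
    qed
  qed
  finally have "\<alpha> * (\<integral>x. (\<eta> x)\<^sup>2 \<partial>M) \<le> 0" by simp
  then have "(\<integral>x. (\<eta> x)\<^sup>2 \<partial>M) \<le> 0" using alpha by (simp add: mult_le_0_iff)
  then have "(\<integral>x. (\<eta> x)\<^sup>2 \<partial>M) = 0" by (intro antisym) auto
  then have "AE x in M. (\<eta> x)\<^sup>2 = 0" using \<eta>2 by (subst (asm) integral_nonneg_eq_0_iff_AE) auto
  then have "AE x in M. zb x = \<zeta> x" by eventually_elim (simp add: \<eta>_def)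
  then show ?thesis unfolding M_def \<zeta>_def .
qed

theorem theorem4p5:
  fixes \<Omega> :: "(real ^ 'n) set"
    and a L :: "real ^ 'n \<Rightarrow> real \<Rightarrow> real"
    and s \<alpha> lo hi :: real
    and ub pb zb :: "real ^ 'n \<Rightarrow> real"
  assumes dim: "CARD('n) \<ge> 2"
    and s: "0 < s" "s < 1 / 2"
    and domain: "bounded_lipschitz_domain \<Omega>"
    and a: "standing_a s \<Omega> a"
    and L: "standing_L s \<Omega> L"
    and a_L2: "\<forall>m > 0. \<forall>u \<in> {-m..m}. (\<lambda>x. a x u) \<in> Lp_space 2 \<Omega>"
    and L_L2: "\<forall>m > 0. \<forall>u \<in> {-m..m}. (\<lambda>x. D1 L x u) \<in> Lp_space 2 \<Omega>"
    and alpha: "\<alpha> > 0"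
    and bounds: "lo < hi"
    and triplet: "optimal_triplet s \<Omega> a L \<alpha> lo hi ub pb zb"
  shows "\<forall>\<epsilon> \<in> {0<..<s}.
           ub \<in> sobolev_space (2 * s - 2 * \<epsilon>) \<Omega> \<and>
           pb \<in> sobolev_space (2 * s - 2 * \<epsilon>) \<Omega> \<and>
           zb \<in> sobolev_space (2 * s - 2 * \<epsilon>) \<Omega>"
proof
  fix \<epsilon> assume eps: "\<epsilon> \<in> {0<..<s}"
  define t where "t = 2 * s - 2 * \<epsilon>"
  have t: "0 < t" "t < 2 * s" using eps by (auto simp: t_def)
  define M where "M = lebesgue_on \<Omega>"
  have op: "open \<Omega>" "bounded \<Omega>" using domain by (auto simp: bounded_lipschitz_domain_def)
  then have O: "\<Omega> \<in> sets lebesgue" "bounded \<Omega>" and lm: "\<Omega> \<in> lmeasurable" by (auto simp: lmeasurable_open)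
  note HE = tilde_H_eq_energy_space[OF domain, of s]
  have state: "is_state s \<Omega> a zb ub" and adj: "is_adjoint_state s \<Omega> a L ub pb" and zad: "zb \<in> Z_ad \<Omega> lo hi"
    using triplet by (auto simp: optimal_triplet_def locally_optimal_def)
  have zL: "zb \<in> Lp_space 2 \<Omega>" using zad by (simp add: Z_ad_def)
  then have zm [measurable]: "zb \<in> borel_measurable M" and z2: "integrable M (\<lambda>x. (zb x)\<^sup>2)" by (auto simp: Lp_space_2_iff M_def)
  have uH: "ub \<in> tilde_H s \<Omega>" and pH: "pb \<in> tilde_H s \<Omega>" and ubL: "ub \<in> Linf_space \<Omega>"
    using state adj by (auto simp: is_state_def is_adjoint_state_def)
  have um [measurable]: "ub \<in> borel_measurable M" "pb \<in> borel_measurable M" and u2: "integrable M (\<lambda>x. (ub x)\<^sup>2)" "integrable M (\<lambda>x. (pb x)\<^sup>2)"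
    using energy_space_on[of ub s \<Omega>] energy_space_on[of pb s \<Omega>] uH pH HE O unfolding M_def by auto
  obtain m where m: "0 \<le> m" "AE x in M. \<bar>ub x\<bar> \<le> m" using Linf_space_bound[OF ubL] unfolding M_def by blast
  have ac: "caratheodory \<Omega> a" and Lc: "caratheodory \<Omega> L" and a2: "C2_second \<Omega> a" and L2: "C2_second \<Omega> L"
    using a L by (auto simp: standing_a_def standing_L_def)
  have am [measurable]: "(\<lambda>x. a x (ub x)) \<in> borel_measurable M"
    "(\<lambda>x. D1 a x (ub x)) \<in> borel_measurable M" "(\<lambda>x. D1 L x (ub x)) \<in> borel_measurable M"
    using caratheodory_composition[OF O(1) ac] D1_composition_measurable[OF O(1) ac a2] D1_composition_measurable[OF O(1) Lc L2] um
    by (auto simp: M_def)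
  obtain C where C: "0 < C" and AC: "AE x in M. \<bar>D1 a x (ub x)\<bar> \<le> C \<and> \<bar>a x (ub x) - a x 0\<bar> \<le> C * \<bar>ub x\<bar> \<and>
     (\<forall>d. \<bar>d\<bar> \<le> 1 \<longrightarrow> \<bar>a x (ub x + d) - a x (ub x) - D1 a x (ub x) * d\<bar> \<le> C * d\<^sup>2)"
    using standing_a_local_bounds[OF a _ m(1), of ub] m(2) unfolding M_def by blast
  have r2: "2 \<le> real CARD('n) / (2 * s)"
  proof -
    have "2 * (2 * s) \<le> real CARD('n)" using s dim by linarith
    then show ?thesis using s by (simp add: pos_le_divide_eq)
  qed
  have a0: "(\<lambda>x. a x 0) \<in> Lp_space 2 \<Omega>" using a_L2 by (auto dest!: spec[of _ 1])
  have ub2: "ub \<in> Lp_space 2 \<Omega>" using um(1) u2(1) by (simp add: Lp_space_2_iff M_def)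
  have asq: "integrable M (\<lambda>x. (a x (ub x))\<^sup>2)"
    using state_term_square_integrable[OF O(1) a a0 ub2 m(2)[unfolded M_def] m(1)] by (simp add: Lp_space_2_iff M_def)
  have ub: "ub \<in> sobolev_space t \<Omega>"
  proof (rule weak_solution_regularity[OF domain s uH _ _ _ t])
    show 1: "(\<lambda>x. zb x - a x (ub x)) \<in> borel_measurable (lebesgue_on \<Omega>)" unfolding M_def[symmetric] by measurable
    show "integrable (lebesgue_on \<Omega>) (\<lambda>x. (zb x - a x (ub x))\<^sup>2)"
      by (rule square_integrable_add_multiple[OF 1 z2[unfolded M_def] asq[unfolded M_def], of 1]) auto
    fix v assume v: "v \<in> tilde_H s \<Omega>"
    then have v': "v \<in> borel_measurable M" "integrable M (\<lambda>x. (v x)\<^sup>2)"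
      using energy_space_on[of v s \<Omega>] HE O unfolding M_def by auto
    have "L2_inner \<Omega> (\<lambda>x. zb x - a x (ub x)) v = L2_inner \<Omega> zb v - L2_inner \<Omega> (\<lambda>x. a x (ub x)) v"
      unfolding L2_inner_def M_def[symmetric] left_diff_distrib
      by (intro Bochner_Integration.integral_diff integrable_mult_of_squares zm z2 am asq v')
    then show "frac_form s ub v = L2_inner \<Omega> (\<lambda>x. zb x - a x (ub x)) v"
      using bspec[OF state[unfolded is_state_def, THEN conjunct2] v] by linarith
  qed
  have pb: "pb \<in> sobolev_space t \<Omega>"
  proof (rule weak_solution_regularity[OF domain s pH _ _ _ t])
    have D1Lsq: "integrable M (\<lambda>x. (D1 L x (ub x))\<^sup>2)"
      using adjoint_rhs_square_integrable[OF lm L r2 _ m(2)[unfolded M_def] m(1)] ub2 by (simp add: Lp_space_2_iff M_def)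
    have apm: "(\<lambda>x. D1 a x (ub x) * pb x) \<in> borel_measurable M" by measurable
    have apsq: "integrable M (\<lambda>x. (D1 a x (ub x) * pb x)\<^sup>2)"
    proof (rule square_integrable_add_multiple[OF apm _ u2(2), of "\<lambda>_. 0" C])
      show "AE x in M. \<bar>D1 a x (ub x) * pb x\<bar> \<le> \<bar>0\<bar> + C * \<bar>pb x\<bar>"
        using AC by eventually_elim (auto simp: abs_mult intro: mult_right_mono)
    qed (use C in auto)
    show 1: "(\<lambda>x. D1 L x (ub x) - D1 a x (ub x) * pb x) \<in> borel_measurable (lebesgue_on \<Omega>)" unfolding M_def[symmetric] by measurable
    show "integrable (lebesgue_on \<Omega>) (\<lambda>x. (D1 L x (ub x) - D1 a x (ub x) * pb x)\<^sup>2)"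
      by (rule square_integrable_add_multiple[OF 1 D1Lsq[unfolded M_def] apsq[unfolded M_def], of 1]) auto
    fix v assume v: "v \<in> tilde_H s \<Omega>"
    then have v': "v \<in> borel_measurable M" "integrable M (\<lambda>x. (v x)\<^sup>2)"
      using energy_space_on[of v s \<Omega>] HE O unfolding M_def by auto
    have "L2_inner \<Omega> (\<lambda>x. D1 L x (ub x) - D1 a x (ub x) * pb x) v = L2_inner \<Omega> (\<lambda>x. D1 L x (ub x)) v - L2_inner \<Omega> (\<lambda>x. D1 a x (ub x) * pb x) v"
      unfolding L2_inner_def M_def[symmetric] left_diff_distrib
      by (intro Bochner_Integration.integral_diff integrable_mult_of_squares am D1Lsq apm apsq v')
    moreover have "frac_form s v pb = frac_form s pb v"
      using energy_inner_commute[of s v pb] by (simp add: frac_form_eq energy_inner_def)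
    ultimately show "frac_form s pb v = L2_inner \<Omega> (\<lambda>x. D1 L x (ub x) - D1 a x (ub x) * pb x) v"
      using bspec[OF adj[unfolded is_adjoint_state_def, THEN conjunct2] v] by linarith
  qed
  have "AE x in lebesgue_on \<Omega>. zb x = max lo (min hi (- pb x / \<alpha>))"
    by (rule control_is_projection[OF domain s dim a L a0 alpha bounds triplet])
  moreover have "\<bar>max lo (min hi (- p / \<alpha>)) - max lo (min hi (- q / \<alpha>))\<bar> \<le> 1 / \<alpha> * \<bar>p - q\<bar>" for p q
  proof -
    have "\<bar>max lo (min hi (- p / \<alpha>)) - max lo (min hi (- q / \<alpha>))\<bar> \<le> \<bar>- p / \<alpha> - - q / \<alpha>\<bar>" by linarith
    also have "- p / \<alpha> - - q / \<alpha> = (q - p) / \<alpha>" by (simp add: diff_divide_distrib)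
    also have "\<bar>(q - p) / \<alpha>\<bar> = 1 / \<alpha> * \<bar>p - q\<bar>" using alpha by (simp add: abs_minus_commute)
    finally show ?thesis .
  qed
  ultimately have "zb \<in> sobolev_space t \<Omega>"
    using sobolev_space_Lipschitz_image[OF pb zL O(1), of "\<lambda>p. max lo (min hi (- p / \<alpha>))" "1 / \<alpha>"] by blast
  then show "ub \<in> sobolev_space (2 * s - 2 * \<epsilon>) \<Omega> \<and> pb \<in> sobolev_space (2 * s - 2 * \<epsilon>) \<Omega> \<and> zb \<in> sobolev_space (2 * s - 2 * \<epsilon>) \<Omega>"
    using ub pb by (simp add: t_def)
qed

end
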